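(* Let $X$ be a complex $3$-torus and $f\in\mathrm{Aut}(X)$ with $\lambda_1(f)>1$. If $\lambda_1(f)$ is a Salem number, then $X$ admits a non-trivial $f$-equivariant holomorphic fibration.
   Context: A complex $n$-torus is a quotient $\mathbf{C}^n/L$ with $L\subset\mathbf{C}^n$ a discrete subgroup of rank $2n$. $\mathrm{Aut}(X)$ is the group of all biholomorphic self-maps of $X$ (not necessarily fixing the origin). For $f\in\mathrm{Aut}(X)$, the $p$-th dynamical degree $\lambda_p(f)$ is the spectral radius of $f^*$ on $H^{p,p}(X)$. A non-trivial $f$-equivariant holomorphic fibration is a surjective holomorphic map $\pi:X\to Y$ with connected fibers onto a normal Kähler complex analytic space $Y$ with $0<\dim Y<\dim X$, for which there is $g\in\mathrm{Aut}(Y)$ with $\pi\circ f=g\circ\pi$. A Salem number is a real algebraic integer $\lambda>1$ such that $1/\lambda$ is a Galois conjugate of $\lambda$ and all Galois conjugates other than $\lambda,1/\lambda$ have absolute value $1$ (degree $2$ is allowed). *)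

theory Defs
  imports
    "HOL-Analysis.Analysis"
    "HOL-Computational_Algebra.Computational_Algebra"
begin

section \<open>Salem numbers\<close>

definition galois_conjugate :: "complex \<Rightarrow> complex \<Rightarrow> bool" where
  "galois_conjugate x z \<longleftrightarrow>
     (\<exists>p :: rat poly. irreducible p \<and> poly (map_poly of_rat p) x = 0 \<and> poly (map_poly of_rat p) z = 0)"

definition salem_number :: "real \<Rightarrow> bool" where
  "salem_number l \<longleftrightarrow>
     algebraic_int l \<and> l > 1 \<and>
     galois_conjugate (of_real l) (of_real (1 / l)) \<and>
     (\<forall>z. galois_conjugate (of_real l) z \<longrightarrow> z \<noteq> of_real l \<longrightarrow> z \<noteq> of_real (1 / l) \<longrightarrow> cmod z = 1)"


section \<open>Reduced complex analytic spaces\<close>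

text \<open>
  Normal complex spaces are reduced, so it suffices to treat reduced spaces. The structure sheaf of
  a reduced space is a sheaf of complex-valued functions, and a holomorphic map is a continuous
  map along which sections pull back to sections. In the record below, \<open>sect X U h\<close> says that the
  function \<open>h\<close>, restricted to the open set \<open>U\<close>, is a section of the structure sheaf; the values of
  \<open>h\<close> outside \<open>U\<close> play no role.
\<close>

record 'a fspace =
  ftop :: "'a topology"
  sect :: "'a set \<Rightarrow> ('a \<Rightarrow> complex) \<Rightarrow> bool"

definition function_sheaf :: "'a fspace \<Rightarrow> bool" where
  "function_sheaf X \<longleftrightarrow>
     (\<forall>U h. sect X U h \<longrightarrow> openin (ftop X) U) \<and>
     (\<forall>U h k. sect X U h \<longrightarrow> (\<forall>x\<in>U. h x = k x) \<longrightarrow> sect X U k) \<and>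
     (\<forall>U V h. sect X U h \<longrightarrow> openin (ftop X) V \<longrightarrow> V \<subseteq> U \<longrightarrow> sect X V h) \<and>
     (\<forall>U h. openin (ftop X) U \<longrightarrow> (\<forall>x\<in>U. \<exists>V. x \<in> V \<and> V \<subseteq> U \<and> sect X V h) \<longrightarrow> sect X U h)"

definition open_subspace :: "'a fspace \<Rightarrow> 'a set \<Rightarrow> 'a fspace" where
  "open_subspace X V = \<lparr>ftop = subtopology (ftop X) V, sect = (\<lambda>W h. W \<subseteq> V \<and> sect X W h)\<rparr>"

definition holomorphic_map :: "'a fspace \<Rightarrow> 'b fspace \<Rightarrow> ('a \<Rightarrow> 'b) \<Rightarrow> bool" where
  "holomorphic_map X Y \<phi> \<longleftrightarrow>
     continuous_map (ftop X) (ftop Y) \<phi> \<and>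
     (\<forall>V h. sect Y V h \<longrightarrow> sect X {x \<in> topspace (ftop X). \<phi> x \<in> V} (h \<circ> \<phi>))"

definition biholomorphic_map :: "'a fspace \<Rightarrow> 'b fspace \<Rightarrow> ('a \<Rightarrow> 'b) \<Rightarrow> bool" where
  "biholomorphic_map X Y \<phi> \<longleftrightarrow>
     bij_betw \<phi> (topspace (ftop X)) (topspace (ftop Y)) \<and>
     holomorphic_map X Y \<phi> \<and>
     holomorphic_map Y X (inv_into (topspace (ftop X)) \<phi>)"

definition Aut :: "'a fspace \<Rightarrow> ('a \<Rightarrow> 'a) set" where
  "Aut X = {f. biholomorphic_map X X f}"


subsection \<open>Local models in affine space\<close>

text \<open>
  The dimension of the affine space in a local model is existentially quantified, so it cannot be
  a type. We use \<open>affine_space N\<close>, the sequences vanishing from index \<open>N\<close> on; the subspace topology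
  inherited from the product topology is the usual one.
\<close>

definition affine_space :: "nat \<Rightarrow> (nat \<Rightarrow> complex) set" where
  "affine_space N = {z. \<forall>i\<ge>N. z i = 0}"

text \<open>Complex differentiability in several variables, for \<open>D\<close> open in \<open>affine_space N\<close>.\<close>

definition holo :: "nat \<Rightarrow> (nat \<Rightarrow> complex) set \<Rightarrow> ((nat \<Rightarrow> complex) \<Rightarrow> complex) \<Rightarrow> bool" where
  "holo N D g \<longleftrightarrow>
     (\<forall>z\<in>D. \<exists>a. ((\<lambda>w. (g w - g z - (\<Sum>i<N. a i * (w i - z i))) / of_real (\<Sum>i<N. cmod (w i - z i)))
                  \<longlongrightarrow> 0) (at z within affine_space N))"

definition zero_set :: "(nat \<Rightarrow> complex) set \<Rightarrow> ((nat \<Rightarrow> complex) \<Rightarrow> complex) set \<Rightarrow> (nat \<Rightarrow> complex) set" where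
  "zero_set D F = {z \<in> D. \<forall>g\<in>F. g z = 0}"

definition local_model ::
    "nat \<Rightarrow> (nat \<Rightarrow> complex) set \<Rightarrow> ((nat \<Rightarrow> complex) \<Rightarrow> complex) set \<Rightarrow> (nat \<Rightarrow> complex) fspace" where
  "local_model N D F =
     \<lparr>ftop = top_of_set (zero_set D F),
      sect = (\<lambda>W h. openin (top_of_set (zero_set D F)) W \<and>
                (\<forall>z\<in>W. \<exists>D' g. openin (top_of_set (affine_space N)) D' \<and> z \<in> D' \<and> holo N D' g \<and>
                               (\<forall>w \<in> D' \<inter> W. h w = g w)))\<rparr>"

definition chart ::
    "'a fspace \<Rightarrow> 'a set \<Rightarrow> nat \<Rightarrow> (nat \<Rightarrow> complex) set \<Rightarrow> ((nat \<Rightarrow> complex) \<Rightarrow> complex) set \<Rightarrow>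
     ('a \<Rightarrow> nat \<Rightarrow> complex) \<Rightarrow> bool" where
  "chart X V N D F \<psi> \<longleftrightarrow>
     openin (ftop X) V \<and> openin (top_of_set (affine_space N)) D \<and>
     finite F \<and> (\<forall>g\<in>F. holo N D g) \<and>
     biholomorphic_map (open_subspace X V) (local_model N D F) \<psi>"

definition complex_space :: "'a fspace \<Rightarrow> bool" where
  "complex_space X \<longleftrightarrow>
     Hausdorff_space (ftop X) \<and> function_sheaf X \<and>
     (\<forall>x \<in> topspace (ftop X). \<exists>V N D F \<psi>. x \<in> V \<and> chart X V N D F \<psi>)"

text \<open>
  The dimension of a reduced complex space is the supremum of its dimensions at regular points,
  that is, points with a neighbourhood biholomorphic to an open subset of affine space.
\<close>

definition complex_dim :: "'a fspace \<Rightarrow> enat" where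
  "complex_dim X = Sup {enat d | d. \<exists>V D \<psi>. V \<noteq> {} \<and> chart X V d D {} \<psi>}"


subsection \<open>Normality\<close>

text \<open>
  Germs at \<open>y\<close> are represented by sections over neighbourhoods of \<open>y\<close>. The space is normal at \<open>y\<close> if
  the local ring at \<open>y\<close> is integrally closed in its total ring of fractions: whenever \<open>b\<close> is a
  non-zero-divisor and the fraction \<open>a / b\<close> is a root of a monic polynomial over the local ring, then
  \<open>a / b\<close> lies in the local ring. The equations for \<open>a / b\<close> are written with denominators cleared.
\<close>

definition germ_eq :: "'a fspace \<Rightarrow> 'a \<Rightarrow> ('a \<Rightarrow> complex) \<Rightarrow> ('a \<Rightarrow> complex) \<Rightarrow> bool" where
  "germ_eq X y h k \<longleftrightarrow> (\<exists>W. openin (ftop X) W \<and> y \<in> W \<and> (\<forall>x\<in>W. h x = k x))"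

definition germ_at :: "'a fspace \<Rightarrow> 'a \<Rightarrow> ('a \<Rightarrow> complex) \<Rightarrow> bool" where
  "germ_at X y h \<longleftrightarrow> (\<exists>W. y \<in> W \<and> sect X W h)"

definition germ_nonzerodivisor :: "'a fspace \<Rightarrow> 'a \<Rightarrow> ('a \<Rightarrow> complex) \<Rightarrow> bool" where
  "germ_nonzerodivisor X y b \<longleftrightarrow>
     (\<forall>c. germ_at X y c \<longrightarrow> germ_eq X y (\<lambda>x. b x * c x) (\<lambda>x. 0) \<longrightarrow> germ_eq X y c (\<lambda>x. 0))"

definition normal_at :: "'a fspace \<Rightarrow> 'a \<Rightarrow> bool" where
  "normal_at X y \<longleftrightarrow>
     (\<forall>a b. germ_at X y a \<longrightarrow> germ_at X y b \<longrightarrow> germ_nonzerodivisor X y b \<longrightarrow>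
        (\<exists>m c. (\<forall>i<m. germ_at X y (c i)) \<and>
               germ_eq X y (\<lambda>x. a x ^ m + (\<Sum>i<m. c i x * a x ^ i * b x ^ (m - i))) (\<lambda>x. 0)) \<longrightarrow>
        (\<exists>q. germ_at X y q \<and> germ_eq X y a (\<lambda>x. q x * b x)))"

definition normal_space :: "'a fspace \<Rightarrow> bool" where
  "normal_space X \<longleftrightarrow> (\<forall>y \<in> topspace (ftop X). normal_at X y)"


subsection \<open>Kaehler spaces\<close>

text \<open>
  \<open>real_partial j e g\<close> is the derivative of \<open>g\<close> in the real direction \<open>e\<close> of the \<open>j\<close>-th coordinate;
  \<open>e = 1\<close> and \<open>e = \<i>\<close> give the derivatives with respect to the real and imaginary parts.
\<close>

definition real_partial ::
    "nat \<Rightarrow> complex \<Rightarrow> ((nat \<Rightarrow> complex) \<Rightarrow> complex) \<Rightarrow> (nat \<Rightarrow> complex) \<Rightarrow> complex" where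
  "real_partial j e g z = vector_derivative (\<lambda>t::real. g (z(j := z j + of_real t * e))) (at 0)"

primrec Ck_on_affine ::
    "nat \<Rightarrow> nat \<Rightarrow> (nat \<Rightarrow> complex) set \<Rightarrow> ((nat \<Rightarrow> complex) \<Rightarrow> complex) \<Rightarrow> bool" where
  "Ck_on_affine 0 N D g \<longleftrightarrow> continuous_on D g"
| "Ck_on_affine (Suc k) N D g \<longleftrightarrow>
     continuous_on D g \<and>
     (\<forall>j<N. \<forall>e \<in> {1, \<i>}.
        (\<forall>z\<in>D. (\<lambda>t::real. g (z(j := z j + of_real t * e))) differentiable (at 0)) \<and>
        Ck_on_affine k N D (real_partial j e g))"

definition wirtinger :: "nat \<Rightarrow> ((nat \<Rightarrow> complex) \<Rightarrow> complex) \<Rightarrow> (nat \<Rightarrow> complex) \<Rightarrow> complex" where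
  "wirtinger j g z = (real_partial j 1 g z - \<i> * real_partial j \<i> g z) / 2"

definition wirtinger_bar :: "nat \<Rightarrow> ((nat \<Rightarrow> complex) \<Rightarrow> complex) \<Rightarrow> (nat \<Rightarrow> complex) \<Rightarrow> complex" where
  "wirtinger_bar j g z = (real_partial j 1 g z + \<i> * real_partial j \<i> g z) / 2"

definition smooth_strictly_psh_affine ::
    "nat \<Rightarrow> (nat \<Rightarrow> complex) set \<Rightarrow> ((nat \<Rightarrow> complex) \<Rightarrow> real) \<Rightarrow> bool" where
  "smooth_strictly_psh_affine N D \<Phi> \<longleftrightarrow>
     (\<forall>k. Ck_on_affine k N D (\<lambda>z. of_real (\<Phi> z))) \<and>
     (\<forall>z\<in>D. \<forall>w \<in> affine_space N. w \<noteq> (\<lambda>i. 0) \<longrightarrow>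
        Re (\<Sum>j<N. \<Sum>k<N. wirtinger j (wirtinger_bar k (\<lambda>z. of_real (\<Phi> z))) z * w j * cnj (w k)) > 0)"

text \<open>On a complex space: locally the restriction of such a function from an ambient affine space.\<close>

definition smooth_strictly_psh :: "'a fspace \<Rightarrow> 'a set \<Rightarrow> ('a \<Rightarrow> real) \<Rightarrow> bool" where
  "smooth_strictly_psh X U \<phi> \<longleftrightarrow>
     (\<forall>x\<in>U. \<exists>V N D F \<psi> \<Phi>. x \<in> V \<and> V \<subseteq> U \<and> chart X V N D F \<psi> \<and>
        smooth_strictly_psh_affine N D \<Phi> \<and> (\<forall>y\<in>V. \<phi> y = \<Phi> (\<psi> y)))"

definition pluriharmonic :: "'a fspace \<Rightarrow> 'a set \<Rightarrow> ('a \<Rightarrow> real) \<Rightarrow> bool" where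
  "pluriharmonic X U u \<longleftrightarrow>
     (\<forall>x\<in>U. \<exists>V h. x \<in> V \<and> V \<subseteq> U \<and> sect X V h \<and> (\<forall>y\<in>V. u y = Re (h y)))"

text \<open>
  A Kaehler metric on a complex space, in the sense of Grauert, is given by local potentials: smooth
  strictly plurisubharmonic functions on the members of an open cover that differ by pluriharmonic
  functions on overlaps.
\<close>

definition kaehler_space :: "'a fspace \<Rightarrow> bool" where
  "kaehler_space X \<longleftrightarrow>
     (\<exists>P :: ('a set \<times> ('a \<Rightarrow> real)) set.
        (\<Union>(U, \<phi>)\<in>P. U) = topspace (ftop X) \<and>
        (\<forall>(U, \<phi>)\<in>P. openin (ftop X) U \<and> smooth_strictly_psh X U \<phi>) \<and>
        (\<forall>(U, \<phi>)\<in>P. \<forall>(U', \<phi>')\<in>P. pluriharmonic X (U \<inter> U') (\<lambda>x. \<phi> x - \<phi>' x)))"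


subsection \<open>Equivariant fibrations\<close>

definition nontrivial_equivariant_fibration ::
    "'a fspace \<Rightarrow> ('a \<Rightarrow> 'a) \<Rightarrow> 'b fspace \<Rightarrow> ('a \<Rightarrow> 'b) \<Rightarrow> bool" where
  "nontrivial_equivariant_fibration X f Y \<pi> \<longleftrightarrow>
     complex_space Y \<and> normal_space Y \<and> kaehler_space Y \<and>
     0 < complex_dim Y \<and> complex_dim Y < complex_dim X \<and>
     holomorphic_map X Y \<pi> \<and>
     \<pi> ` topspace (ftop X) = topspace (ftop Y) \<and>
     (\<forall>y \<in> topspace (ftop Y). connectedin (ftop X) {x \<in> topspace (ftop X). \<pi> x = y}) \<and>
     (\<exists>g \<in> Aut Y. \<forall>x \<in> topspace (ftop X). \<pi> (f x) = g (\<pi> x))"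


section \<open>Complex tori\<close>

global_interpretation zmod: module "\<lambda>(k::int) (x::'a::real_vector). of_int k *\<^sub>R x"
  by unfold_locales (simp_all add: algebra_simps)

definition lattice_group :: "(complex^'n) set \<Rightarrow> bool" where
  "lattice_group L \<longleftrightarrow>
     zmod.subspace L \<and> discrete L \<and>
     (\<exists>B. finite B \<and> card B = 2 * CARD('n) \<and> \<not> zmod.dependent B \<and> zmod.span B = L)"

definition torus_proj :: "(complex^'n) set \<Rightarrow> complex^'n \<Rightarrow> (complex^'n) set" where
  "torus_proj L v = (\<lambda>l. v + l) ` L"

definition torus_topology :: "(complex^'n) set \<Rightarrow> (complex^'n) set topology" where
  "torus_topology L = topology (\<lambda>U. U \<subseteq> range (torus_proj L) \<and> open (torus_proj L -` U))"

lemma openin_torus_topology: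
  "openin (torus_topology L) U \<longleftrightarrow> U \<subseteq> range (torus_proj L) \<and> open (torus_proj L -` U)"
proof -
  have "istopology (\<lambda>U. U \<subseteq> range (torus_proj L) \<and> open (torus_proj L -` U))"
    unfolding istopology_def by (auto simp: vimage_Union vimage_Int)
  then show ?thesis
    by (simp add: torus_topology_def)
qed

definition complex_differentiable_at :: "(complex^'n \<Rightarrow> complex) \<Rightarrow> complex^'n \<Rightarrow> bool" where
  "complex_differentiable_at g v \<longleftrightarrow>
     (\<exists>g'. (g has_derivative g') (at v) \<and> (\<forall>c u. g' (c *s u) = c * g' u))"

definition torus :: "(complex^'n) set \<Rightarrow> (complex^'n) set fspace" where
  "torus L =
     \<lparr>ftop = torus_topology L,
      sect = (\<lambda>U h. openin (torus_topology L) U \<and>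
                (\<forall>v \<in> torus_proj L -` U. complex_differentiable_at (h \<circ> torus_proj L) v))\<rparr>"


subsection \<open>The cohomology group of type (1,1)\<close>

text \<open>
  Differential forms on the torus are identified with \<open>L\<close>-periodic forms on the universal cover.
  A 2-form \<open>\<omega>\<close> assigns to a point \<open>x\<close> the complex-valued alternating real-bilinear form \<open>\<omega> x\<close>.
\<close>

primrec Ck :: "nat \<Rightarrow> ('a::real_normed_vector \<Rightarrow> complex) \<Rightarrow> bool" where
  "Ck 0 g \<longleftrightarrow> continuous_on UNIV g"
| "Ck (Suc k) g \<longleftrightarrow>
     (\<forall>x. g differentiable (at x)) \<and> (\<forall>v. Ck k (\<lambda>x. frechet_derivative g (at x) v))"

type_synonym 'n form1 = "complex^'n \<Rightarrow> complex^'n \<Rightarrow> complex"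
type_synonym 'n form2 = "complex^'n \<Rightarrow> complex^'n \<Rightarrow> complex^'n \<Rightarrow> complex"

definition smooth_form1 :: "(complex^'n) set \<Rightarrow> 'n form1 \<Rightarrow> bool" where
  "smooth_form1 L \<eta> \<longleftrightarrow>
     (\<forall>x. linear (\<eta> x)) \<and>
     (\<forall>x. \<forall>l\<in>L. \<eta> (x + l) = \<eta> x) \<and>
     (\<forall>k u. Ck k (\<lambda>x. \<eta> x u))"

definition smooth_form2 :: "(complex^'n) set \<Rightarrow> 'n form2 \<Rightarrow> bool" where
  "smooth_form2 L \<omega> \<longleftrightarrow>
     (\<forall>x. bilinear (\<omega> x) \<and> (\<forall>u. \<omega> x u u = 0)) \<and>
     (\<forall>x. \<forall>l\<in>L. \<omega> (x + l) = \<omega> x) \<and>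
     (\<forall>k u v. Ck k (\<lambda>x. \<omega> x u v))"

definition ext_deriv1 :: "'n::finite form1 \<Rightarrow> 'n form2" where
  "ext_deriv1 \<eta> x u v =
     frechet_derivative (\<lambda>y. \<eta> y v) (at x) u - frechet_derivative (\<lambda>y. \<eta> y u) (at x) v"

definition ext_deriv2 :: "'n::finite form2 \<Rightarrow> complex^'n \<Rightarrow> complex^'n \<Rightarrow> complex^'n \<Rightarrow> complex^'n \<Rightarrow> complex" where
  "ext_deriv2 \<omega> x u v w =
     frechet_derivative (\<lambda>y. \<omega> y v w) (at x) u
     - frechet_derivative (\<lambda>y. \<omega> y u w) (at x) v
     + frechet_derivative (\<lambda>y. \<omega> y u v) (at x) w"

definition closed_form2 :: "(complex^'n) set \<Rightarrow> 'n form2 \<Rightarrow> bool" where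
  "closed_form2 L \<omega> \<longleftrightarrow> smooth_form2 L \<omega> \<and> (\<forall>x u v w. ext_deriv2 \<omega> x u v w = 0)"

definition exact_form2 :: "(complex^'n) set \<Rightarrow> 'n form2 \<Rightarrow> bool" where
  "exact_form2 L \<omega> \<longleftrightarrow> (\<exists>\<eta>. smooth_form1 L \<eta> \<and> \<omega> = ext_deriv1 \<eta>)"

text \<open>
  Type (1,1): a combination of the wedge products of \<open>dz\<^sub>j\<close> with the conjugate of \<open>dz\<^sub>k\<close>.
\<close>

definition type11 :: "'n::finite form2 \<Rightarrow> bool" where
  "type11 \<omega> \<longleftrightarrow>
     (\<exists>a. \<forall>x u v. \<omega> x u v =
        (\<Sum>j\<in>UNIV. \<Sum>k\<in>UNIV. a x j k * (u $ j * cnj (v $ k) - v $ j * cnj (u $ k))))"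

text \<open>
  De Rham classes of degree 2 are sets of cohomologous closed forms, and \<open>H11 L\<close> consists of the
  classes that contain a closed form of type (1,1). The operator \<open>induced L T\<close> is the map
  on classes induced by a linear operator \<open>T\<close> on forms that preserves closed and exact forms.
\<close>

definition coh_class :: "(complex^'n) set \<Rightarrow> 'n form2 \<Rightarrow> 'n form2 set" where
  "coh_class L \<omega> = {\<omega>'. closed_form2 L \<omega>' \<and> exact_form2 L (\<lambda>x u v. \<omega>' x u v - \<omega> x u v)}"

definition H11 :: "(complex^'n) set \<Rightarrow> 'n form2 set set" where
  "H11 L = coh_class L ` {\<omega>. closed_form2 L \<omega> \<and> type11 \<omega>}"

definition induced :: "(complex^'n) set \<Rightarrow> ('n form2 \<Rightarrow> 'n form2) \<Rightarrow> 'n form2 set \<Rightarrow> 'n form2 set" where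
  "induced L T c = (\<Union>\<omega>\<in>c. coh_class L (T \<omega>))"

definition pullback2 :: "(complex^'n \<Rightarrow> complex^'n) \<Rightarrow> 'n::finite form2 \<Rightarrow> 'n form2" where
  "pullback2 \<Phi> \<omega> x u v =
     \<omega> (\<Phi> x) (frechet_derivative \<Phi> (at x) u) (frechet_derivative \<Phi> (at x) v)"

text \<open>
  A continuous self-map of the torus has a continuous lift to the universal cover. Two lifts differ
  by a constant in \<open>L\<close>, so the pullback of periodic forms does not depend on the choice.
\<close>

definition torus_lift :: "(complex^'n) set \<Rightarrow> ((complex^'n) set \<Rightarrow> (complex^'n) set) \<Rightarrow> complex^'n \<Rightarrow> complex^'n" where
  "torus_lift L f =
     (SOME \<Phi>. continuous_on UNIV \<Phi> \<and> (\<forall>v. torus_proj L (\<Phi> v) = f (torus_proj L v)))"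

definition H11_pullback ::
    "(complex^'n) set \<Rightarrow> ((complex^'n) set \<Rightarrow> (complex^'n) set) \<Rightarrow> 'n form2 set \<Rightarrow> 'n form2 set" where
  "H11_pullback L f = induced L (pullback2 (torus_lift L f))"

definition H11_scale :: "(complex^'n) set \<Rightarrow> complex \<Rightarrow> 'n form2 set \<Rightarrow> 'n form2 set" where
  "H11_scale L \<mu> = induced L (\<lambda>\<omega> x u v. \<mu> * \<omega> x u v)"

definition H11_eigenvalue ::
    "(complex^'n) set \<Rightarrow> ((complex^'n) set \<Rightarrow> (complex^'n) set) \<Rightarrow> complex \<Rightarrow> bool" where
  "H11_eigenvalue L f \<mu> \<longleftrightarrow>
     (\<exists>c \<in> H11 L. c \<noteq> coh_class L (\<lambda>x u v. 0) \<and> H11_pullback L f c = H11_scale L \<mu> c)"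

text \<open>
  Since \<open>H11 L\<close> is finite-dimensional, the spectral radius of the pullback is the largest modulus
  of an eigenvalue.
\<close>

definition dynamical_degree1 ::
    "(complex^'n) set \<Rightarrow> ((complex^'n) set \<Rightarrow> (complex^'n) set) \<Rightarrow> real" where
  "dynamical_degree1 L f = Sup {cmod \<mu> | \<mu>. H11_eigenvalue L f \<mu>}"

end

theory Submission
  imports Defs "HOL-Complex_Analysis.Complex_Analysis" "Jordan_Normal_Form.Schur_Decomposition"
begin

text \<open>
  An automorphism of a torus lifts to an affine map \<open>v \<mapsto> A v + b\<close> with \<open>A\<close> preserving the lattice. If
  some rational polynomial \<open>q\<close> makes \<open>q(A)\<close> neither zero nor injective, then a multiple \<open>T\<close> of \<open>q(A)\<close>
  is an endomorphism of the torus, and the desired fibration divides the torus by the image of the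
  kernel of \<open>T\<close>. Otherwise a rational polynomial vanishing at one of the three
  eigenvalues \<open>x, y, z\<close> of \<open>A\<close> vanishes at all of them. Averaging forms over the torus identifies
  \<open>H\<^sup>2\<close> with constant forms, so \<open>\<lambda>\<^sub>1\<close> is the square of the largest modulus among
  \<open>x, y, z\<close>. The characteristic polynomial of \<open>A\<close> on the lattice has the roots \<open>x, y, z\<close> and their
  conjugates and constant term \<open>\<bar>x y z\<bar>\<^sup>2 = 1\<close>, and comparing moduli excludes that \<open>\<lambda>\<^sub>1\<close> is a Salem number.
\<close>

text \<open>The quotient is C^n / G with G = L + ker T, kept on C^n itself instead of being
  rewritten as C^d modulo a lattice with d depending on the kernel. One type thus serves for all
  bases, and one locale of linear coordinates covers both the torus (d = n) and its quotients. G is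
  not discrete, but T maps it into L; the gap of L around 0 makes the quotient Hausdorff and
  supplies its charts. The dichotomy takes the place of Galois automorphisms. If every q(A) is zero
  or injective, then q(x) = 0 makes q(A) kill an eigenvector, so q(A) = 0 and q vanishes at all
  eigenvalues. The Salem number is not an eigenvalue but a product x * cnj x of two eigenvalues of
  the integral matrix M of A on L. Its irreducible polynomial m therefore enters through the
  rational polynomial D(t) = det m(t M): D vanishes at x exactly if the product of x with some
  eigenvalue of M is a root of m, and this property passes from x to y and z.\<close>

no_notation vec_index (infixl "$" 100)
no_notation fps_nth (infixl "$" 75)
no_notation scalar_prod (infix "\<bullet>" 70)
hide_const (open) Determinant.det Matrix.row Matrix.col Matrix.mat Matrix.vec Matrix.diag_mat
hide_fact (open) Matrix.vec_eq_iff

section \<open>Discrete subgroups\<close>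

text \<open>Differences of group elements are group elements, so a gap around 0 separates all
  points; later arguments use discreteness in this form.\<close>

lemma discrete_subgroup_separated:
  fixes L :: "'a::real_normed_vector set"
  assumes "zmod.subspace L" "discrete L"
  obtains e where "e > 0" "\<And>l. l \<in> L \<Longrightarrow> norm l < e \<Longrightarrow> l = 0"
proof -
  have "0 isolated_in L"
    using assms zmod.subspace_0 discreteD by blast
  then obtain e where "e > 0" "\<forall>y\<in>L. dist 0 y < e \<longrightarrow> y = 0"
    unfolding isolated_in_dist_Ex_iff by blast
  then show thesis
    using that by simp
qed

text \<open>Near an accumulation point there would be two distinct group elements whose difference
  is shorter than the gap around 0.\<close>

lemma discrete_subgroup_Int_cball_finite:
  fixes L :: "'a::euclidean_space set"
  assumes L: "zmod.subspace L" "discrete L"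
  shows "finite (L \<inter> cball 0 r)"
proof (rule ccontr)
  assume inf: "infinite (L \<inter> cball 0 r)"
  obtain e where e: "e > 0" "\<And>l. l \<in> L \<Longrightarrow> norm l < e \<Longrightarrow> l = 0"
    using discrete_subgroup_separated[OF L] by blast
  obtain x where x: "x islimpt (L \<inter> cball 0 r)"
    using Heine_Borel_imp_Bolzano_Weierstrass[OF compact_cball inf] by auto
  obtain y where y: "y \<in> L" "y \<noteq> x" "dist y x < e/2"
    using x \<open>e > 0\<close> unfolding islimpt_approachable by (metis half_gt_zero IntE)
  \<comment> \<open>Taking \<open>z\<close> strictly closer to \<open>x\<close> than
    \<open>y\<close> is ensures \<open>z \<noteq> y\<close>.\<close>
  obtain z where z: "z \<in> L" "z \<noteq> x" "dist z x < min (e/2) (dist y x)"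
    using x \<open>e > 0\<close> y unfolding islimpt_approachable
    by (metis half_gt_zero IntE min_less_iff_conj zero_less_dist_iff)
  have "norm (y - z) < e"
    using y z by (metis dist_norm dist_triangle_half_l dist_commute min_less_iff_conj)
  then have "y - z = 0"
    using e y z zmod.subspace_diff[OF L(1)] by blast
  then show False using z by simp
qed

text \<open>The multiples of an element of \<open>B\<close> that depends over the reals on other elements, reduced
  modulo these elements, form a bounded and hence finite subset of the lattice.\<close>

lemma zmod_independent_imp_independent:
  fixes L :: "'a::euclidean_space set"
  assumes L: "zmod.subspace L" "discrete L" and B: "finite B" "B \<subseteq> L" "\<not> zmod.dependent B"
  shows "independent B"
proof -
  obtain C where C: "C \<subseteq> B" "independent C" "B \<subseteq> span C"
    using maximal_independent_subset[of B] by auto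
  have fC: "finite C" using C(1) B(1) finite_subset by blast
  have "B = C"
  proof (rule ccontr)
    assume "B \<noteq> C"
    then obtain b where b: "b \<in> B" "b \<notin> C" using C by blast
    then obtain a where a: "b = (\<Sum>c\<in>C. a c *\<^sub>R c)"
      using C(3) span_finite[OF fC] by auto
    define x where "x = (\<lambda>n::nat. of_int (int n) *\<^sub>R b - (\<Sum>c\<in>C. of_int \<lfloor>real n * a c\<rfloor> *\<^sub>R c))"
    have xL: "x n \<in> L" for n
      unfolding x_def using B b C(1)
      by (intro zmod.subspace_diff zmod.subspace_scale zmod.subspace_sum L) auto
    have xeq: "x n = (\<Sum>c\<in>C. frac (real n * a c) *\<^sub>R c)" for n
      unfolding x_def frac_def
      by (subst a) (simp add: scaleR_sum_right sum_subtractf[symmetric] algebra_simps)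
    have xb: "norm (x n) \<le> (\<Sum>c\<in>C. norm c)" for n
      unfolding xeq
    proof (rule order_trans[OF norm_sum sum_mono])
      fix c :: 'a
      show "norm (frac (real n * a c) *\<^sub>R c) \<le> norm c"
        using frac_lt_1[of "real n * a c"] frac_ge_0[of "real n * a c"]
        by (simp add: mult_left_le_one_le)
    qed
    have "range x \<subseteq> L \<inter> cball 0 (\<Sum>c\<in>C. norm c)"
      using xL xb by auto
    then have "finite (range x)"
      using discrete_subgroup_Int_cball_finite[OF L] finite_subset by blast
    then have "\<not> inj x"
      using range_inj_infinite by blast
    then obtain n m where nm: "x n = x m" "n \<noteq> m"
      unfolding inj_def by blast
    \<comment> \<open>The coincidence \<open>x n = x m\<close> is an integral relation whose
      coefficient \<open>n - m\<close> at \<open>b\<close> is non-zero, contrary to independence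
      over the integers.\<close>
    define u where "u = (\<lambda>c. if c = b then int n - int m
      else - (\<lfloor>real n * a c\<rfloor> - \<lfloor>real m * a c\<rfloor>))"
    have "(\<Sum>v\<in>insert b C. of_int (u v) *\<^sub>R v) = of_int (u b) *\<^sub>R b + (\<Sum>v\<in>C. of_int (u v) *\<^sub>R v)"
      using fC b by simp
    also have "(\<Sum>v\<in>C. of_int (u v) *\<^sub>R v)
      = (\<Sum>v\<in>C. of_int \<lfloor>real m * a v\<rfloor> *\<^sub>R v - of_int \<lfloor>real n * a v\<rfloor> *\<^sub>R v)"
      using b(2) by (intro sum.cong) (auto simp: u_def algebra_simps)
    also have "of_int (u b) *\<^sub>R b + \<dots> = x n - x m"
      unfolding x_def u_def sum_subtractf by (simp add: algebra_simps)
    finally have s: "(\<Sum>v\<in>insert b C. of_int (u v) *\<^sub>R v) = 0"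
      using nm by simp
    have "u b \<noteq> 0" using nm by (simp add: u_def)
    with s have "zmod.dependent B"
      unfolding zmod.dependent_explicit using fC b C(1)
      by (intro exI[of _ "insert b C"] exI[of _ u]) auto
    then show False using B(3) by simp
  qed
  then show ?thesis using C by simp
qed

text \<open>The definition of a lattice gives independence over the integers only. Discreteness
  lifts it to the reals, and the count \<open>2 * CARD('n)\<close>, the real dimension, then makes
  the basis span.\<close>

lemma lattice_group_basis:
  fixes L :: "(complex^'n) set"
  assumes "lattice_group L"
  obtains B where "finite B" "card B = 2 * CARD('n)" "independent B" "span B = UNIV"
    "L = zmod.span B"
proof -
  obtain B where B: "finite B" "card B = 2 * CARD('n)" "\<not> zmod.dependent B" "zmod.span B = L"
    using assms unfolding lattice_group_def by auto
  have ind: "independent B"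
    using assms B zmod_independent_imp_independent[of L B] zmod.span_superset
    unfolding lattice_group_def by blast
  have "span B = UNIV"
    using card_eq_dim[of B UNIV] ind B by (auto simp: mult.commute)
  with ind B show thesis
    using that by blast
qed

lemma lattice_group_span:
  assumes "lattice_group L"
  shows "span L = UNIV"
proof -
  obtain B where "span B = UNIV" "L = zmod.span B"
    using lattice_group_basis[OF assms] .
  then show ?thesis
    using span_mono[OF zmod.span_superset[of B]] by auto
qed

text \<open>Rounding the real coordinates down leaves a remainder in the fundamental box, of norm at
  most the sum of the norms of the basis vectors.\<close>

lemma lattice_group_cocompact:
  fixes L :: "(complex^'n) set"
  assumes "lattice_group L"
  obtains r where "\<And>v. \<exists>l\<in>L. norm (v - l) \<le> r"
proof -
  obtain B where B: "finite B" "span B = UNIV" "L = zmod.span B"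
    using lattice_group_basis[OF assms] .
  have "\<exists>l\<in>L. norm (v - l) \<le> (\<Sum>b\<in>B. norm b)" for v
  proof -
    obtain a where a: "v = (\<Sum>b\<in>B. a b *\<^sub>R b)"
      using B(2) span_finite[OF B(1)] by auto
    define l where "l = (\<Sum>b\<in>B. of_int \<lfloor>a b\<rfloor> *\<^sub>R b)"
    have "l \<in> L"
      unfolding l_def B(3) by (intro zmod.span_sum zmod.span_scale zmod.span_base)
    moreover have "v - l = (\<Sum>b\<in>B. frac (a b) *\<^sub>R b)"
      unfolding a l_def frac_def by (simp add: sum_subtractf[symmetric] algebra_simps)
    moreover have "norm (\<Sum>b\<in>B. frac (a b) *\<^sub>R b) \<le> (\<Sum>b\<in>B. norm b)"
    proof (rule order_trans[OF norm_sum sum_mono])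
      fix b :: "complex^'n"
      show "norm (frac (a b) *\<^sub>R b) \<le> norm b"
        using frac_lt_1[of "a b"] frac_ge_0[of "a b"] by (simp add: mult_left_le_one_le)
    qed
    ultimately show ?thesis by metis
  qed
  then show thesis using that by blast
qed

section \<open>Holomorphic functions of several variables\<close>

lemma bounded_linear_scalar_mult_left [intro]: "bounded_linear (\<lambda>t::complex. t *s (u :: complex^'n))"
  by (intro linear_linear[THEN iffD2] linearI) (auto simp: vec_eq_iff algebra_simps)

lemma bounded_linear_scalar_mult_right [intro]: "bounded_linear (\<lambda>u::complex^'n. c *s u)"
  by (intro linear_linear[THEN iffD2] linearI) (auto simp: vec_eq_iff algebra_simps)

lemma norm_scalar_mult: "norm (c *s (u :: complex^'n)) = cmod c * norm u"
  by (simp add: norm_vec_def norm_mult L2_set_right_distrib)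

lemma complex_differentiable_atE:
  assumes "complex_differentiable_at g v"
  obtains g' where "(g has_derivative g') (at v)" "\<And>c u. g' (c *s u) = c * g' u"
  using assms unfolding complex_differentiable_at_def by blast

lemma complex_differentiable_at_imp_differentiable:
  "complex_differentiable_at g v \<Longrightarrow> g differentiable (at v)"
  unfolding complex_differentiable_at_def differentiable_def by blast

lemma complex_differentiable_at_imp_continuous:
  "complex_differentiable_at g v \<Longrightarrow> isCont g v"
  using complex_differentiable_at_imp_differentiable differentiable_imp_continuous_within by blast

lemma complex_differentiable_at_frechet:
  assumes "complex_differentiable_at g v"
  shows "(g has_derivative frechet_derivative g (at v)) (at v)"
    and "frechet_derivative g (at v) (c *s u) = c * frechet_derivative g (at v) u"
proof -
  obtain g' where g': "(g has_derivative g') (at v)" "\<And>c u. g' (c *s u) = c * g' u"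
    using assms by (rule complex_differentiable_atE) blast
  have "g' = frechet_derivative g (at v)"
    using g'(1) by (rule frechet_derivative_at)
  with g' show "(g has_derivative frechet_derivative g (at v)) (at v)"
    "frechet_derivative g (at v) (c *s u) = c * frechet_derivative g (at v) u"
    by auto
qed

lemma complex_differentiable_at_cong:
  assumes "complex_differentiable_at g v" "open S" "v \<in> S" "\<And>x. x \<in> S \<Longrightarrow> g x = h x"
  shows "complex_differentiable_at h v"
proof -
  obtain g' where g': "(g has_derivative g') (at v)" "\<And>c u. g' (c *s u) = c * g' u"
    using assms(1) by (rule complex_differentiable_atE) blast
  have "(h has_derivative g') (at v)"
    by (rule has_derivative_transform_within_open[OF g'(1) assms(2-4)])
  with g'(2) show ?thesis
    unfolding complex_differentiable_at_def by blast
qed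

lemma complex_differentiable_at_const [simp, intro]: "complex_differentiable_at (\<lambda>x. c) v"
  unfolding complex_differentiable_at_def by (rule exI[of _ "\<lambda>x. 0"]) auto

lemma complex_differentiable_at_nth [simp, intro]: "complex_differentiable_at (\<lambda>x. x $ i) v"
  unfolding complex_differentiable_at_def
  by (rule exI[of _ "\<lambda>x. x $ i"]) (auto intro!: bounded_linear.has_derivative[OF bounded_linear_vec_nth] derivative_eq_intros)

lemma complex_differentiable_at_add [intro]:
  assumes "complex_differentiable_at g v" "complex_differentiable_at h v"
  shows "complex_differentiable_at (\<lambda>x. g x + h x) v"
proof -
  obtain g' where g': "(g has_derivative g') (at v)" "\<And>c u. g' (c *s u) = c * g' u"
    using assms(1) by (rule complex_differentiable_atE) blast
  obtain h' where h': "(h has_derivative h') (at v)" "\<And>c u. h' (c *s u) = c * h' u"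
    using assms(2) by (rule complex_differentiable_atE) blast
  show ?thesis
    unfolding complex_differentiable_at_def
    by (rule exI, rule conjI, rule has_derivative_add[OF g'(1) h'(1)])
      (simp add: g'(2) h'(2) algebra_simps)
qed

lemma complex_differentiable_at_mult [intro]:
  assumes "complex_differentiable_at g v" "complex_differentiable_at h v"
  shows "complex_differentiable_at (\<lambda>x. g x * h x) v"
proof -
  obtain g' where g': "(g has_derivative g') (at v)" "\<And>c u. g' (c *s u) = c * g' u"
    using assms(1) by (rule complex_differentiable_atE) blast
  obtain h' where h': "(h has_derivative h') (at v)" "\<And>c u. h' (c *s u) = c * h' u"
    using assms(2) by (rule complex_differentiable_atE) blast
  show ?thesis
    unfolding complex_differentiable_at_def
    by (rule exI, rule conjI, rule has_derivative_mult[OF g'(1) h'(1)])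
      (simp add: g'(2) h'(2) algebra_simps)
qed

lemma complex_differentiable_at_cmult [intro]:
  "complex_differentiable_at g v \<Longrightarrow> complex_differentiable_at (\<lambda>x. c * g x) v"
  by (rule complex_differentiable_at_mult) auto

lemma complex_differentiable_at_diff [intro]:
  assumes "complex_differentiable_at g v" "complex_differentiable_at h v"
  shows "complex_differentiable_at (\<lambda>x. g x - h x) v"
  using complex_differentiable_at_add[OF assms(1) complex_differentiable_at_cmult[OF assms(2), of "-1"]]
  by simp

lemma complex_differentiable_at_sum [intro]:
  assumes "\<And>i. i \<in> I \<Longrightarrow> complex_differentiable_at (g i) v"
  shows "complex_differentiable_at (\<lambda>x. \<Sum>i\<in>I. g i x) v"
  using assms by (induction I rule: infinite_finite_induct) auto

lemma complex_differentiable_at_divide [intro]: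
  assumes "complex_differentiable_at g v" "complex_differentiable_at h v" "h v \<noteq> 0"
  shows "complex_differentiable_at (\<lambda>x. g x / h x) v"
proof -
  obtain g' where g': "(g has_derivative g') (at v)" "\<And>c u. g' (c *s u) = c * g' u"
    using assms(1) by (rule complex_differentiable_atE) blast
  obtain h' where h': "(h has_derivative h') (at v)" "\<And>c u. h' (c *s u) = c * h' u"
    using assms(2) by (rule complex_differentiable_atE) blast
  show ?thesis
    unfolding complex_differentiable_at_def
    by (rule exI, rule conjI, rule has_derivative_divide'[OF g'(1) h'(1) assms(3)])
      (simp add: g'(2) h'(2) algebra_simps)
qed

lemma complex_differentiable_at_affine:
  fixes A :: "complex^'n^'m"
  assumes "complex_differentiable_at g (A *v v + b)"
  shows "complex_differentiable_at (\<lambda>x. g (A *v x + b)) v"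
proof -
  obtain g' where g': "(g has_derivative g') (at (A *v v + b))" "\<And>c u. g' (c *s u) = c * g' u"
    using assms by (rule complex_differentiable_atE) blast
  have "((\<lambda>x. A *v x + b) has_derivative (\<lambda>x. A *v x)) (at v)"
    by (auto intro!: derivative_eq_intros bounded_linear.has_derivative[OF matrix_vector_mul_bounded_linear])
  from diff_chain_at[OF this g'(1)] show ?thesis
    unfolding complex_differentiable_at_def
    by (intro exI[of _ "\<lambda>x. g' (A *v x)"]) (auto simp: o_def g'(2) vector_scalar_commute)
qed

lemma complex_differentiable_at_shift:
  assumes "complex_differentiable_at g (v + b)"
  shows "complex_differentiable_at (\<lambda>x. g (x + b)) v"
  using complex_differentiable_at_affine[of g "mat 1" v b] assms by simp

lemma complex_differentiable_at_line:
  assumes "complex_differentiable_at g (v + t *s u)"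
  shows "((\<lambda>t. g (v + t *s u)) has_field_derivative frechet_derivative g (at (v + t *s u)) u) (at t)"
proof -
  have "((\<lambda>t. v + t *s u) has_derivative (\<lambda>t. t *s u)) (at t)"
    by (auto intro!: derivative_eq_intros bounded_linear.has_derivative[OF bounded_linear_scalar_mult_left])
  from diff_chain_at[OF this complex_differentiable_at_frechet(1)[OF assms]]
  show ?thesis
    unfolding has_field_derivative_def
    by (simp add: o_def complex_differentiable_at_frechet(2)[OF assms] mult.commute[of _ "frechet_derivative g _ u"])
qed

lemma complex_differentiable_line_holomorphic:
  assumes "\<And>t. t \<in> S \<Longrightarrow> complex_differentiable_at g (v + t *s u)"
  shows "(\<lambda>t. g (v + t *s u)) holomorphic_on S"
  unfolding holomorphic_on_def field_differentiable_def
  using complex_differentiable_at_line[OF assms] has_field_derivative_at_within by blast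

lemma complex_differentiable_imp_continuous_on:
  assumes "\<And>x. x \<in> U \<Longrightarrow> complex_differentiable_at g x"
  shows "continuous_on U g"
  using complex_differentiable_at_imp_continuous[OF assms] continuous_at_imp_continuous_on by blast

text \<open>Liouville's theorem in one variable, on the complex line through the two points.\<close>

lemma complex_differentiable_bounded_constant:
  fixes g :: "complex^'n \<Rightarrow> complex"
  assumes "\<And>x. complex_differentiable_at g x" "bounded (range g)"
  shows "g x = g y"
proof -
  have "(\<lambda>t. g (y + t *s (x - y))) holomorphic_on UNIV"
    by (rule complex_differentiable_line_holomorphic) (rule assms(1))
  moreover have "bounded (range (\<lambda>t. g (y + t *s (x - y))))"
    using assms(2) by (rule bounded_subset) auto
  ultimately have "(\<lambda>t. g (y + t *s (x - y))) constant_on UNIV"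
    by (rule Liouville_theorem)
  then have "g (y + 1 *s (x - y)) = g (y + 0 *s (x - y))"
    unfolding constant_on_def by (metis UNIV_I)
  then show ?thesis by simp
qed

text \<open>Cauchy's formula expresses a directional derivative as an integral that depends continuously
  on the point.\<close>

lemma complex_differentiable_frechet_continuous:
  fixes g :: "complex^'n \<Rightarrow> complex"
  assumes U: "open U" "\<And>x. x \<in> U \<Longrightarrow> complex_differentiable_at g x"
  shows "continuous_on U (\<lambda>x. frechet_derivative g (at x) u)"
proof (rule continuous_at_imp_continuous_on, rule ballI)
  fix x0 assume "x0 \<in> U"
  then obtain d where d: "d > 0" "cball x0 d \<subseteq> U"
    using U(1) open_contains_cball by blast
  \<comment> \<open>Half of \<open>d\<close> is left for moving the centre and half for the circle;
    the summand 1 admits \<open>u = 0\<close>.\<close>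
  define r where "r = d / 2 / (1 + norm u)"
  have r: "r > 0" "r * norm u \<le> d / 2"
  proof -
    show "r > 0" using d by (simp add: r_def add_pos_nonneg)
    have "norm u / (1 + norm u) \<le> 1"
      by (simp add: divide_le_eq_1 add_pos_nonneg)
    then show "r * norm u \<le> d / 2" using d
      unfolding r_def by (simp add: field_simps mult_left_le add_pos_nonneg)
  qed
  have inU: "x + t *s u \<in> U" if "x \<in> ball x0 (d/2)" "t \<in> cball 0 r" for x t
  proof -
    have "norm (t *s u) \<le> d / 2"
      using that r mult_right_mono[of "norm t" r "norm u"] unfolding norm_scalar_mult by simp
    then have "dist x0 (x + t *s u) \<le> d"
      using that norm_triangle_ineq4[of "x0 - x" "t *s u"] by (simp add: dist_norm algebra_simps)
    then show ?thesis using d by auto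
  qed
  \<comment> \<open>Cauchy's formula for the derivative at the centre, with the parametrisation of
    the circle inserted: its velocity cancels \<open>2 * pi * \<i>\<close> and one of the two powers
    in the denominator.\<close>
  define F where "F = (\<lambda>x. integral (cbox 0 1) (\<lambda>s::real. g (x + (r * exp (2 * pi * \<i> * s)) *s u)
      / (r * exp (2 * pi * \<i> * s))))"
  have eq: "frechet_derivative g (at x) u = F x" if x: "x \<in> ball x0 (d/2)" for x
  proof -
    have holo: "(\<lambda>t. g (x + t *s u)) holomorphic_on cball 0 r"
      by (rule complex_differentiable_line_holomorphic) (use U(2) inU x in blast)
    have "((\<lambda>t. g (x + t *s u)) has_field_derivative
        1 / (2 * of_real pi * \<i>) * contour_integral (circlepath 0 r) (\<lambda>t. g (x + t *s u) / (t - 0)\<^sup>2)) (at 0)"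
      by (rule Cauchy_derivative_integral_circlepath)
        (use holo r in \<open>auto intro: holomorphic_on_imp_continuous_on holomorphic_on_subset\<close>)
    moreover have "((\<lambda>t. g (x + t *s u)) has_field_derivative frechet_derivative g (at (x + 0 *s u)) u) (at 0)"
      by (rule complex_differentiable_at_line) (use U(2) inU[OF x, of 0] r in auto)
    ultimately have "frechet_derivative g (at x) u
       = 1 / (2 * of_real pi * \<i>) * contour_integral (circlepath 0 r) (\<lambda>t. g (x + t *s u) / (t - 0)\<^sup>2)"
      using DERIV_unique by fastforce
    also have "\<dots> = integral {0..1} (\<lambda>s::real. 1 / (2 * of_real pi * \<i>) * (g (x + circlepath 0 r s *s u) / (circlepath 0 r s)\<^sup>2
        * (2 * pi * \<i> * r * exp (2 * of_real pi * \<i> * s))))"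
      by (subst integral_mult_right) (simp add: contour_integral_integral vector_derivative_circlepath mult.assoc)
    also have "\<dots> = F x"
      unfolding F_def box_real circlepath_def part_circlepath_def linepath_def using r
      by (intro integral_cong) (auto simp: field_simps power2_eq_square)
    finally show ?thesis .
  qed
  have "continuous_on (ball x0 (d/2)) F"
    unfolding F_def
  proof (rule integral_continuous_on_param)
    have "continuous_on (ball x0 (d/2) \<times> cbox (0::real) 1) (\<lambda>z. g (fst z + (r * exp (2 * pi * \<i> * snd z)) *s u))"
    proof (rule continuous_on_compose2[OF complex_differentiable_imp_continuous_on[OF U(2)]])
      show "continuous_on (ball x0 (d/2) \<times> cbox (0::real) 1) (\<lambda>z. fst z + (r * exp (2 * pi * \<i> * snd z)) *s u)"
        by (intro continuous_intros bounded_linear.continuous_on[OF bounded_linear_scalar_mult_left])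
      show "(\<lambda>z. fst z + (complex_of_real r * exp (2 * pi * \<i> * snd z)) *s u) ` (ball x0 (d / 2) \<times> cbox (0::real) 1) \<subseteq> U"
        using inU r by (auto simp: norm_mult norm_exp_eq_Re)
    qed auto
    then show "continuous_on (ball x0 (d / 2) \<times> cbox (0::real) 1)
     (\<lambda>(x, s). g (x + (complex_of_real r * exp (2 * pi * \<i> * s)) *s u) / (r * exp (2 * pi * \<i> * s)))"
      unfolding case_prod_unfold using r by (intro continuous_intros) auto
  qed
  then have "continuous_on (ball x0 (d/2)) (\<lambda>x. frechet_derivative g (at x) u)"
    by (rule continuous_on_eq) (simp add: eq)
  then show "isCont (\<lambda>x. frechet_derivative g (at x) u) x0"
    using d by (simp add: continuous_on_eq_continuous_at)
qed

text \<open>Differentiation under the integral sign. The curve and the weight are general enough for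
  the circle means in the proof of normality and for the segment integrals of differential
  forms.\<close>

lemma has_derivative_integral_translates:
  fixes g :: "'a::euclidean_space \<Rightarrow> complex" and \<gamma> :: "real \<Rightarrow> 'a"
  assumes U: "open U" "\<And>x. x \<in> U \<Longrightarrow> g differentiable (at x)"
      "\<And>u. continuous_on U (\<lambda>x. frechet_derivative g (at x) u)"
    and \<gamma>: "continuous_on {0..1} \<gamma>" "\<And>t. t \<in> {0..1} \<Longrightarrow> x0 + \<gamma> t \<in> U"
    and k: "continuous_on {0..1} k"
  shows "((\<lambda>x. integral {0..1} (\<lambda>t. k t * g (x + \<gamma> t))) has_derivative
    (\<lambda>u. integral {0..1} (\<lambda>t. k t * frechet_derivative g (at (x0 + \<gamma> t)) u))) (at x0)"
proof -
  have "compact ((\<lambda>t. x0 + \<gamma> t) ` {0..1})"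
    by (rule compact_continuous_image[OF continuous_on_add[OF continuous_on_const \<gamma>(1)]]) auto
  moreover have "(\<lambda>t. x0 + \<gamma> t) ` {0..1} \<subseteq> U"
    using \<gamma>(2) by auto
  \<comment> \<open>By compactness one radius works for the whole curve: all its translates by less
    than \<open>e\<close> stay in \<open>U\<close>.\<close>
  ultimately obtain e where e: "e > 0" "(\<Union>x\<in>(\<lambda>t. x0 + \<gamma> t) ` {0..1}. ball x e) \<subseteq> U"
    by (rule compact_subset_open_imp_ball_epsilon_subset[OF _ U(1)])
  define V where "V = ball x0 e"
  have inU: "x + \<gamma> t \<in> U" if "x \<in> V" "t \<in> {0..1}" for x t
  proof -
    have "x + \<gamma> t \<in> ball (x0 + \<gamma> t) e" using that by (simp add: V_def dist_norm)
    then show ?thesis using e(2) that by blast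
  qed
  have fr: "(g has_derivative frechet_derivative g (at x)) (at x)" if "x \<in> U" for x
    using U(2)[OF that] by (simp add: frechet_derivative_works)
  define fx where "fx = (\<lambda>x t. Blinfun (\<lambda>u. k t * frechet_derivative g (at (x + \<gamma> t)) u))"
  have fx: "blinfun_apply (fx x t) = (\<lambda>u. k t * frechet_derivative g (at (x + \<gamma> t)) u)"
    if "x \<in> V" "t \<in> {0..1}" for x t
    unfolding fx_def
    by (intro bounded_linear_Blinfun_apply bounded_linear_const_mult
        has_derivative_bounded_linear[OF fr[OF inU[OF that]]])
  have cont: "continuous_on (V \<times> {0..1}) (\<lambda>z. h (fst z + \<gamma> (snd z)))"
    if "continuous_on U h" for h :: "'a \<Rightarrow> complex"
  proof (rule continuous_on_compose2[OF that])
    show "continuous_on (V \<times> {0..1}) (\<lambda>z. fst z + \<gamma> (snd z))"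
      by (rule continuous_on_add[OF continuous_on_fst[OF continuous_on_id]
          continuous_on_compose2[OF \<gamma>(1) continuous_on_snd[OF continuous_on_id]]]) auto
  qed (use inU in auto)
  have contk: "continuous_on (V \<times> {0..1}) (\<lambda>z. k (snd z))"
    by (rule continuous_on_compose2[OF k]) (auto intro: continuous_on_snd continuous_on_id)
  have contg: "continuous_on U g"
    using U(2) differentiable_imp_continuous_within continuous_at_imp_continuous_on by blast
  have contfx: "continuous_on (V \<times> {0..1}) (\<lambda>(x, t). fx x t)"
  proof (rule continuous_on_blinfun_componentwise)
    fix i :: 'a
    have "continuous_on (V \<times> {0..1}) (\<lambda>z. k (snd z) * frechet_derivative g (at (fst z + \<gamma> (snd z))) i)"
      by (intro continuous_on_mult contk cont[OF U(3)])
    then show "continuous_on (V \<times> {0..1}) (\<lambda>z. blinfun_apply (case z of (x, t) \<Rightarrow> fx x t) i)"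
      by (rule continuous_on_eq) (auto simp: fx)
  qed
  have x0: "x0 \<in> V" using e by (simp add: V_def)
  have "((\<lambda>x. integral (cbox 0 1) (\<lambda>t. k t * g (x + \<gamma> t))) has_derivative
    blinfun_apply (integral (cbox 0 1) (fx x0))) (at x0 within V)"
  proof (rule leibniz_rule)
    fix x :: 'a and t :: real assume xt: "x \<in> V" "t \<in> cbox 0 1"
    then have t: "t \<in> {0..1}" by simp
    have "((\<lambda>x. x + \<gamma> t) has_derivative (\<lambda>u. u)) (at x within V)"
      using has_derivative_add[OF has_derivative_ident has_derivative_const] by simp
    from has_derivative_compose[OF this fr[OF inU[OF xt(1) t]]]
    show "((\<lambda>x. k t * g (x + \<gamma> t)) has_derivative blinfun_apply (fx x t)) (at x within V)"
      unfolding fx[OF xt(1) t] by (rule has_derivative_mult_right)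
  next
    fix x assume x: "x \<in> V"
    have "continuous_on {0..1} (\<lambda>t. k t * g (x + \<gamma> t))"
      by (rule continuous_on_mult[OF k continuous_on_compose2[OF contg
          continuous_on_add[OF continuous_on_const \<gamma>(1)]]]) (use x inU in auto)
    then show "(\<lambda>t. k t * g (x + \<gamma> t)) integrable_on cbox 0 1"
      by (simp add: integrable_continuous_real)
  next
    show "continuous_on (V \<times> cbox 0 1) (\<lambda>(x, t). fx x t)"
      using contfx by simp
    show "x0 \<in> V" "convex V"
      using x0 by (simp_all add: V_def)
  qed
  moreover have "at x0 within V = at x0"
    by (rule at_within_open[OF x0]) (simp add: V_def)
  moreover have "blinfun_apply (integral (cbox 0 1) (fx x0))
      = (\<lambda>u. integral {0..1} (\<lambda>t. k t * frechet_derivative g (at (x0 + \<gamma> t)) u))"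
  proof
    fix u
    have "continuous_on {0..1} (\<lambda>t. fx x0 t)"
    proof -
      have "continuous_on {0..1} (\<lambda>t. case (x0, t) of (x, t) \<Rightarrow> fx x t)"
        by (rule continuous_on_compose2[OF contfx continuous_on_Pair[OF continuous_on_const continuous_on_id]])
          (use x0 in auto)
      then show ?thesis by simp
    qed
    then have "fx x0 integrable_on {0..1}"
      by (rule integrable_continuous_real)
    then have "blinfun_apply (integral (cbox 0 1) (fx x0)) u = integral {0..1} (\<lambda>t. blinfun_apply (fx x0 t) u)"
      by (simp add: blinfun_apply_integral)
    also have "\<dots> = integral {0..1} (\<lambda>t. k t * frechet_derivative g (at (x0 + \<gamma> t)) u)"
      by (intro integral_cong) (simp add: fx x0)
    finally show "blinfun_apply (integral (cbox 0 1) (fx x0)) u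
      = integral {0..1} (\<lambda>t. k t * frechet_derivative g (at (x0 + \<gamma> t)) u)" .
  qed
  ultimately show ?thesis
    by simp
qed

section \<open>Quotients by closed subgroups\<close>

lemma mem_torus_proj_iff: "w \<in> torus_proj G v \<longleftrightarrow> w - v \<in> G"
  unfolding torus_proj_def by (auto simp: image_iff algebra_simps intro!: bexI[of _ "w - v"])

lemma torus_proj_eq_iff:
  assumes "zmod.subspace G"
  shows "torus_proj G v = torus_proj G w \<longleftrightarrow> v - w \<in> G"
proof
  assume "torus_proj G v = torus_proj G w"
  moreover have "v \<in> torus_proj G v"
    using zmod.subspace_0[OF assms] by (simp add: mem_torus_proj_iff)
  ultimately show "v - w \<in> G"
    by (simp add: mem_torus_proj_iff)
next
  assume vw: "v - w \<in> G"
  have "x - v \<in> G \<longleftrightarrow> x - w \<in> G" for x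
    using zmod.subspace_add[OF assms vw, of "x - v"] zmod.subspace_diff[OF assms _ vw, of "x - w"]
    by auto
  then show "torus_proj G v = torus_proj G w"
    by (auto simp: mem_torus_proj_iff)
qed

lemma torus_proj_add:
  "zmod.subspace G \<Longrightarrow> g \<in> G \<Longrightarrow> torus_proj G (v + g) = torus_proj G v"
  by (simp add: torus_proj_eq_iff)

lemma topspace_torus_topology [simp]: "topspace (torus_topology G) = range (torus_proj G)"
  unfolding topspace_def by (force simp: openin_torus_topology vimage_def)

lemma ftop_torus [simp]: "ftop (torus G) = torus_topology G"
  by (simp add: torus_def)

lemma sect_torus:
  "sect (torus G) U h \<longleftrightarrow> openin (torus_topology G) U \<and>
     (\<forall>v. torus_proj G v \<in> U \<longrightarrow> complex_differentiable_at (h \<circ> torus_proj G) v)"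
  by (auto simp: torus_def)

lemma quotient_map_torus_proj: "quotient_map euclidean (torus_topology G) (torus_proj G)"
  by (auto simp: quotient_map_def openin_torus_topology vimage_def)

lemma continuous_map_torus_proj: "continuous_map euclidean (torus_topology G) (torus_proj G)"
  using quotient_imp_continuous_map quotient_map_torus_proj by blast

lemma open_vimage_torus_proj: "openin (torus_topology G) U \<Longrightarrow> open (torus_proj G -` U)"
  by (simp add: openin_torus_topology)

text \<open>The preimage of the image of \<open>S\<close> is the union of the translates of
  \<open>S\<close> by \<open>G\<close>.\<close>

lemma openin_torus_proj_image:
  fixes G :: "(complex^'n) set"
  assumes G: "zmod.subspace G" and S: "open S"
  shows "openin (torus_topology G) (torus_proj G ` S)"
proof -
  have "torus_proj G -` torus_proj G ` S = (\<Union>g\<in>G. (+) g ` S)"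
  proof (rule Set.set_eqI, rule iffI)
    fix v assume "v \<in> torus_proj G -` torus_proj G ` S"
    then obtain s where "s \<in> S" "v - s \<in> G"
      using torus_proj_eq_iff[OF G] by auto
    then show "v \<in> (\<Union>g\<in>G. (+) g ` S)"
      by (auto intro!: bexI[of _ "v - s"] image_eqI[of _ _ s])
  next
    fix v assume "v \<in> (\<Union>g\<in>G. (+) g ` S)"
    then obtain g s where "g \<in> G" "s \<in> S" "v = s + g" by (auto simp: add.commute)
    then show "v \<in> torus_proj G -` torus_proj G ` S"
      using torus_proj_add[OF G] by auto
  qed
  moreover have "open (\<Union>g\<in>G. (+) g ` S)"
    by (intro open_UN ballI open_translation S)
  ultimately show ?thesis
    by (auto simp: openin_torus_topology)
qed

text \<open>Two lifts of a point differ by a translation under which the lifted function is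
  invariant, so holomorphy on the quotient can be tested at any single lift.\<close>

lemma complex_differentiable_at_torus_proj_cong:
  assumes "zmod.subspace G" "torus_proj G v = torus_proj G w"
    "complex_differentiable_at (h \<circ> torus_proj G) v"
  shows "complex_differentiable_at (h \<circ> torus_proj G) w"
proof -
  have g: "v - w \<in> G" using assms torus_proj_eq_iff by blast
  have "w + (v - w) = v" by simp
  with assms(3) have "complex_differentiable_at (\<lambda>x. (h \<circ> torus_proj G) (x + (v - w))) w"
    by (intro complex_differentiable_at_shift) (simp only:)
  then show ?thesis
    using torus_proj_add[OF assms(1) g] by (simp add: o_def)
qed

lemma function_sheaf_torus: "function_sheaf (torus G)"
  unfolding function_sheaf_def ftop_torus
proof (intro conjI allI impI)
  fix U h k assume h: "sect (torus G) U h" and eq: "\<forall>x\<in>U. h x = k x"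
  show "sect (torus G) U k"
    unfolding sect_torus
  proof (intro conjI allI impI)
    show "openin (torus_topology G) U" using h by (simp add: sect_torus)
    fix v assume v: "torus_proj G v \<in> U"
    show "complex_differentiable_at (k \<circ> torus_proj G) v"
    proof (rule complex_differentiable_at_cong)
      show "complex_differentiable_at (h \<circ> torus_proj G) v"
        using h v by (simp add: sect_torus)
      show "open (torus_proj G -` U)"
        using h by (simp add: sect_torus open_vimage_torus_proj)
    qed (use v eq in auto)
  qed
next
  fix U h
  assume "openin (torus_topology G) U" "\<forall>x\<in>U. \<exists>V. x \<in> V \<and> V \<subseteq> U \<and> sect (torus G) V h"
  then show "sect (torus G) U h"
    unfolding sect_torus by blast
qed (auto simp: sect_torus)

lemma holomorphic_map_torus_affine:
  fixes A :: "complex^'n^'m"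
  assumes F: "\<And>v. F (torus_proj G v) = torus_proj G' (A *v v + b)"
  shows "holomorphic_map (torus G) (torus G') F"
  unfolding holomorphic_map_def ftop_torus
proof (intro conjI allI impI)
  have "continuous_map euclidean (torus_topology G') (torus_proj G' \<circ> (\<lambda>v. A *v v + b))"
    by (intro continuous_map_compose[OF _ continuous_map_torus_proj])
      (auto intro!: continuous_intros bounded_linear.continuous_on[OF matrix_vector_mul_bounded_linear])
  then have "continuous_map euclidean (torus_topology G') (F \<circ> torus_proj G)"
    using F by (simp add: o_def)
  then show cont: "continuous_map (torus_topology G) (torus_topology G') F"
    using continuous_compose_quotient_map[OF quotient_map_torus_proj] by blast
  fix V h assume h: "sect (torus G') V h"
  show "sect (torus G) {x \<in> topspace (torus_topology G). F x \<in> V} (h \<circ> F)"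
    unfolding sect_torus
  proof (intro conjI allI impI)
    show "openin (torus_topology G) {x \<in> topspace (torus_topology G). F x \<in> V}"
      using cont h openin_continuous_map_preimage unfolding sect_torus by blast
    fix v assume "torus_proj G v \<in> {x \<in> topspace (torus_topology G). F x \<in> V}"
    then have "complex_differentiable_at (h \<circ> torus_proj G') (A *v v + b)"
      using h F by (simp add: sect_torus)
    then have "complex_differentiable_at (\<lambda>x. (h \<circ> torus_proj G') (A *v x + b)) v"
      by (rule complex_differentiable_at_affine)
    then show "complex_differentiable_at (h \<circ> F \<circ> torus_proj G) v"
      using F by (simp add: o_def)
  qed
qed

text \<open>Since \<open>G\<close> is closed, \<open>v - w\<close> has a positive distance
  \<open>e\<close> from it; balls of radius \<open>e / 2\<close> then have disjoint images.\<close>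

lemma Hausdorff_space_torus:
  fixes G :: "(complex^'n) set"
  assumes G: "zmod.subspace G" "closed G"
  shows "Hausdorff_space (torus_topology G)"
  unfolding Hausdorff_space_def
proof (intro allI impI, elim conjE)
  fix x y assume "x \<in> topspace (torus_topology G)" "y \<in> topspace (torus_topology G)" "x \<noteq> y"
  then obtain v w where "x = torus_proj G v" "y = torus_proj G w"
    by auto
  with \<open>x \<noteq> y\<close> have vw: "x = torus_proj G v" "y = torus_proj G w" "v - w \<notin> G"
    using torus_proj_eq_iff[OF G(1)] by blast+
  obtain e where e: "e > 0" "ball (v - w) e \<inter> G = {}"
    using vw(3) open_Compl[OF G(2)] open_contains_ball[of "- G"] by blast
  have "disjnt (torus_proj G ` ball v (e/2)) (torus_proj G ` ball w (e/2))"
    unfolding disjnt_def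
  proof (rule ccontr)
    assume "torus_proj G ` ball v (e/2) \<inter> torus_proj G ` ball w (e/2) \<noteq> {}"
    then obtain a b where ab: "a \<in> ball v (e/2)" "b \<in> ball w (e/2)" "torus_proj G a = torus_proj G b"
      by blast
    then have "a - b \<in> G" using torus_proj_eq_iff[OF G(1)] by blast
    moreover have "dist (v - w) (a - b) < e"
      using ab norm_triangle_ineq4[of "v - a" "w - b"] by (simp add: dist_norm algebra_simps)
    ultimately show False using e by auto
  qed
  then show "\<exists>U V. openin (torus_topology G) U \<and> openin (torus_topology G) V \<and> x \<in> U \<and> y \<in> V \<and> disjnt U V"
    using openin_torus_proj_image[OF G(1)] e(1) vw
    by (intro exI[of _ "torus_proj G ` ball v (e/2)"] exI[of _ "torus_proj G ` ball w (e/2)"]) auto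
qed

section \<open>Charts of a quotient\<close>

text \<open>In \<open>quotient_coordinates\<close> the functionals \<open>E i\<close> with \<open>i < d\<close> are coordinates on
  \<open>\<complex>\<^sup>n / K\<close>, where \<open>K\<close> is their common kernel, and \<open>s i\<close> is a dual system of vectors.
  The last assumption says that the image of \<open>G\<close> in \<open>\<complex>\<^sup>n / K\<close> is discrete.\<close>

locale quotient_coordinates =
  fixes G :: "(complex^'n) set" and d :: nat and E :: "nat \<Rightarrow> complex^'n \<Rightarrow> complex"
    and s :: "nat \<Rightarrow> complex^'n" and \<epsilon> :: real
  assumes subgroup: "zmod.subspace G"
    and E_add: "\<And>i v w. E i (v + w) = E i v + E i w"
    and E_scale: "\<And>i c v. E i (c *s v) = c * E i v"
    and E_s: "\<And>i j. i < d \<Longrightarrow> j < d \<Longrightarrow> E i (s j) = (if i = j then 1 else 0)"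
    and kernel: "\<And>v. (\<And>i. i < d \<Longrightarrow> E i v = 0) \<Longrightarrow> v \<in> G"
    and eps: "\<epsilon> > 0"
    and separated: "\<And>g i. g \<in> G \<Longrightarrow> (\<And>j. j < d \<Longrightarrow> cmod (E j g) < \<epsilon>) \<Longrightarrow> i < d \<Longrightarrow> E i g = 0"
begin

definition "coord v = (\<lambda>i. if i < d then E i v else 0)"
definition "lin z = (\<Sum>i<d. z i *s s i)"
text \<open>A cylinder along the common kernel. The radius is \<epsilon> / 2 because the coordinates
  of the difference of two of its points are then below \<epsilon>, as \<open>separated\<close>
  requires.\<close>

definition "cyl v0 = {v. \<forall>i<d. cmod (E i v - E i v0) < \<epsilon> / 2}"
definition "patch v0 = torus_proj G ` cyl v0"
definition "polydisc v0 = {z \<in> affine_space d. \<forall>i<d. cmod (z i - E i v0) < \<epsilon> / 2}"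
text \<open>Many lifts of \<open>y\<close> lie in the cylinder, which contains whole translates of
  the kernel, but all of them have the same coordinates.\<close>

definition "cmap v0 y = coord (SOME v. v \<in> cyl v0 \<and> torus_proj G v = y)"

section \<open>Linear algebra and topology of the coordinates\<close>

lemma E_0 [simp]: "E i 0 = 0"
  using E_scale[of i 0 0] by simp

lemma E_diff: "E i (v - w) = E i v - E i w"
  using E_add[of i "v - w" w] by simp

lemma E_sum: "E i (\<Sum>j\<in>J. f j) = (\<Sum>j\<in>J. E i (f j))"
  by (induction J rule: infinite_finite_induct) (auto simp: E_add)

lemma bounded_linear_E: "bounded_linear (E i)"
proof -
  have "E i (r *\<^sub>R v) = r *\<^sub>R E i v" for r v
  proof -
    have "r *\<^sub>R v = of_real r *s v" by (simp add: vec_eq_iff) (simp add: scaleR_conv_of_real)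
    then show ?thesis by (simp add: E_scale scaleR_conv_of_real)
  qed
  then have "linear (E i)"
    by (intro linearI) (auto simp: E_add)
  then show ?thesis
    by (simp add: linear_conv_bounded_linear)
qed

lemma continuous_on_E [continuous_intros]: "continuous_on S (E i)"
  by (rule linear_continuous_on[OF bounded_linear_E])

lemma complex_differentiable_at_E: "complex_differentiable_at (E i) v"
  unfolding complex_differentiable_at_def
  by (intro exI[of _ "E i"] conjI bounded_linear_imp_has_derivative bounded_linear_E) (simp add: E_scale)

lemma coord_affine [simp]: "coord v \<in> affine_space d"
  by (simp add: coord_def affine_space_def)

lemma coord_eq_iff: "coord v = coord w \<longleftrightarrow> (\<forall>i<d. E i v = E i w)"
  by (auto simp: coord_def fun_eq_iff)

lemma coord_lin [simp]:
  assumes "z \<in> affine_space d"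
  shows "coord (lin z) = z"
proof
  fix i
  have "E i (lin z) = z i" if "i < d"
    using that by (simp add: lin_def E_sum E_scale E_s if_distrib[of "(*) _"] sum.delta cong: if_cong)
  then show "coord (lin z) i = z i"
    using assms by (auto simp: coord_def affine_space_def)
qed

lemma E_lin: "z \<in> affine_space d \<Longrightarrow> i < d \<Longrightarrow> E i (lin z) = z i"
  using coord_lin[of z] by (metis coord_def)

text \<open>\<open>lin\<close> inverts \<open>coord\<close> only up to the common kernel, which lies
  in \<open>G\<close> and is invisible in the quotient.\<close>

lemma torus_proj_lin_coord: "torus_proj G (lin (coord v)) = torus_proj G v"
  unfolding torus_proj_eq_iff[OF subgroup]
  by (rule kernel) (simp add: E_diff E_lin coord_def[of v] affine_space_def)

lemma continuous_on_coord: "continuous_on S coord"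
proof (rule continuous_on_coordinatewise_then_product)
  show "continuous_on S (\<lambda>v. coord v i)" for i
    by (cases "i < d") (auto simp: coord_def continuous_on_E)
qed

lemma continuous_on_lin: "continuous_on S lin"
  unfolding lin_def
proof (intro continuous_on_sum)
  fix i
  have "continuous_on S (\<lambda>z::nat \<Rightarrow> complex. z i)"
    by (rule continuous_on_subset[OF continuous_on_product_coordinates]) simp
  then show "continuous_on S (\<lambda>z. z i *s s i)"
    by (rule bounded_linear.continuous_on[OF bounded_linear_scalar_mult_left])
qed

lemma lin_diff: "lin w - lin z = (\<Sum>i<d. (w i - z i) *s s i)"
  unfolding lin_def by (simp add: sum_subtractf[symmetric] vector_sub_rdistrib)

lemma open_cyl: "open (cyl v0)"
proof -
  have "cyl v0 = (\<Inter>i\<in>{..<d}. {v. cmod (E i v - E i v0) < \<epsilon> / 2})"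
    by (auto simp: cyl_def)
  moreover have "open {v. cmod (E i v - E i v0) < \<epsilon> / 2}" for i
    by (intro open_Collect_less continuous_intros)
  ultimately show ?thesis by (metis (no_types, lifting) open_INT finite_lessThan)
qed

lemma cyl_self [simp]: "v0 \<in> cyl v0"
  using eps by (simp add: cyl_def)

lemma openin_patch: "openin (torus_topology G) (patch v0)"
  unfolding patch_def by (rule openin_torus_proj_image[OF subgroup open_cyl])

lemma coord_polydisc [simp]: "coord v \<in> polydisc v0 \<longleftrightarrow> v \<in> cyl v0"
  by (auto simp: polydisc_def cyl_def) (auto simp: coord_def)

lemma lin_cyl: "z \<in> polydisc v0 \<Longrightarrow> lin z \<in> cyl v0"
  using coord_polydisc[of "lin z"] by (auto simp: polydisc_def)

lemma polydisc_affine: "z \<in> polydisc v0 \<Longrightarrow> z \<in> affine_space d"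
  by (simp add: polydisc_def)

lemma openin_polydisc: "openin (top_of_set (affine_space d)) (polydisc v0)"
proof -
  have "open (\<Inter>i\<in>{..<d}. {z::nat \<Rightarrow> complex. cmod (z i - E i v0) < \<epsilon> / 2})"
    by (intro open_INT finite_lessThan ballI open_Collect_less continuous_on_norm continuous_on_diff
        continuous_on_const continuous_on_product_coordinates)
  moreover have "polydisc v0 = affine_space d \<inter> (\<Inter>i\<in>{..<d}. {z. cmod (z i - E i v0) < \<epsilon> / 2})"
    by (auto simp: polydisc_def)
  ultimately show ?thesis
    unfolding openin_open by blast
qed

text \<open>The difference of the two lifts is an element of \<open>G\<close> with coordinates below
  \<epsilon>, so \<open>separated\<close> makes them vanish. This is what makes \<open>cmap\<close>
  well defined and injective.\<close>

lemma coord_eq_of_torus_proj_eq: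
  assumes "v \<in> cyl v0" "w \<in> cyl v0" "torus_proj G v = torus_proj G w"
  shows "coord v = coord w"
proof -
  have vw: "v - w \<in> G" using assms torus_proj_eq_iff[OF subgroup] by blast
  have "cmod (E j (v - w)) < \<epsilon>" if "j < d" for j
  proof -
    have "cmod (E j v - E j v0) < \<epsilon> / 2" "cmod (E j w - E j v0) < \<epsilon> / 2"
      using assms that by (auto simp: cyl_def)
    then show ?thesis
      using norm_triangle_ineq4[of "E j v - E j v0" "E j w - E j v0"] by (simp add: E_diff)
  qed
  from separated[OF vw this] show ?thesis
    by (simp add: coord_eq_iff E_diff)
qed

lemma cmap_torus_proj: "v \<in> cyl v0 \<Longrightarrow> cmap v0 (torus_proj G v) = coord v"
  unfolding cmap_def
  by (rule someI2[of _ v]) (auto intro: coord_eq_of_torus_proj_eq)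

lemma patch_cases:
  assumes "y \<in> patch v0"
  obtains v where "v \<in> cyl v0" "y = torus_proj G v"
  using assms unfolding patch_def by blast

lemma torus_proj_lin_cmap: "y \<in> patch v0 \<Longrightarrow> torus_proj G (lin (cmap v0 y)) = y"
  by (metis patch_cases cmap_torus_proj torus_proj_lin_coord)

lemma cmap_torus_proj_lin: "z \<in> polydisc v0 \<Longrightarrow> cmap v0 (torus_proj G (lin z)) = z"
  by (simp add: cmap_torus_proj lin_cyl polydisc_affine)

lemma torus_proj_lin_patch: "z \<in> polydisc v0 \<Longrightarrow> torus_proj G (lin z) \<in> patch v0"
  by (simp add: patch_def lin_cyl)

lemma cmap_polydisc: "y \<in> patch v0 \<Longrightarrow> cmap v0 y \<in> polydisc v0"
  by (metis patch_cases cmap_torus_proj coord_polydisc)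

lemma bij_betw_cmap: "bij_betw (cmap v0) (patch v0) (polydisc v0)"
  by (rule bij_betw_byWitness[of _ "\<lambda>z. torus_proj G (lin z)"])
    (auto simp: torus_proj_lin_cmap cmap_torus_proj_lin cmap_polydisc torus_proj_lin_patch)

lemma inv_into_cmap: "z \<in> polydisc v0 \<Longrightarrow> inv_into (patch v0) (cmap v0) z = torus_proj G (lin z)"
  using bij_betw_cmap[of v0] by (intro inv_into_f_eq)
    (auto simp: bij_betw_def cmap_torus_proj_lin torus_proj_lin_patch)

text \<open>\<open>holo\<close> measures the error against the sum of the moduli of the coordinates,
  a Frechet derivative against the norm of the vector; the constant \<open>C\<close> bounds the
  former by the latter.\<close>

lemma complex_differentiable_at_coord:
  assumes g: "holo d D g" and v: "coord v \<in> D"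
  shows "complex_differentiable_at (\<lambda>x. g (coord x)) v"
proof -
  obtain a where a: "((\<lambda>w. (g w - g (coord v) - (\<Sum>i<d. a i * (w i - coord v i))) /
       of_real (\<Sum>i<d. cmod (w i - coord v i))) \<longlongrightarrow> 0) (at (coord v) within affine_space d)"
    using g v unfolding holo_def by blast
  define g' where "g' = (\<lambda>u. \<Sum>i<d. a i * E i u)"
  have blg': "bounded_linear g'"
    unfolding g'_def by (intro bounded_linear_sum bounded_linear_const_mult bounded_linear_E)
  define C where "C = (\<Sum>i<d. onorm (E i))"
  have C: "(\<Sum>i<d. cmod (E i u)) \<le> C * norm u" for u
    unfolding C_def sum_distrib_right by (intro sum_mono onorm bounded_linear_E)
  have C0: "C \<ge> 0"
    unfolding C_def by (intro sum_nonneg onorm_pos_le bounded_linear_E)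
  have "((\<lambda>x. g (coord x)) has_derivative g') (at v)"
    unfolding has_derivative_at_alt
  proof (intro conjI blg' allI impI)
    fix e :: real assume e: "e > 0"
    \<comment> \<open>The summand 1 keeps the denominator positive when \<open>d = 0\<close> and
      hence \<open>C = 0\<close>.\<close>
    define e' where "e' = e / (C + 1)"
    have e': "e' > 0" using e C0 by (simp add: e'_def)
    from tendstoD[OF a e'] obtain S where S: "open S" "coord v \<in> S"
      "\<And>w. w \<in> S \<Longrightarrow> w \<noteq> coord v \<Longrightarrow> w \<in> affine_space d \<Longrightarrow>
        dist ((g w - g (coord v) - (\<Sum>i<d. a i * (w i - coord v i))) /
       of_real (\<Sum>i<d. cmod (w i - coord v i))) 0 < e'"
      unfolding eventually_at_topological by blast
    have "open (coord -` S)"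
      using continuous_on_coord[of UNIV] S(1) by (simp add: continuous_on_open_vimage)
    then obtain r where r: "r > 0" "ball v r \<subseteq> coord -` S"
      using S(2) open_contains_ball by blast
    show "\<exists>r>0. \<forall>y. norm (y - v) < r \<longrightarrow> norm (g (coord y) - g (coord v) - g' (y - v)) \<le> e * norm (y - v)"
    proof (intro exI[of _ r] conjI r allI impI)
      fix y assume "norm (y - v) < r"
      then have y: "coord y \<in> S" using r by (auto simp: dist_norm norm_minus_commute subset_iff)
      have g'y: "g' (y - v) = (\<Sum>i<d. a i * (coord y i - coord v i))"
        unfolding g'_def by (intro sum.cong) (auto simp: coord_def E_diff)
      have Ey: "(\<Sum>i<d. cmod (coord y i - coord v i)) = (\<Sum>i<d. cmod (E i (y - v)))"
        by (intro sum.cong) (auto simp: coord_def E_diff)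
      show "norm (g (coord y) - g (coord v) - g' (y - v)) \<le> e * norm (y - v)"
      proof (cases "coord y = coord v")
        \<comment> \<open>Along the kernel of the coordinates the quotient in \<open>holo\<close>
          says nothing, but the increment and \<open>g' (y - v)\<close> both vanish.\<close>
        case True
        then show ?thesis using g'y e by simp
      next
        case False
        define T where "T = (\<Sum>i<d. cmod (E i (y - v)))"
        have "T \<noteq> 0"
        proof
          assume "T = 0"
          then have "\<forall>i<d. E i (y - v) = 0" unfolding T_def by (subst (asm) sum_nonneg_eq_0_iff) auto
          then show False using False by (simp add: coord_eq_iff E_diff)
        qed
        moreover have "T \<ge> 0" unfolding T_def by (intro sum_nonneg) auto
        ultimately have T: "T > 0" by simp
        have "norm (g (coord y) - g (coord v) - g' (y - v)) / T < e'"
          using S(3)[OF y False coord_affine] T unfolding Ey g'y[symmetric] T_def[symmetric]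
          by (simp add: norm_divide)
        then have "norm (g (coord y) - g (coord v) - g' (y - v)) \<le> e' * T"
          using T by (simp add: field_simps)
        also have "\<dots> \<le> e' * (C * norm (y - v))"
          using C[of "y - v"] e' unfolding T_def by simp
        also have "\<dots> \<le> e * norm (y - v)"
        proof -
          have "e' * C \<le> e" unfolding e'_def using e C0 by (simp add: field_simps)
          then show ?thesis
            using mult_right_mono[of "e' * C" e "norm (y - v)"] by (simp add: mult.assoc)
        qed
        finally show ?thesis .
      qed
    qed
  qed
  then show ?thesis
    unfolding complex_differentiable_at_def
    by (intro exI[of _ g']) (simp add: g'_def E_scale sum_distrib_left algebra_simps)
qed

text \<open>The passage opposite to \<open>complex_differentiable_at_coord\<close>; here the norm of
  \<open>lin w - lin z\<close> has to be bounded by the coordinates.\<close>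

lemma holo_lin:
  assumes "\<And>z. z \<in> D \<Longrightarrow> complex_differentiable_at H (lin z)"
  shows "holo d D (\<lambda>z. H (lin z))"
  unfolding holo_def
proof
  fix z assume z: "z \<in> D"
  obtain H' where H': "(H has_derivative H') (at (lin z))" "\<And>c u. H' (c *s u) = c * H' u"
    using assms[OF z] by (rule complex_differentiable_atE) blast
  define C where "C = (\<Sum>i<d. norm (s i))"
  have C0: "C \<ge> 0" unfolding C_def by (intro sum_nonneg) auto
  have C: "norm (lin w - lin z) \<le> C * (\<Sum>i<d. cmod (w i - z i))" for w
  proof -
    have "norm (lin w - lin z) \<le> (\<Sum>i<d. norm (s i) * cmod (w i - z i))"
      unfolding lin_diff by (rule order_trans[OF norm_sum]) (simp only: norm_scalar_mult mult.commute order_refl)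
    also have "\<dots> \<le> (\<Sum>i<d. norm (s i) * (\<Sum>j<d. cmod (w j - z j)))"
      by (intro sum_mono mult_left_mono member_le_sum) auto
    finally show ?thesis by (simp add: C_def sum_distrib_right)
  qed
  have H'lin: "H' (lin w - lin z) = (\<Sum>i<d. H' (s i) * (w i - z i))" for w
    unfolding lin_diff linear_sum[OF has_derivative_linear[OF H'(1)]] by (simp only: H'(2) mult.commute)
  have "((\<lambda>w. (H (lin w) - H (lin z) - (\<Sum>i<d. H' (s i) * (w i - z i))) /
      of_real (\<Sum>i<d. cmod (w i - z i))) \<longlongrightarrow> 0) (at z within affine_space d)"
  proof (rule tendstoI)
    fix e :: real assume e: "e > 0"
    \<comment> \<open>The extra division by 2 yields the strict inequality demanded by the
      definition of a limit.\<close>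
    define e' where "e' = e / (C + 1) / 2"
    have e': "e' > 0" using e C0 by (simp add: e'_def)
    have e'C: "e' * C < e"
    proof -
      have "e' * C \<le> e / 2" unfolding e'_def using e C0 by (simp add: field_simps)
      then show ?thesis using e by simp
    qed
    obtain r where r: "r > 0" "\<And>y. norm (y - lin z) < r \<Longrightarrow>
        norm (H y - H (lin z) - H' (y - lin z)) \<le> e' * norm (y - lin z)"
      using H'(1) e' unfolding has_derivative_at_alt by blast
    have op: "open (lin -` ball (lin z) r)"
      using continuous_on_lin[of UNIV] by (simp add: continuous_on_open_vimage)
    show "\<forall>\<^sub>F w in at z within affine_space d.
        dist ((H (lin w) - H (lin z) - (\<Sum>i<d. H' (s i) * (w i - z i))) /
      of_real (\<Sum>i<d. cmod (w i - z i))) 0 < e"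
      unfolding eventually_at_topological
    proof (intro exI[of _ "lin -` ball (lin z) r"] conjI op ballI impI)
      show "z \<in> lin -` ball (lin z) r" using r by simp
      fix w assume w: "w \<in> lin -` ball (lin z) r"
      define T where "T = (\<Sum>i<d. cmod (w i - z i))"
      have T: "T \<ge> 0" unfolding T_def by (intro sum_nonneg) auto
      have "norm (H (lin w) - H (lin z) - H' (lin w - lin z)) \<le> e' * norm (lin w - lin z)"
        using w by (intro r) (simp add: dist_norm norm_minus_commute)
      also have "\<dots> \<le> e' * C * T"
        using C[of w] e' unfolding T_def by (simp add: mult.assoc)
      \<comment> \<open>For \<open>T = 0\<close> the quotient is 0 by the convention for
        division.\<close>
      finally have "norm (H (lin w) - H (lin z) - H' (lin w - lin z)) / T \<le> e' * C"
        using T e' C0 by (cases "T = 0") (auto simp: field_simps)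
      then show "dist ((H (lin w) - H (lin z) - (\<Sum>i<d. H' (s i) * (w i - z i))) /
      of_real (\<Sum>i<d. cmod (w i - z i))) 0 < e"
        using e'C T unfolding H'lin[symmetric] T_def[symmetric] by (simp add: norm_divide)
    qed
  qed
  then show "\<exists>a. ((\<lambda>w. (H (lin w) - H (lin z) - (\<Sum>i<d. a i * (w i - z i))) /
      of_real (\<Sum>i<d. cmod (w i - z i))) \<longlongrightarrow> 0) (at z within affine_space d)"
    by (intro exI[of _ "\<lambda>i. H' (s i)"])
qed

section \<open>The charts and the structure of a complex space\<close>

lemma zero_set_empty [simp]: "zero_set D {} = D"
  by (simp add: zero_set_def)

lemma topspace_subtopology_patch [simp]: "topspace (subtopology (torus_topology G) (patch v0)) = patch v0"
  using openin_patch[of v0] openin_subset by (auto simp: patch_def)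

lemma continuous_map_cmap:
  "continuous_map (subtopology (torus_topology G) (patch v0)) (top_of_set (polydisc v0)) (cmap v0)"
  unfolding continuous_map_def topspace_subtopology_patch
proof (intro conjI allI impI)
  show "cmap v0 \<in> patch v0 \<rightarrow> topspace (top_of_set (polydisc v0))"
    using cmap_polydisc by auto
  fix W assume "openin (top_of_set (polydisc v0)) W"
  then obtain S where S: "open S" "W = polydisc v0 \<inter> S" by (auto simp: openin_open)
  have "{y \<in> patch v0. cmap v0 y \<in> W} = torus_proj G ` (cyl v0 \<inter> coord -` S)"
    unfolding S(2) patch_def by (force simp: cmap_torus_proj)
  moreover have "open (cyl v0 \<inter> coord -` S)"
    using continuous_on_coord[of UNIV] S(1) open_cyl by (auto simp: continuous_on_open_vimage)
  ultimately have "openin (torus_topology G) {y \<in> patch v0. cmap v0 y \<in> W}"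
    using openin_torus_proj_image[OF subgroup] by simp
  then show "openin (subtopology (torus_topology G) (patch v0)) {y \<in> patch v0. cmap v0 y \<in> W}"
    unfolding openin_subtopology by blast
qed

lemma continuous_map_inv_cmap:
  "continuous_map (top_of_set (polydisc v0)) (subtopology (torus_topology G) (patch v0)) (inv_into (patch v0) (cmap v0))"
proof (rule continuous_map_eq)
  have "continuous_map (top_of_set (polydisc v0)) (torus_topology G) (torus_proj G \<circ> lin)"
    by (rule continuous_map_compose[OF _ continuous_map_torus_proj]) (simp add: continuous_on_lin)
  then show "continuous_map (top_of_set (polydisc v0)) (subtopology (torus_topology G) (patch v0)) (torus_proj G \<circ> lin)"
    by (simp add: continuous_map_in_subtopology torus_proj_lin_patch image_subset_iff)
qed (simp add: inv_into_cmap)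

text \<open>The local model is an open polydisc without equations, so the quotient is a manifold of
  dimension \<open>d\<close>. The same charts later carry the Kaehler potentials.\<close>

theorem chart_cmap: "chart (torus G) (patch v0) d (polydisc v0) {} (cmap v0)"
  unfolding chart_def biholomorphic_map_def
proof (intro conjI)
  let ?V = "open_subspace (torus G) (patch v0)" and ?M = "local_model d (polydisc v0) {}"
  have fV: "ftop ?V = subtopology (torus_topology G) (patch v0)"
    and fM: "ftop ?M = top_of_set (polydisc v0)"
    by (simp_all add: open_subspace_def local_model_def)
  have tV: "topspace (ftop ?V) = patch v0" and tM: "topspace (ftop ?M) = polydisc v0"
    by (simp_all only: fV fM topspace_subtopology_patch) simp
  show "openin (ftop (torus G)) (patch v0)" by (simp add: openin_patch)
  show "bij_betw (cmap v0) (topspace (ftop ?V)) (topspace (ftop ?M))"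
    unfolding tV tM by (rule bij_betw_cmap)
  show "holomorphic_map ?V ?M (cmap v0)"
    unfolding holomorphic_map_def
  proof (intro conjI allI impI)
    show "continuous_map (ftop ?V) (ftop ?M) (cmap v0)"
      unfolding fV fM by (rule continuous_map_cmap)
    fix W h assume h: "sect ?M W h"
    then have W: "openin (top_of_set (polydisc v0)) W"
      by (simp add: local_model_def)
    obtain S where S: "open S" "W = polydisc v0 \<inter> S" using W by (auto simp: openin_open)
    have "openin (subtopology (torus_topology G) (patch v0)) {y \<in> patch v0. cmap v0 y \<in> W}"
      using continuous_map_cmap W unfolding continuous_map_def topspace_subtopology_patch by blast
    then have op: "openin (torus_topology G) {y \<in> patch v0. cmap v0 y \<in> W}"
      using openin_patch openin_trans_full by blast
    have "complex_differentiable_at ((h \<circ> cmap v0) \<circ> torus_proj G) v"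
      if v: "torus_proj G v \<in> patch v0" "cmap v0 (torus_proj G v) \<in> W" for v
    proof -
      \<comment> \<open>\<open>v\<close> need not lie in the cylinder; differentiability is checked
        at a lift \<open>w\<close> that does and is then carried over to \<open>v\<close>.\<close>
      obtain w where w: "w \<in> cyl v0" "torus_proj G v = torus_proj G w"
        using v(1) by (rule patch_cases) blast
      have cw: "coord w \<in> W" using v(2) w by (simp add: cmap_torus_proj)
      then obtain D' g where D': "openin (top_of_set (affine_space d)) D'" "coord w \<in> D'" "holo d D' g"
        "\<forall>x \<in> D' \<inter> W. h x = g x"
        using h by (auto simp: local_model_def)
      obtain S' where S': "open S'" "D' = affine_space d \<inter> S'" using D'(1) by (auto simp: openin_open)
      have "complex_differentiable_at ((h \<circ> cmap v0) \<circ> torus_proj G) w"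
      proof (rule complex_differentiable_at_cong)
        show "complex_differentiable_at (\<lambda>x. g (coord x)) w"
          using D'(3,2) by (rule complex_differentiable_at_coord)
        show "open (cyl v0 \<inter> coord -` S \<inter> coord -` S')"
          using continuous_on_coord[of UNIV] S(1) S'(1) open_cyl
          by (auto simp: continuous_on_open_vimage)
        show "w \<in> cyl v0 \<inter> coord -` S \<inter> coord -` S'"
          using w cw D'(2) S(2) S'(2) by auto
        show "g (coord x) = ((h \<circ> cmap v0) \<circ> torus_proj G) x"
          if "x \<in> cyl v0 \<inter> coord -` S \<inter> coord -` S'" for x
          using that D'(4) S(2) S'(2) by (auto simp: cmap_torus_proj)
      qed
      then show ?thesis
        using complex_differentiable_at_torus_proj_cong[OF subgroup] w(2) by metis
    qed
    with op show "sect ?V {x \<in> topspace (ftop ?V). cmap v0 x \<in> W} (h \<circ> cmap v0)"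
      unfolding tV by (auto simp: open_subspace_def sect_torus)
  qed
  show "holomorphic_map ?M ?V (inv_into (topspace (ftop ?V)) (cmap v0))"
    unfolding holomorphic_map_def tV tM
  proof (intro conjI allI impI)
    show "continuous_map (ftop ?M) (ftop ?V) (inv_into (patch v0) (cmap v0))"
      unfolding fV fM by (rule continuous_map_inv_cmap)
    fix W h assume "sect ?V W h"
    then have W: "W \<subseteq> patch v0" "sect (torus G) W h"
      by (simp_all add: open_subspace_def)
    let ?D = "{z \<in> polydisc v0. inv_into (patch v0) (cmap v0) z \<in> W}"
    have "openin (subtopology (torus_topology G) (patch v0)) W"
      using W by (simp add: sect_torus openin_subset_topspace_eq openin_subtopology) blast
    then have op: "openin (top_of_set (polydisc v0)) ?D"
      using continuous_map_inv_cmap[of v0] unfolding continuous_map_def by auto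
    then have op': "openin (top_of_set (affine_space d)) ?D"
      using openin_polydisc openin_trans by blast
    have holo: "holo d ?D (\<lambda>z. (h \<circ> torus_proj G) (lin z))"
      by (rule holo_lin[of _ "h \<circ> torus_proj G"]) (use W(2) in \<open>auto simp: sect_torus inv_into_cmap\<close>)
    show "sect ?M ?D (h \<circ> inv_into (patch v0) (cmap v0))"
      unfolding local_model_def using op
      by (auto intro!: exI[of _ ?D] exI[of _ "\<lambda>z. (h \<circ> torus_proj G) (lin z)"] op' holo[unfolded o_def]
          simp: inv_into_cmap)
  qed
qed (auto simp: openin_polydisc)

text \<open>Within a cylinder all elements of \<open>G\<close> have the same coordinates. Those of a
  point outside \<open>G\<close> are different, because \<open>G\<close> contains the kernel, so an
  open condition on one coordinate separates it from \<open>G\<close>.\<close>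

lemma closed_G: "closed G"
proof -
  have "\<exists>S. open S \<and> v \<in> S \<and> S \<inter> G = {}" if v: "v \<notin> G" for v
  proof (cases "cyl v \<inter> G = {}")
    case True
    then show ?thesis using open_cyl[of v] cyl_self[of v] by blast
  next
    case False
    then obtain g where g: "g \<in> cyl v" "g \<in> G" by blast
    have "coord g \<noteq> coord v"
    proof
      assume "coord g = coord v"
      then have "v - g \<in> G" by (intro kernel) (simp add: coord_eq_iff E_diff)
      then show False using v zmod.subspace_add[OF subgroup _ g(2), of "v - g"] by simp
    qed
    then obtain i where i: "i < d" "E i g \<noteq> E i v" by (auto simp: coord_eq_iff)
    let ?S = "cyl v \<inter> {w. E i w \<noteq> E i g}"
    have "open {w. E i w \<noteq> E i g}"
      by (intro open_Collect_neq continuous_intros)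
    then have "open ?S" using open_cyl by blast
    moreover have "v \<in> ?S" using i by auto
    moreover have "w \<notin> G" if w: "w \<in> ?S" for w
    proof
      assume "w \<in> G"
      then have "torus_proj G w = torus_proj G g"
        using g(2) torus_proj_eq_iff[OF subgroup] zmod.subspace_diff[OF subgroup] by blast
      then have "coord w = coord g" using w g(1) coord_eq_of_torus_proj_eq[of w v g] by blast
      then show False using w i by (simp add: coord_eq_iff)
    qed
    ultimately show ?thesis by blast
  qed
  then have "open (- G)"
    by (subst open_subopen) (metis Compl_iff disjoint_eq_subset_Compl inf_commute)
  then show ?thesis by (simp add: closed_def)
qed

lemma complex_space_torus: "complex_space (torus G)"
  unfolding complex_space_def
proof (intro conjI ballI)
  fix x assume "x \<in> topspace (ftop (torus G))"
  then obtain v where "x = torus_proj G v" by auto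
  then have "x \<in> patch v" by (simp add: patch_def)
  then show "\<exists>V N D F \<psi>. x \<in> V \<and> chart (torus G) V N D F \<psi>"
    using chart_cmap by blast
qed (simp_all add: Hausdorff_space_torus subgroup closed_G function_sheaf_torus)

lemma le_complex_dim: "enat d \<le> complex_dim (torus G)"
proof -
  have "patch 0 \<noteq> {}"
    using cyl_self[of 0] unfolding patch_def by blast
  then show ?thesis
    unfolding complex_dim_def by (intro Sup_upper) (use chart_cmap[of 0] in blast)
qed

end

section \<open>Normality\<close>

text \<open>Riemann's removable singularity theorem, applied to one point at a time.\<close>

lemma holomorphic_extend_finite:
  assumes "finite Z" "open S" "Z \<subseteq> S" "f holomorphic_on S - Z"
    "\<And>\<xi>. \<xi> \<in> Z \<Longrightarrow> \<exists>B. \<forall>\<^sub>F z in at \<xi>. cmod (f z) \<le> B"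
  shows "\<exists>g. g holomorphic_on S \<and> (\<forall>z\<in>S - Z. g z = f z)"
  using assms
proof (induction Z arbitrary: S rule: finite_induct)
  case empty
  then show ?case by auto
next
  case (insert \<xi> Z)
  have "\<exists>g. g holomorphic_on S - {\<xi>} \<and> (\<forall>z\<in>S - {\<xi>} - Z. g z = f z)"
    using insert.prems insert.hyps by (intro insert.IH) (auto simp: Diff_insert2[symmetric])
  then obtain g where g: "g holomorphic_on S - {\<xi>}" "\<And>z. z \<in> S - {\<xi>} - Z \<Longrightarrow> g z = f z" by blast
  obtain B where B: "\<forall>\<^sub>F z in at \<xi>. cmod (f z) \<le> B" using insert.prems(4) by blast
  have "open (S - Z)" using insert.prems insert.hyps by (simp add: open_Diff finite_imp_closed)
  then have "\<forall>\<^sub>F z in at \<xi>. z \<in> S - Z - {\<xi>}"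
    using insert.prems insert.hyps eventually_at_in_open[of "S - Z" \<xi>] by auto
  with B have "\<forall>\<^sub>F z in at \<xi>. cmod (g z) \<le> B"
    by eventually_elim (use g(2) in auto)
  moreover have "\<xi> \<in> interior S" using insert.prems by (simp add: interior_open)
  ultimately obtain k where k: "k holomorphic_on S" "\<And>z. z \<in> S - {\<xi>} \<Longrightarrow> k z = g z"
    using holomorphic_on_extend_bounded[OF g(1)] by blast
  then show ?case using g(2) by (intro exI[of _ k]) auto
qed

lemma holomorphic_finite_zeros_cball:
  assumes "B holomorphic_on ball 0 R" "r < R" "t0 \<in> ball 0 R" "B t0 \<noteq> 0"
  shows "finite {t \<in> cball 0 r. B t = 0}"
proof (cases "B constant_on ball 0 R")
  case True
  then obtain y where "\<And>t. t \<in> ball 0 R \<Longrightarrow> B t = y"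
    unfolding constant_on_def by blast
  then have "B t \<noteq> 0" if "t \<in> cball 0 r" for t
    using assms(2-4) that by (metis dist_0_norm le_less_trans mem_ball mem_cball)
  then have "{t \<in> cball 0 r. B t = 0} = {}" by (simp only: Collect_empty_eq) simp
  then show ?thesis by (simp only: finite.emptyI)
next
  case False
  have "cball 0 r \<subseteq> ball (0::complex) R"
    using assms(2) by auto
  then show ?thesis
    by (rule holomorphic_compact_finite_zeros[OF assms(1) open_ball connected_ball compact_cball _ False])
qed

text \<open>The bound makes the zeros of \<open>B\<close> removable for \<open>A / B\<close>, and
  the extension has the mean value property on the circle. If \<open>B 0 = 0\<close>, the bound
  forces \<open>A 0 = 0\<close>, so the identity also holds there.\<close>

lemma bounded_quotient_mean_value:
  assumes A: "A holomorphic_on ball 0 R" and B: "B holomorphic_on ball 0 R" and r: "0 < r" "r < R"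
    and nz: "\<And>t. cmod t = r \<Longrightarrow> B t \<noteq> 0" and C: "\<And>t. cmod t < r \<Longrightarrow> cmod (A t) \<le> C * cmod (B t)"
  shows "A 0 = integral {0..1} (\<lambda>s. A (circlepath 0 r s) / B (circlepath 0 r s)) * B 0"
proof -
  define Z where "Z = {t \<in> cball 0 r. B t = 0}"
  have fin: "finite Z"
    unfolding Z_def using nz[of "of_real r"] r by (intro holomorphic_finite_zeros_cball[OF B, of r "of_real r"]) auto
  have Zr: "Z \<subseteq> ball 0 r"
    using nz by (force simp: Z_def)
  have "open (ball 0 R \<inter> B -` (- {0}))"
    by (rule continuous_open_preimage[OF holomorphic_on_imp_continuous_on[OF B]]) auto
  then have "open {t \<in> ball 0 R. B t \<noteq> 0}"
    by (simp add: vimage_def Int_def)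
  then have open_S: "open (ball 0 r \<union> {t \<in> ball 0 R. B t \<noteq> 0})" by auto
  \<comment> \<open>An open neighbourhood of the closed disc in which \<open>B\<close> has no zeros
    except those inside the open disc.\<close>
  define S where "S = ball 0 r \<union> {t \<in> ball 0 R. B t \<noteq> 0}"
  have SR: "S \<subseteq> ball 0 R" using r by (auto simp: S_def)
  have nzS: "B t \<noteq> 0" if "t \<in> S - Z" for t using that by (auto simp: S_def Z_def)
  have cS: "cball 0 r \<subseteq> S"
    using nz r by (force simp: S_def)
  have "(\<lambda>t. A t / B t) holomorphic_on S - Z"
    by (intro holomorphic_intros holomorphic_on_subset[OF A] holomorphic_on_subset[OF B])
      (use SR nzS in auto)
  moreover have "\<exists>M. \<forall>\<^sub>F t in at \<xi>. cmod (A t / B t) \<le> M" if "\<xi> \<in> Z" for \<xi>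
  proof -
    have "open (ball 0 r - (Z - {\<xi>}))"
      using fin by (intro open_Diff finite_imp_closed) auto
    then have "\<forall>\<^sub>F t in at \<xi>. t \<in> ball 0 r - (Z - {\<xi>}) - {\<xi>}"
      by (rule eventually_at_in_open) (use that Zr in auto)
    then have "\<forall>\<^sub>F t in at \<xi>. cmod (A t / B t) \<le> C"
    proof eventually_elim
      case (elim t)
      then have t: "t \<in> ball 0 r" "t \<notin> Z" by auto
      then have "B t \<noteq> 0" by (auto simp: Z_def)
      then show ?case using C[of t] t by (simp add: norm_divide divide_le_eq)
    qed
    then show ?thesis ..
  qed
  moreover have "Z \<subseteq> S" using Zr by (auto simp: S_def)
  ultimately obtain g where g: "g holomorphic_on S" "\<And>t. t \<in> S - Z \<Longrightarrow> g t = A t / B t"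
    using holomorphic_extend_finite[OF fin, of S "\<lambda>t. A t / B t"] open_S unfolding S_def by blast
  have "((\<lambda>u. g u / (u - 0)) has_contour_integral 2 * of_real pi * \<i> * g 0) (circlepath 0 r)"
    by (rule Cauchy_integral_circlepath)
      (use g(1) cS r in \<open>auto intro!: holomorphic_on_imp_continuous_on holomorphic_on_subset[OF g(1)]\<close>)
  then have "2 * of_real pi * \<i> * g 0 = contour_integral (circlepath 0 r) (\<lambda>u. g u / u)"
    by (simp add: contour_integral_unique)
  also have "\<dots> = integral {0..1} (\<lambda>s. 2 * of_real pi * \<i> * g (circlepath 0 r s))"
    unfolding contour_integral_integral vector_derivative_circlepath
    using r by (intro integral_cong) (simp add: circlepath_def part_circlepath_def linepath_def mult_ac)
  also have "\<dots> = 2 * of_real pi * \<i> * integral {0..1} (\<lambda>s. g (circlepath 0 r s))"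
    by (rule integral_mult_right)
  finally have "g 0 = integral {0..1} (\<lambda>s. g (circlepath 0 r s))"
    by simp
  also have "\<dots> = integral {0..1} (\<lambda>s. A (circlepath 0 r s) / B (circlepath 0 r s))"
  proof (rule integral_cong)
    fix s :: real
    have "cmod (circlepath 0 r s) = r"
      using r by (simp add: circlepath_def part_circlepath_def linepath_def norm_mult norm_exp_eq_Re)
    then have "circlepath 0 r s \<in> S - Z" using cS Zr by (auto simp: subset_iff)
    then show "g (circlepath 0 r s) = A (circlepath 0 r s) / B (circlepath 0 r s)" by (rule g(2))
  qed
  finally have g0: "g 0 = integral {0..1} (\<lambda>s. A (circlepath 0 r s) / B (circlepath 0 r s))" .
  have "A 0 = g 0 * B 0"
  proof (cases "0 \<in> Z")
    case True
    then show ?thesis using C[of 0] r by (simp add: Z_def)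
  next
    case False
    moreover have "0 \<in> S" using r by (simp add: S_def)
    ultimately show ?thesis using g(2)[of 0] nzS[of 0] by simp
  qed
  then show ?thesis using g0 by simp
qed

text \<open>Cauchy's bound for the roots of a monic polynomial, in homogeneous form so that
  \<open>b = 0\<close> is included: if \<open>a\<close> exceeded it, the leading term would dominate
  the sum of the others.\<close>

lemma monic_root_bound:
  fixes a b :: complex
  assumes eq: "a ^ m + (\<Sum>i<m. c i * a ^ i * b ^ (m - i)) = 0" and M: "\<And>i. i < m \<Longrightarrow> cmod (c i) \<le> M i"
  shows "cmod a \<le> (1 + (\<Sum>i<m. M i)) * cmod b"
proof (rule ccontr)
  let ?C = "1 + (\<Sum>i<m. M i)"
  assume "\<not> cmod a \<le> ?C * cmod b"
  then have lt: "?C * cmod b < cmod a" by simp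
  have M0: "(\<Sum>i<m. M i) \<ge> 0"
    using M by (intro sum_nonneg) (metis lessThan_iff norm_ge_zero order_trans)
  then have C: "?C \<ge> 1" by simp
  have ba: "cmod b \<le> cmod a / ?C"
    using lt C by (simp add: field_simps)
  have a0: "cmod a > 0"
  proof -
    have "0 \<le> ?C * cmod b" using C by simp
    then show ?thesis using lt by linarith
  qed
  have "cmod a ^ m = cmod (\<Sum>i<m. c i * a ^ i * b ^ (m - i))"
    using eq by (metis add_eq_0_iff norm_minus_cancel norm_power)
  also have "\<dots> \<le> (\<Sum>i<m. M i * (cmod a ^ m / ?C))"
  proof (rule order_trans[OF norm_sum sum_mono])
    fix i assume i: "i \<in> {..<m}"
    have "cmod b ^ (m - i) \<le> (cmod a / ?C) ^ (m - i)"
      using ba by (intro power_mono) auto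
    also have "\<dots> \<le> cmod a ^ (m - i) / ?C"
    proof -
      have "?C \<le> ?C ^ (m - i)" using C i self_le_power[of ?C "m - i"] by auto
      then show ?thesis
        using C by (simp add: power_divide divide_left_mono)
    qed
    finally have "cmod a ^ i * cmod b ^ (m - i) \<le> cmod a ^ i * (cmod a ^ (m - i) / ?C)"
      by (intro mult_left_mono) auto
    also have "\<dots> = cmod a ^ m / ?C"
      using i by (simp add: power_add[symmetric])
    finally have "cmod (c i) * (cmod a ^ i * cmod b ^ (m - i)) \<le> M i * (cmod a ^ m / ?C)"
      using M[of i] i C by (intro mult_mono) (auto intro: order_trans[OF norm_ge_zero])
    then show "cmod (c i * a ^ i * b ^ (m - i)) \<le> M i * (cmod a ^ m / ?C)"
      by (simp add: norm_mult norm_power mult.assoc)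
  qed
  also have "\<dots> = (\<Sum>i<m. M i) * (cmod a ^ m / ?C)"
    by (simp only: sum_distrib_right)
  also have "\<dots> = (\<Sum>i<m. M i) / ?C * cmod a ^ m"
    by simp
  also have "\<dots> < 1 * cmod a ^ m"
    using a0 C by (intro mult_strict_right_mono) auto
  finally show False by simp
qed

lemma circlepath_in_circle: "r \<ge> 0 \<Longrightarrow> cmod (circlepath 0 r s) = r"
  by (simp add: circlepath_def part_circlepath_def linepath_def norm_mult norm_exp_eq_Re)

text \<open>If \<open>a / b\<close> is integral, it is bounded, and its extension across the zeros of \<open>b\<close> is
  the mean value of \<open>a / b\<close> over a circle in a complex line on which \<open>b\<close> does not vanish identically.\<close>

lemma normal_space_torus:
  fixes G :: "(complex^'n) set"
  assumes G: "zmod.subspace G"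
  shows "normal_space (torus G)"
  unfolding normal_space_def
proof
  fix y assume "y \<in> topspace (ftop (torus G))"
  then obtain v0 where y: "y = torus_proj G v0" by auto
  show "normal_at (torus G) y"
    unfolding normal_at_def
  proof (intro allI impI)
    fix a b
    assume a: "germ_at (torus G) y a" and b: "germ_at (torus G) y b"
      and nzd: "germ_nonzerodivisor (torus G) y b"
      and ex: "\<exists>m c. (\<forall>i<m. germ_at (torus G) y (c i)) \<and>
        germ_eq (torus G) y (\<lambda>x. a x ^ m + (\<Sum>i<m. c i x * a x ^ i * b x ^ (m - i))) (\<lambda>x. 0)"
    obtain m c where c: "\<And>i. i < m \<Longrightarrow> germ_at (torus G) y (c i)"
      and eqg: "germ_eq (torus G) y (\<lambda>x. a x ^ m + (\<Sum>i<m. c i x * a x ^ i * b x ^ (m - i))) (\<lambda>x. 0)"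
      using ex by blast
    obtain Wa where Wa: "y \<in> Wa" "sect (torus G) Wa a" using a unfolding germ_at_def by blast
    obtain Wb where Wb: "y \<in> Wb" "sect (torus G) Wb b" using b unfolding germ_at_def by blast
    obtain W where W: "\<And>i. i < m \<Longrightarrow> y \<in> W i" "\<And>i. i < m \<Longrightarrow> sect (torus G) (W i) (c i)"
      using c unfolding germ_at_def by metis
    obtain We where We: "openin (torus_topology G) We" "y \<in> We"
      "\<And>x. x \<in> We \<Longrightarrow> a x ^ m + (\<Sum>i<m. c i x * a x ^ i * b x ^ (m - i)) = 0"
      using eqg unfolding germ_eq_def ftop_torus by blast
    define Ov where "Ov = torus_proj G -` Wa \<inter> torus_proj G -` Wb \<inter> torus_proj G -` We
      \<inter> (\<Inter>i\<in>{..<m}. torus_proj G -` W i)"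
    have "open Ov"
      unfolding Ov_def using Wa(2) Wb(2) W(2) We(1)
      by (intro open_Int open_INT ballI finite_lessThan open_vimage_torus_proj) (auto simp: sect_torus)
    moreover have "v0 \<in> Ov" using Wa(1) Wb(1) W(1) We(2) by (simp add: Ov_def y)
    ultimately obtain R' where R': "R' > 0" "cball v0 R' \<subseteq> Ov"
      using open_contains_cball by blast
    \<comment> \<open>Base points will vary in radius \<open>R\<close>, and the discs attached to
      them contribute less than another \<open>R\<close>.\<close>
    define R where "R = R' / 2"
    have R: "R > 0" "cball v0 (2 * R) \<subseteq> Ov" using R' by (simp_all add: R_def)
    have cda: "complex_differentiable_at (a \<circ> torus_proj G) v" if "v \<in> Ov" for v
      using that Wa(2) by (simp add: Ov_def sect_torus)
    have cdb: "complex_differentiable_at (b \<circ> torus_proj G) v" if "v \<in> Ov" for v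
      using that Wb(2) by (simp add: Ov_def sect_torus)
    have cdc: "complex_differentiable_at (c i \<circ> torus_proj G) v" if "v \<in> Ov" "i < m" for v i
      using that W(2)[OF that(2)] by (simp add: Ov_def sect_torus)
    have "\<exists>M. \<forall>v\<in>cball v0 (2 * R). cmod (c i (torus_proj G v)) \<le> M" if i: "i < m" for i
    proof -
      have "continuous_on (cball v0 (2 * R)) (c i \<circ> torus_proj G)"
        using cdc i R(2) by (intro complex_differentiable_imp_continuous_on) blast
      then have "bounded ((c i \<circ> torus_proj G) ` cball v0 (2 * R))"
        by (intro compact_imp_bounded compact_continuous_image) auto
      then show ?thesis unfolding bounded_iff by force
    qed
    then obtain M where M: "\<And>i v. i < m \<Longrightarrow> v \<in> cball v0 (2 * R) \<Longrightarrow> cmod (c i (torus_proj G v)) \<le> M i"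
      by metis
    define C where "C = 1 + (\<Sum>i<m. M i)"
    have ab: "cmod (a (torus_proj G v)) \<le> C * cmod (b (torus_proj G v))" if "v \<in> cball v0 (2 * R)" for v
      unfolding C_def
    proof (rule monic_root_bound)
      show "a (torus_proj G v) ^ m
         + (\<Sum>i<m. c i (torus_proj G v) * a (torus_proj G v) ^ i * b (torus_proj G v) ^ (m - i)) = 0"
        using that R(2) by (intro We(3)) (auto simp: Ov_def)
    next
      show "cmod (c i (torus_proj G v)) \<le> M i" if "i < m" for i
        using M[OF that] \<open>v \<in> cball v0 (2 * R)\<close> .
    qed
    \<comment> \<open>If \<open>b\<close> vanished near \<open>y\<close>, it would annihilate the
      germ 1, contrary to its being a non-zero-divisor.\<close>
    have "\<exists>v1\<in>ball v0 (R / 2). b (torus_proj G v1) \<noteq> 0"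
    proof (rule ccontr)
      assume neg: "\<not> ?thesis"
      let ?W = "torus_proj G ` ball v0 (R / 2)"
      have op: "openin (torus_topology G) ?W" by (rule openin_torus_proj_image[OF G open_ball])
      have yW: "y \<in> ?W" using R by (simp add: y)
      have "germ_at (torus G) y (\<lambda>x. 1)"
        unfolding germ_at_def by (rule exI[of _ ?W]) (use op yW in \<open>auto simp: sect_torus o_def\<close>)
      moreover have "germ_eq (torus G) y (\<lambda>x. b x * 1) (\<lambda>x. 0)"
        unfolding germ_eq_def by (rule exI[of _ ?W]) (use op yW neg in auto)
      ultimately have "germ_eq (torus G) y (\<lambda>x. 1) (\<lambda>x. 0)"
        using nzd unfolding germ_nonzerodivisor_def by blast
      then show False unfolding germ_eq_def by auto
    qed
    then obtain v1 where v1: "dist v0 v1 < R / 2" "b (torus_proj G v1) \<noteq> 0" by auto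
    \<comment> \<open>The factor 2 places \<open>v1\<close> at the parameter 1/2 of the line through
      \<open>v0\<close>, well inside the unit disc.\<close>
    define u where "u = 2 *s (v1 - v0)"
    have u: "norm u < R" using v1(1) unfolding u_def norm_scalar_mult by (simp add: dist_norm norm_minus_commute)
    have near: "v + t *s u \<in> ball v0 (2 * R)" if "v \<in> ball v0 R" "cmod t < 1" for v t
    proof -
      have "norm (t *s u) \<le> norm u"
        using that unfolding norm_scalar_mult by (simp add: mult_left_le_one_le)
      then show ?thesis
        using that u norm_triangle_ineq4[of "v0 - v" "t *s u"] by (simp add: dist_norm algebra_simps)
    qed
    define line where "line h v t = (h \<circ> torus_proj G) (v + t *s u)" for h :: "(complex^'n) set \<Rightarrow> complex" and v t
    have holo_a: "line a v holomorphic_on ball 0 1" and holo_b: "line b v holomorphic_on ball 0 1"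
      if "v \<in> ball v0 R" for v
    proof -
      have "v + t *s u \<in> Ov" if t: "t \<in> ball 0 1" for t
      proof -
        have "v + t *s u \<in> ball v0 (2 * R)" using t \<open>v \<in> ball v0 R\<close> by (intro near) auto
        then show ?thesis using R(2) by (meson ball_subset_cball subsetD)
      qed
      then show "line a v holomorphic_on ball 0 1" "line b v holomorphic_on ball 0 1"
        unfolding line_def by (intro complex_differentiable_line_holomorphic cda cdb; blast)+
    qed
    have v0R: "v0 \<in> ball v0 R" using R by simp
    have half: "line b v0 (1/2) \<noteq> 0"
      using v1(2) by (simp add: line_def u_def vector_smult_assoc)
    have h: "(1/2 :: complex) \<in> ball 0 1"
      by (simp add: norm_divide)
    have "finite {t \<in> cball 0 (3/4). line b v0 t = 0}"
      by (rule holomorphic_finite_zeros_cball[of "line b v0" 1 "3/4" "1/2", OF holo_b[OF v0R] _ h half]) simp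
    \<comment> \<open>Only finitely many radii meet a zero of \<open>b\<close> on this line; any
      other radius gives a circle free of zeros.\<close>
    then have "infinite ({0<..<3/4} - cmod ` {t \<in> cball 0 (3/4). line b v0 t = 0})"
      by (intro Diff_infinite_finite finite_imageI) auto
    then obtain r where "r \<in> {0<..<3/4} - cmod ` {t \<in> cball 0 (3/4). line b v0 t = 0}"
      using infinite_imp_nonempty by blast
    then have r: "0 < r" "r < 3/4" "r \<notin> cmod ` {t \<in> cball 0 (3/4). line b v0 t = 0}"
      by simp_all
    have nzr: "line b v0 t \<noteq> 0" if "cmod t = r" for t
      using r that by auto
    define U where "U = {v \<in> ball v0 (2 * R). (b \<circ> torus_proj G) v \<noteq> 0}"
    have UO: "U \<subseteq> Ov" using R(2) ball_subset_cball[of v0 "2*R"] by (auto simp: U_def)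
    have "continuous_on (ball v0 (2 * R)) (b \<circ> torus_proj G)"
      using R(2) ball_subset_cball[of v0 "2*R"] by (intro complex_differentiable_imp_continuous_on cdb) blast
    then have "open (ball v0 (2 * R) \<inter> (b \<circ> torus_proj G) -` (- {0}))"
      by (intro continuous_open_preimage) auto
    then have openU: "open U" by (simp add: U_def vimage_def Int_def)
    define \<gamma> where "\<gamma> s = circlepath 0 r s *s u" for s
    have cont\<gamma>: "continuous_on S \<gamma>" for S
      unfolding \<gamma>_def circlepath_def part_circlepath_def linepath_def
      by (intro bounded_linear.continuous_on[OF bounded_linear_scalar_mult_left] continuous_intros)
    have "compact ((\<lambda>s. v0 + \<gamma> s) ` {0..1})"
      by (intro compact_continuous_image continuous_on_add continuous_on_const cont\<gamma>) auto
    moreover have "(\<lambda>s. v0 + \<gamma> s) ` {0..1} \<subseteq> U"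
    proof
      fix w assume "w \<in> (\<lambda>s. v0 + \<gamma> s) ` {0..1}"
      then obtain s where s: "w = v0 + circlepath 0 r s *s u" by (auto simp: \<gamma>_def)
      have "cmod (circlepath 0 r s) = r" using r by (simp add: circlepath_in_circle)
      then show "w \<in> U"
        using near[OF v0R, of "circlepath 0 r s"] nzr[of "circlepath 0 r s"] r by (simp add: U_def s line_def)
    qed
    ultimately obtain e where e: "e > 0" "(\<Union>x\<in>(\<lambda>s. v0 + \<gamma> s) ` {0..1}. ball x e) \<subseteq> U"
      by (rule compact_subset_open_imp_ball_epsilon_subset[OF _ openU])
    \<comment> \<open>Within distance \<open>e\<close> of \<open>v0\<close> the translated circle
      still avoids the zeros of \<open>b\<close>; within distance \<open>R\<close> the whole disc
      stays in the domain.\<close>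
    define \<delta> where "\<delta> = min e R"
    have \<delta>: "\<delta> > 0" "\<delta> \<le> R" using e R by (auto simp: \<delta>_def)
    have inU: "v + \<gamma> s \<in> U" if "v \<in> ball v0 \<delta>" "s \<in> {0..1}" for v s
    proof -
      have "v + \<gamma> s \<in> ball (v0 + \<gamma> s) e" using that by (simp add: \<delta>_def dist_norm)
      then show ?thesis using e(2) that by blast
    qed
    define quo where "quo = (\<lambda>x. (a \<circ> torus_proj G) x / (b \<circ> torus_proj G) x)"
    have cdquo: "complex_differentiable_at quo x" if "x \<in> U" for x
      unfolding quo_def using that UO by (intro complex_differentiable_at_divide cda cdb) (auto simp: U_def)
    define Q where "Q v = integral {0..1} (\<lambda>s. quo (v + \<gamma> s))" for v
    \<comment> \<open>Any lift serves: \<open>Q\<close> integrates functions composed with the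
      projection and is therefore \<open>G\<close>-invariant.\<close>
    define q where "q y = Q (SOME v. torus_proj G v = y)" for y
    have qQ: "q (torus_proj G v) = Q v" for v
    proof -
      define w where "w = (SOME w. torus_proj G w = torus_proj G v)"
      have "torus_proj G w = torus_proj G v" unfolding w_def by (rule someI[of _ v]) simp
      then have "w - v \<in> G" using torus_proj_eq_iff[OF G] by blast
      then have "torus_proj G (w + x) = torus_proj G (v + x)" for x
        by (simp add: torus_proj_eq_iff[OF G])
      then show ?thesis unfolding q_def w_def[symmetric] Q_def quo_def by simp
    qed
    have cdQ: "complex_differentiable_at Q v" if v: "v \<in> ball v0 \<delta>" for v
    proof -
      have "((\<lambda>x. integral {0..1} (\<lambda>s. 1 * quo (x + \<gamma> s))) has_derivative
        (\<lambda>h. integral {0..1} (\<lambda>s. 1 * frechet_derivative quo (at (v + \<gamma> s)) h))) (at v)"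
        by (rule has_derivative_integral_translates[OF openU])
          (use cdquo inU[OF v] openU in \<open>auto intro!: cont\<gamma> complex_differentiable_at_imp_differentiable
            complex_differentiable_frechet_continuous\<close>)
      then have "(Q has_derivative (\<lambda>h. integral {0..1} (\<lambda>s. frechet_derivative quo (at (v + \<gamma> s)) h))) (at v)"
        unfolding Q_def by simp
      moreover have "integral {0..1} (\<lambda>s. frechet_derivative quo (at (v + \<gamma> s)) (k *s h))
        = k * integral {0..1} (\<lambda>s. frechet_derivative quo (at (v + \<gamma> s)) h)" for k h
      proof -
        have "integral {0..1} (\<lambda>s. frechet_derivative quo (at (v + \<gamma> s)) (k *s h))
          = integral {0..1} (\<lambda>s. k * frechet_derivative quo (at (v + \<gamma> s)) h)"
          by (intro integral_cong complex_differentiable_at_frechet(2) cdquo inU v)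
        then show ?thesis by simp
      qed
      ultimately show ?thesis unfolding complex_differentiable_at_def by blast
    qed
    let ?W = "torus_proj G ` ball v0 \<delta>"
    have opW: "openin (torus_topology G) ?W" by (rule openin_torus_proj_image[OF G open_ball])
    have yW: "y \<in> ?W" using \<delta> by (simp add: y)
    have qp: "q \<circ> torus_proj G = Q" using qQ by (simp add: fun_eq_iff)
    have "complex_differentiable_at (q \<circ> torus_proj G) v" if "torus_proj G v \<in> ?W" for v
    proof -
      obtain w where "w \<in> ball v0 \<delta>" "torus_proj G w = torus_proj G v" using \<open>torus_proj G v \<in> ?W\<close> by (elim imageE) simp
      then show ?thesis
        using complex_differentiable_at_torus_proj_cong[OF G, of w v q] cdQ qp by simp
    qed
    then have "sect (torus G) ?W q" using opW by (simp add: sect_torus)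
    then have "germ_at (torus G) y q" unfolding germ_at_def using yW by blast
    moreover have "germ_eq (torus G) y a (\<lambda>x. q x * b x)"
      unfolding germ_eq_def ftop_torus
    proof (rule exI[of _ ?W], rule conjI[OF opW], rule conjI[OF yW], rule ballI)
      fix x assume "x \<in> ?W"
      then obtain v where v: "v \<in> ball v0 \<delta>" "x = torus_proj G v" by blast
      have vR: "v \<in> ball v0 R" using v \<delta> by auto
      have "line a v 0 = integral {0..1} (\<lambda>s. line a v (circlepath 0 r s) / line b v (circlepath 0 r s)) * line b v 0"
      proof (rule bounded_quotient_mean_value[OF holo_a[OF vR] holo_b[OF vR] r(1)])
        fix t assume t: "cmod t = r"
        then have "t \<in> path_image (circlepath 0 r)"
          using r by simp
        then obtain s where s: "s \<in> {0..1}" "t = circlepath 0 r s"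
          unfolding path_image_def by blast
        then show "line b v t \<noteq> 0"
          using inU[OF v(1) s(1)] unfolding U_def line_def \<gamma>_def by simp
      next
        fix t assume "cmod t < r"
        then have "v + t *s u \<in> cball v0 (2 * R)"
          using near[OF vR, of t] r by simp
        then show "cmod (line a v t) \<le> C * cmod (line b v t)"
          unfolding line_def o_apply by (rule ab)
      next
        show "r < 1" using r(2) by simp
      qed
      then show "a x = q x * b x"
        unfolding v(2) qQ Q_def quo_def line_def \<gamma>_def by simp
    qed
    ultimately show "\<exists>q. germ_at (torus G) y q \<and> germ_eq (torus G) y a (\<lambda>x. q x * b x)"
      by (intro exI[of _ q] conjI)
  qed
qed

context quotient_coordinates
begin

section \<open>Dimension\<close>

text \<open>\<open>complex_dim\<close> is a supremum over all charts, so charts of unexpected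
  dimension must be excluded. If \<open>N\<close> were at least n, an n-dimensional slice of the
  chart, followed by \<open>lin\<close> after \<open>cmap\<close>, would map continuously and
  injectively onto an open subset of C^n by invariance of domain. Moving in it along the kernel
  vector \<open>k\<close> does not change the coordinates, a contradiction.\<close>

lemma chart_dim_less:
  assumes ch: "chart (torus G) V N D {} \<psi>" and ne: "V \<noteq> {}"
    and k: "k \<noteq> 0" "\<And>i. i < d \<Longrightarrow> E i k = 0"
  shows "N < CARD('n)"
proof (rule ccontr)
  assume "\<not> N < CARD('n)"
  then have N: "CARD('n) \<le> N" by simp
  obtain \<iota> :: "'n \<Rightarrow> nat" where \<iota>: "bij_betw \<iota> UNIV {..<CARD('n)}"
    using ex_bij_betw_finite_nat[of "UNIV :: 'n set"] by (auto simp: atLeast0LessThan)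
  have inj\<iota>: "inj \<iota>" using \<iota> by (simp add: bij_betw_def)
  have \<iota>N: "\<iota> j < N" for j
    using \<iota> N by (meson UNIV_I bij_betwE lessThan_iff less_le_trans)
  have opV: "openin (torus_topology G) V" and opD: "openin (top_of_set (affine_space N)) D"
    and bih: "biholomorphic_map (open_subspace (torus G) V) (local_model N D {}) \<psi>"
    using ch by (simp_all add: chart_def)
  have tV: "topspace (ftop (open_subspace (torus G) V)) = V"
    using openin_subset[OF opV] by (auto simp: open_subspace_def)
  have tD: "topspace (ftop (local_model N D {})) = D"
    by (simp add: local_model_def)
  define \<phi> where "\<phi> = inv_into V \<psi>"
  have bij: "bij_betw \<psi> V D"
    using bih unfolding biholomorphic_map_def tV tD by blast
  have cont\<phi>: "continuous_map (top_of_set D) (subtopology (torus_topology G) V) \<phi>"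
  proof -
    have "continuous_map (ftop (local_model N D {})) (ftop (open_subspace (torus G) V)) \<phi>"
      using bih unfolding biholomorphic_map_def tV holomorphic_map_def \<phi>_def by blast
    then show ?thesis by (simp add: local_model_def open_subspace_def)
  qed
  have inj\<phi>: "inj_on \<phi> D"
    unfolding \<phi>_def using bij by (metis bij_betw_def inj_on_inv_into order_refl)
  obtain y0 where y0: "y0 \<in> V" using ne by blast
  then obtain v0 where v0: "y0 = torus_proj G v0"
    using openin_subset[OF opV] by auto
  define z0 where "z0 = \<psi> y0"
  have z0: "z0 \<in> D" "\<phi> z0 = y0"
    unfolding z0_def \<phi>_def using bij y0 by (auto simp: bij_betw_def)
  obtain S where S: "open S" "D = affine_space N \<inter> S" using opD by (auto simp: openin_open)
  \<comment> \<open>A copy of C^n through \<open>z0\<close>, parallel to the first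
    \<open>CARD('n)\<close> coordinate axes of the affine space of the chart.\<close>
  define slice where "slice w i = z0 i + (if i \<in> range \<iota> then w $ (inv_into UNIV \<iota> i) else 0)" for w :: "complex^'n" and i
  have slice\<iota>: "slice w (\<iota> j) = z0 (\<iota> j) + w $ j" for w j
    using inj\<iota> by (simp add: slice_def)
  have slice_affine: "slice w \<in> affine_space N" for w
    using z0(1) \<iota>N S(2) by (auto simp: slice_def affine_space_def dest: leD)
  have cont_slice: "continuous_on X slice" for X
  proof (rule continuous_on_coordinatewise_then_product)
    show "continuous_on X (\<lambda>w. slice w i)" for i
      unfolding slice_def
      by (cases "i \<in> range \<iota>") (auto intro!: continuous_on_add linear_continuous_on[OF bounded_linear_vec_nth])
  qed
  have inj_slice: "slice w = slice w' \<Longrightarrow> w = w'" for w w'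
    using slice\<iota> by (metis add_left_cancel vec_eq_iff)
  define S0 where "S0 = slice -` S"
  have openS0: "open S0"
    unfolding S0_def using cont_slice[of UNIV] S(1) by (simp add: continuous_on_open_vimage)
  have sliceD: "slice w \<in> D" if "w \<in> S0" for w
    using that slice_affine by (simp add: S0_def S(2))
  have c1: "continuous_map (top_of_set S0) (torus_topology G) (\<phi> \<circ> slice)"
  proof (rule continuous_map_compose)
    show "continuous_map (top_of_set S0) (top_of_set D) slice"
      using sliceD by (simp add: cont_slice image_subset_iff)
    show "continuous_map (top_of_set D) (torus_topology G) \<phi>"
      using cont\<phi> continuous_map_in_subtopology by blast
  qed
  define S1 where "S1 = {w \<in> S0. (\<phi> \<circ> slice) w \<in> patch v0}"
  have "openin (top_of_set S0) {w \<in> topspace (top_of_set S0). (\<phi> \<circ> slice) w \<in> patch v0}"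
    by (rule openin_continuous_map_preimage[OF c1 openin_patch])
  then have openS1: "open S1"
    unfolding S1_def using openS0 openin_open_trans by auto
  have "slice 0 = z0" by (auto simp: slice_def fun_eq_iff)
  then have zero: "0 \<in> S1"
    using z0 S(2) v0 by (simp add: S1_def S0_def patch_def)
  define \<Theta> where "\<Theta> w = lin (cmap v0 (\<phi> (slice w)))" for w
  have inpatch: "\<phi> (slice w) \<in> patch v0" if "w \<in> S1" for w using that by (simp add: S1_def)
  have "continuous_map (top_of_set S1) (top_of_set (polydisc v0)) (cmap v0 \<circ> (\<phi> \<circ> slice))"
  proof (rule continuous_map_compose[OF _ continuous_map_cmap])
    have "continuous_map (top_of_set S1) (torus_topology G) (\<phi> \<circ> slice)"
      by (rule continuous_map_from_subtopology_mono[OF c1]) (auto simp: S1_def)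
    then show "continuous_map (top_of_set S1) (subtopology (torus_topology G) (patch v0)) (\<phi> \<circ> slice)"
      using inpatch by (simp add: continuous_map_in_subtopology image_subset_iff)
  qed
  then have "continuous_on S1 (cmap v0 \<circ> (\<phi> \<circ> slice))"
    by simp
  then have "continuous_on S1 (\<lambda>w. lin ((cmap v0 \<circ> (\<phi> \<circ> slice)) w))"
    by (rule continuous_on_compose2[OF continuous_on_lin[of UNIV]]) simp
  then have cont\<Theta>: "continuous_on S1 \<Theta>"
    unfolding \<Theta>_def by simp
  have aff: "cmap v0 (\<phi> (slice w)) \<in> affine_space d" if "w \<in> S1" for w
    using cmap_polydisc[OF inpatch[OF that]] by (rule polydisc_affine)
  have inj\<Theta>: "inj_on \<Theta> S1"
  proof (rule inj_onI)
    fix w w' assume w: "w \<in> S1" "w' \<in> S1" "\<Theta> w = \<Theta> w'"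
    then have "cmap v0 (\<phi> (slice w)) = cmap v0 (\<phi> (slice w'))"
      using aff coord_lin unfolding \<Theta>_def by metis
    then have "\<phi> (slice w) = \<phi> (slice w')"
      using inpatch w bij_betw_cmap[of v0] unfolding bij_betw_def inj_on_def by blast
    then have "slice w = slice w'"
      using inj\<phi> sliceD w unfolding inj_on_def S1_def by blast
    then show "w = w'" by (rule inj_slice)
  qed
  have "open (\<Theta> ` S1)"
    using invariance_of_domain[OF cont\<Theta> openS1 inj\<Theta>] .
  moreover have "\<Theta> 0 \<in> \<Theta> ` S1" using zero by blast
  ultimately obtain r where r: "r > 0" "cball (\<Theta> 0) r \<subseteq> \<Theta> ` S1"
    using open_contains_cball by blast
  define t where "t = r / norm k"
  have t: "t > 0" using r k by (simp add: t_def)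
  have "norm (of_real t *s k) = r"
    unfolding norm_scalar_mult norm_of_real using t r k by (simp add: t_def)
  then have "\<Theta> 0 + of_real t *s k \<in> cball (\<Theta> 0) r"
    by (simp add: dist_norm)
  then obtain w where w: "w \<in> S1" "\<Theta> 0 + of_real t *s k = \<Theta> w" using r by blast
  have "coord (\<Theta> 0 + of_real t *s k) = coord (\<Theta> 0)"
    unfolding coord_eq_iff by (simp add: E_add E_scale k)
  then have "cmap v0 (\<phi> (slice w)) = cmap v0 (\<phi> (slice 0))"
    unfolding w(2) unfolding \<Theta>_def using aff[OF w(1)] aff[OF zero] by simp
  then have "\<Theta> w = \<Theta> 0" by (simp add: \<Theta>_def)
  then have "of_real t *s k = 0" using w(2) by simp
  then show False using t k(1) by (simp add: vec.scale_eq_0_iff)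
qed

lemma complex_dim_less:
  assumes "k \<noteq> 0" "\<And>i. i < d \<Longrightarrow> E i k = 0"
  shows "complex_dim (torus G) < enat (CARD('n))"
proof -
  \<comment> \<open>A strict bound need not survive a supremum, hence the non-strict one by
    \<open>CARD('n) - 1\<close>.\<close>
  have "complex_dim (torus G) \<le> enat (CARD('n) - 1)"
    unfolding complex_dim_def
  proof (rule Sup_least)
    fix x assume "x \<in> {enat m | m. \<exists>V D \<psi>. V \<noteq> {} \<and> chart (torus G) V m D {} \<psi>}"
    then obtain m V D \<psi> where "x = enat m" "V \<noteq> {}" "chart (torus G) V m D {} \<psi>" by blast
    moreover from this have "m < CARD('n)" using chart_dim_less assms by blast
    ultimately show "x \<le> enat (CARD('n) - 1)" by simp
  qed
  also have "\<dots> < enat (CARD('n))" by simp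
  finally show ?thesis .
qed

end

section \<open>Kaehler potentials\<close>

text \<open>The potential of the flat metric.\<close>

definition "sq_norm d z = (\<Sum>i<d. (cmod (z i))\<^sup>2)" for d :: nat and z :: "nat \<Rightarrow> complex"

lemma real_partial_sq_norm:
  assumes "j < d"
  shows "(\<lambda>t::real. complex_of_real (sq_norm d (z(j := z j + of_real t * e)))) differentiable (at 0)"
    and "real_partial j e (\<lambda>z. complex_of_real (sq_norm d z)) z = of_real (2 * Re (z j * cnj e))"
proof -
  have eq: "complex_of_real (sq_norm d (z(j := z j + of_real t * e)))
     = of_real (sq_norm d z + (2 * Re (z j * cnj e)) * t + (cmod e)\<^sup>2 * t\<^sup>2)" for t :: real
  proof -
    have "sq_norm d w = (cmod (w j))\<^sup>2 + (\<Sum>i\<in>{..<d} - {j}. (cmod (w i))\<^sup>2)" for w :: "nat \<Rightarrow> complex"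
      unfolding sq_norm_def using assms by (subst sum.remove[of _ j]) auto
    note split = this
    have "(cmod (z j + of_real t * e))\<^sup>2 = (cmod (z j))\<^sup>2 + (2 * Re (z j * cnj e)) * t + (cmod e)\<^sup>2 * t\<^sup>2"
      by (simp only: cmod_power2) (simp add: power2_eq_square algebra_simps)
    moreover have "(\<Sum>i\<in>{..<d} - {j}. (cmod ((z(j := z j + of_real t * e)) i))\<^sup>2) = (\<Sum>i\<in>{..<d} - {j}. (cmod (z i))\<^sup>2)"
      by (intro sum.cong) auto
    ultimately show ?thesis
      unfolding split[of "z(j := z j + of_real t * e)"] split[of z] by simp
  qed
  have "((\<lambda>t::real. sq_norm d z + (2 * Re (z j * cnj e)) * t + (cmod e)\<^sup>2 * t\<^sup>2) has_vector_derivative (2 * Re (z j * cnj e))) (at 0)"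
    unfolding has_real_derivative_iff_has_vector_derivative[symmetric]
    by (auto intro!: derivative_eq_intros)
  then have "((\<lambda>t::real. complex_of_real (sq_norm d (z(j := z j + of_real t * e)))) has_vector_derivative
      of_real (2 * Re (z j * cnj e))) (at 0)"
    unfolding eq by (rule bounded_linear.has_vector_derivative[OF bounded_linear_of_real])
  then show "(\<lambda>t::real. complex_of_real (sq_norm d (z(j := z j + of_real t * e)))) differentiable (at 0)"
    and "real_partial j e (\<lambda>z. complex_of_real (sq_norm d z)) z = of_real (2 * Re (z j * cnj e))"
    unfolding real_partial_def
    by (auto simp: vector_derivative_at intro: differentiableI_vector)
qed

lemma real_partial_coordinate:
  shows "(\<lambda>t::real. complex_of_real (2 * Re ((z(j := z j + of_real t * e)) i * c))) differentiable (at 0)"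
    and "real_partial j e (\<lambda>z. complex_of_real (2 * Re (z i * c))) z
      = of_real (if i = j then 2 * Re (e * c) else 0)"
proof -
  have "((\<lambda>t::real. 2 * Re (z i * c) + (if i = j then 2 * Re (e * c) else 0) * t) has_vector_derivative
      (if i = j then 2 * Re (e * c) else 0)) (at 0)"
    unfolding has_real_derivative_iff_has_vector_derivative[symmetric]
    by (auto intro!: derivative_eq_intros)
  from bounded_linear.has_vector_derivative[OF bounded_linear_of_real this]
  have "((\<lambda>t::real. complex_of_real (2 * Re (z i * c) + (if i = j then 2 * Re (e * c) else 0) * t))
      has_vector_derivative of_real (if i = j then 2 * Re (e * c) else 0)) (at 0)" .
  moreover have "2 * Re ((z(j := z j + of_real t * e)) i * c)
     = 2 * Re (z i * c) + (if i = j then 2 * Re (e * c) else 0) * t" for t :: real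
    by (simp add: algebra_simps)
  ultimately have "((\<lambda>t::real. complex_of_real (2 * Re ((z(j := z j + of_real t * e)) i * c))) has_vector_derivative
      of_real (if i = j then 2 * Re (e * c) else 0)) (at 0)"
    by (simp only:)
  then show "(\<lambda>t::real. complex_of_real (2 * Re ((z(j := z j + of_real t * e)) i * c))) differentiable (at 0)"
    and "real_partial j e (\<lambda>z. complex_of_real (2 * Re (z i * c))) z
      = of_real (if i = j then 2 * Re (e * c) else 0)"
    unfolding real_partial_def
    by (auto simp: vector_derivative_at intro: differentiableI_vector)
qed

lemma Ck_on_affine_const: "Ck_on_affine k N D (\<lambda>z. c)"
  by (induction k arbitrary: c) (auto simp: real_partial_def[abs_def])

lemma Ck_on_affine_coordinate: "Ck_on_affine k N D (\<lambda>z. complex_of_real (2 * Re (z i * c)))"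
proof -
  have cont: "continuous_on D (\<lambda>z. complex_of_real (2 * Re (z i * c)))"
  proof -
    have "continuous_on D (\<lambda>z::nat \<Rightarrow> complex. z i)"
      by (rule continuous_on_subset[OF continuous_on_product_coordinates]) simp
    then show ?thesis
      by (intro continuous_on_of_real continuous_on_mult continuous_on_const continuous_on_Re)
  qed
  show ?thesis
  proof (cases k)
    case 0
    then show ?thesis using cont by simp
  next
    case (Suc k')
    have "real_partial j e (\<lambda>z. complex_of_real (2 * Re (z i * c)))
      = (\<lambda>z. of_real (if i = j then 2 * Re (e * c) else 0))" for j e
      by (rule ext) (rule real_partial_coordinate)
    then show ?thesis
      unfolding Suc Ck_on_affine.simps using cont real_partial_coordinate(1) Ck_on_affine_const by simp
  qed
qed

text \<open>First partial derivatives are real-linear in a single coordinate and second ones are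
  constant, so every order of smoothness is settled after two steps.\<close>

lemma Ck_on_affine_sq_norm: "Ck_on_affine k d D (\<lambda>z. complex_of_real (sq_norm d z))"
proof -
  have cont: "continuous_on D (\<lambda>z. complex_of_real (sq_norm d z))"
    unfolding sq_norm_def
    by (intro continuous_on_of_real continuous_on_sum continuous_on_power continuous_on_norm
        continuous_on_subset[OF continuous_on_product_coordinates]) simp
  show ?thesis
  proof (cases k)
    case 0
    then show ?thesis using cont by simp
  next
    case (Suc k')
    have "real_partial j e (\<lambda>z. complex_of_real (sq_norm d z)) = (\<lambda>z. of_real (2 * Re (z j * cnj e)))"
      if "j < d" for j e
      by (rule ext) (rule real_partial_sq_norm(2)[OF that])
    then show ?thesis
      unfolding Suc Ck_on_affine.simps
      by (intro conjI cont allI impI ballI real_partial_sq_norm(1)) (simp_all only: Ck_on_affine_coordinate)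
  qed
qed

lemma wirtinger_bar_sq_norm:
  assumes "k < d"
  shows "wirtinger_bar k (\<lambda>z. complex_of_real (sq_norm d z)) = (\<lambda>z. z k)"
proof
  fix z :: "nat \<Rightarrow> complex"
  show "wirtinger_bar k (\<lambda>z. complex_of_real (sq_norm d z)) z = z k"
    unfolding wirtinger_bar_def real_partial_sq_norm(2)[OF assms] by (rule complex_eqI) simp_all
qed

lemma wirtinger_coordinate: "wirtinger j (\<lambda>z. z k) z = (if j = k then 1 else 0)"
proof -
  have "real_partial j e (\<lambda>z. z k) z = (if j = k then e else 0)" for e
  proof -
    define c where "c = (if j = k then e else 0)"
    have "((\<lambda>t::real. z k + t *\<^sub>R c) has_vector_derivative (0 + 1 *\<^sub>R c)) (at 0)"
      by (intro has_vector_derivative_add has_vector_derivative_const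
          bounded_linear.has_vector_derivative[OF bounded_linear_scaleR_left has_vector_derivative_id])
    then have "vector_derivative (\<lambda>t::real. z k + t *\<^sub>R c) (at 0) = c"
      by (simp only: vector_derivative_at) simp
    moreover have "(z(j := z j + of_real t * e)) k = z k + t *\<^sub>R c" for t :: real
      by (simp add: scaleR_conv_of_real c_def)
    ultimately show ?thesis
      unfolding real_partial_def c_def[symmetric] by (simp only:)
  qed
  then show ?thesis
    by (simp add: wirtinger_def)
qed

text \<open>The Levi form of the squared norm is the identity matrix.\<close>

lemma smooth_strictly_psh_affine_sq_norm: "smooth_strictly_psh_affine d D (sq_norm d)"
  unfolding smooth_strictly_psh_affine_def
proof (intro conjI allI ballI impI)
  fix k show "Ck_on_affine k d D (\<lambda>z. complex_of_real (sq_norm d z))"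
    by (rule Ck_on_affine_sq_norm)
next
  fix z w assume w: "w \<in> affine_space d" "w \<noteq> (\<lambda>i. 0)"
  have "(\<Sum>j<d. \<Sum>k<d. wirtinger j (wirtinger_bar k (\<lambda>z. complex_of_real (sq_norm d z))) z * w j * cnj (w k))
     = (\<Sum>j<d. \<Sum>k<d. (if j = k then w j * cnj (w k) else 0))"
    by (intro sum.cong refl) (simp only: lessThan_iff wirtinger_bar_sq_norm wirtinger_coordinate, simp)
  also have "\<dots> = (\<Sum>j<d. w j * cnj (w j))"
    by (intro sum.cong refl) simp
  also have "\<dots> = of_real (\<Sum>j<d. (cmod (w j))\<^sup>2)"
    by (simp only: of_real_sum complex_norm_square)
  also have "Re \<dots> = (\<Sum>j<d. (cmod (w j))\<^sup>2)"
    by simp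
  also have "\<dots> > 0"
  proof -
    obtain i where i: "w i \<noteq> 0" using w(2) unfolding fun_eq_iff by blast
    then have "i < d" using w(1) unfolding affine_space_def by (simp add: not_le[symmetric]) blast
    then have "i \<in> {..<d}" by simp
    then show ?thesis by (rule sum_pos2[OF finite_lessThan]) (simp_all add: i)
  qed
  finally show "0 < Re (\<Sum>j<d. \<Sum>k<d. wirtinger j (wirtinger_bar k (\<lambda>z. complex_of_real (sq_norm d z))) z * w j * cnj (w k))" .
qed

context quotient_coordinates
begin

text \<open>Two charts differ locally by the translation with the coordinates of some
  \<open>g\<close> in \<open>G\<close>. Under it the squared norm changes by the real part of an
  affine function, because the quadratic terms cancel.\<close>

lemma pluriharmonic_difference:
  "pluriharmonic (torus G) (patch v0 \<inter> patch v1) (\<lambda>y. sq_norm d (cmap v0 y) - sq_norm d (cmap v1 y))"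
  unfolding pluriharmonic_def
proof
  fix x assume x: "x \<in> patch v0 \<inter> patch v1"
  obtain a where a: "a \<in> cyl v0" "x = torus_proj G a"
    using x patch_cases[of x v0] by blast
  obtain b where b: "b \<in> cyl v1" "x = torus_proj G b"
    using x patch_cases[of x v1] by blast
  define g where "g = b - a"
  have g: "g \<in> G" using a b torus_proj_eq_iff[OF subgroup] by (simp add: g_def)
  \<comment> \<open>Different parts of the overlap may need different translations; on
    \<open>S\<close> the single \<open>g\<close> works throughout.\<close>
  define S where "S = cyl v0 \<inter> (\<lambda>v. v + g) -` cyl v1"
  have "open S"
    unfolding S_def by (intro open_Int open_cyl open_vimage continuous_intros)
  have aS: "a \<in> S" using a b by (simp add: S_def g_def)
  define h where "h y = - (\<Sum>i<d. 2 * cmap v0 y i * cnj (E i g) + of_real ((cmod (E i g))\<^sup>2))" for y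
  let ?V = "torus_proj G ` S"
  have opV: "openin (torus_topology G) ?V" by (rule openin_torus_proj_image[OF subgroup \<open>open S\<close>])
  have cmap0: "cmap v0 (torus_proj G v) = coord v" and cmap1: "cmap v1 (torus_proj G v) = coord (v + g)"
    if "v \<in> S" for v
  proof -
    show "cmap v0 (torus_proj G v) = coord v" using that by (simp add: S_def cmap_torus_proj)
    have "cmap v1 (torus_proj G (v + g)) = coord (v + g)" using that by (simp add: S_def cmap_torus_proj)
    then show "cmap v1 (torus_proj G v) = coord (v + g)" by (simp add: torus_proj_add[OF subgroup g])
  qed
  have "?V \<subseteq> patch v0 \<inter> patch v1"
  proof
    fix y assume "y \<in> ?V"
    then obtain v where v: "v \<in> S" "y = torus_proj G v" by blast
    then have "y = torus_proj G (v + g)" by (simp add: torus_proj_add[OF subgroup g])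
    then show "y \<in> patch v0 \<inter> patch v1" using v unfolding S_def patch_def by blast
  qed
  moreover have "sect (torus G) ?V h"
    unfolding sect_torus
  proof (intro conjI opV allI impI)
    fix v assume "torus_proj G v \<in> ?V"
    then obtain w where w: "w \<in> S" "torus_proj G v = torus_proj G w" by blast
    have "complex_differentiable_at (h \<circ> torus_proj G) w"
    proof (rule complex_differentiable_at_cong[OF _ \<open>open S\<close> w(1)])
      have "complex_differentiable_at (\<lambda>v. (-1) * (\<Sum>i<d. E i v * (2 * cnj (E i g)) + of_real ((cmod (E i g))\<^sup>2))) w"
        by (intro complex_differentiable_at_cmult complex_differentiable_at_sum complex_differentiable_at_add
            complex_differentiable_at_mult complex_differentiable_at_E complex_differentiable_at_const)
      then show "complex_differentiable_at (\<lambda>v. - (\<Sum>i<d. 2 * E i v * cnj (E i g) + of_real ((cmod (E i g))\<^sup>2))) w"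
        by (simp add: mult_ac)
      show "- (\<Sum>i<d. 2 * E i v * cnj (E i g) + of_real ((cmod (E i g))\<^sup>2)) = (h \<circ> torus_proj G) v"
        if "v \<in> S" for v
        unfolding h_def o_apply cmap0[OF that] coord_def by simp
    qed
    then show "complex_differentiable_at (h \<circ> torus_proj G) v"
      using complex_differentiable_at_torus_proj_cong[OF subgroup] w(2) by metis
  qed
  moreover have "sq_norm d (cmap v0 y) - sq_norm d (cmap v1 y) = Re (h y)" if y: "y \<in> ?V" for y
  proof -
    obtain v where v: "v \<in> S" "y = torus_proj G v" using y by blast
    have eq: "(cmod (E i v))\<^sup>2 - (cmod (E i (v + g)))\<^sup>2
        = - Re (2 * E i v * cnj (E i g) + of_real ((cmod (E i g))\<^sup>2))" for i
      unfolding E_add cmod_power2 by (simp add: power2_eq_square algebra_simps)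
    have "sq_norm d (cmap v0 y) - sq_norm d (cmap v1 y)
        = (\<Sum>i<d. (cmod (E i v))\<^sup>2 - (cmod (E i (v + g)))\<^sup>2)"
      unfolding v(2) cmap0[OF v(1)] cmap1[OF v(1)] sq_norm_def sum_subtractf by (simp add: coord_def)
    also have "\<dots> = Re (- (\<Sum>i<d. 2 * E i v * cnj (E i g) + of_real ((cmod (E i g))\<^sup>2)))"
      by (simp only: eq sum_negf Re_sum uminus_complex.sel)
    also have "- (\<Sum>i<d. 2 * E i v * cnj (E i g) + of_real ((cmod (E i g))\<^sup>2)) = h y"
      unfolding v(2) h_def cmap0[OF v(1)]
      by (intro arg_cong[where f = uminus] sum.cong) (auto simp: coord_def)
    finally show ?thesis .
  qed
  moreover have "x \<in> ?V" using aS a(2) by blast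
  ultimately show "\<exists>V h. x \<in> V \<and> V \<subseteq> patch v0 \<inter> patch v1 \<and> sect (torus G) V h \<and>
      (\<forall>y\<in>V. sq_norm d (cmap v0 y) - sq_norm d (cmap v1 y) = Re (h y))"
    by (intro exI[of _ ?V] exI[of _ h] conjI ballI)
qed

lemma kaehler_space_torus: "kaehler_space (torus G)"
  unfolding kaehler_space_def
proof (intro exI[of _ "range (\<lambda>v. (patch v, \<lambda>y. sq_norm d (cmap v y)))"] conjI)
  show "(\<Union>(U, \<phi>)\<in>range (\<lambda>v. (patch v, \<lambda>y. sq_norm d (cmap v y))). U) = topspace (ftop (torus G))"
  proof -
    have "patch v \<subseteq> range (torus_proj G)" for v
      unfolding patch_def by (rule image_mono[OF subset_UNIV])
    moreover have "torus_proj G v \<in> patch v" for v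
      unfolding patch_def by (rule imageI[OF cyl_self])
    ultimately have "(\<Union>v. patch v) = range (torus_proj G)"
      by (intro equalityI UN_least image_subsetI UN_I[OF UNIV_I])
    then show ?thesis by simp
  qed
  show "\<forall>(U, \<phi>)\<in>range (\<lambda>v. (patch v, \<lambda>y. sq_norm d (cmap v y))).
      openin (ftop (torus G)) U \<and> smooth_strictly_psh (torus G) U \<phi>"
  proof clarify
    fix v
    have "smooth_strictly_psh (torus G) (patch v) (\<lambda>y. sq_norm d (cmap v y))"
      unfolding smooth_strictly_psh_def
    proof
      fix x assume "x \<in> patch v"
      then have "x \<in> patch v \<and> patch v \<subseteq> patch v \<and> chart (torus G) (patch v) d (polydisc v) {} (cmap v) \<and>
          smooth_strictly_psh_affine d (polydisc v) (sq_norm d) \<and>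
          (\<forall>y\<in>patch v. sq_norm d (cmap v y) = sq_norm d (cmap v y))"
        by (simp add: chart_cmap smooth_strictly_psh_affine_sq_norm)
      then show "\<exists>V N D F \<psi> \<Phi>. x \<in> V \<and> V \<subseteq> patch v \<and> chart (torus G) V N D F \<psi> \<and>
          smooth_strictly_psh_affine N D \<Phi> \<and> (\<forall>y\<in>V. sq_norm d (cmap v y) = \<Phi> (\<psi> y))"
        by (intro exI)
    qed
    then show "openin (ftop (torus G)) (patch v) \<and>
        smooth_strictly_psh (torus G) (patch v) (\<lambda>y. sq_norm d (cmap v y))"
      by (simp add: openin_patch)
  qed
  show "\<forall>(U, \<phi>)\<in>range (\<lambda>v. (patch v, \<lambda>y. sq_norm d (cmap v y))).
      \<forall>(U', \<phi>')\<in>range (\<lambda>v. (patch v, \<lambda>y. sq_norm d (cmap v y))).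
      pluriharmonic (torus G) (U \<inter> U') (\<lambda>x. \<phi> x - \<phi>' x)"
    by (clarify, rule pluriharmonic_difference)
qed

end

section \<open>Fibrations from endomorphisms\<close>

lemma torus_affine_descends:
  assumes G: "zmod.subspace G" and G': "zmod.subspace G'" and A: "\<And>g. g \<in> G \<Longrightarrow> A *v g \<in> G'"
  shows "\<exists>F. \<forall>v. F (torus_proj G v) = torus_proj G' (A *v v + b)"
proof (intro exI allI)
  fix v
  define w where "w = (SOME w. w \<in> torus_proj G v)"
  have "v \<in> torus_proj G v"
    by (simp add: mem_torus_proj_iff zmod.subspace_0[OF G])
  then have "w \<in> torus_proj G v"
    unfolding w_def by (rule someI)
  then have "A *v (w - v) \<in> G'"
    by (simp add: mem_torus_proj_iff A)
  then show "(\<lambda>C. torus_proj G' (A *v (SOME w. w \<in> C) + b)) (torus_proj G v) = torus_proj G' (A *v v + b)"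
    unfolding w_def[symmetric] torus_proj_eq_iff[OF G'] by (simp add: matrix_vector_mult_diff_distrib)
qed

lemma Aut_torus_affine:
  fixes A A' :: "complex^'n^'n"
  assumes G: "zmod.subspace G"
    and inverse: "\<And>v. A *v (A' *v v) = v" "\<And>v. A' *v (A *v v) = v"
    and A': "\<And>g. g \<in> G \<Longrightarrow> A' *v g \<in> G"
    and F: "\<And>v. F (torus_proj G v) = torus_proj G (A *v v + b)"
  shows "F \<in> Aut (torus G)"
proof -
  let ?X = "range (torus_proj G)"
  have inj: "inj_on F ?X"
  proof (rule inj_onI)
    fix x y assume "x \<in> ?X" "y \<in> ?X" and eq: "F x = F y"
    then obtain v w where vw: "x = torus_proj G v" "y = torus_proj G w" by (elim rangeE)
    have "A *v v - A *v w \<in> G" using eq unfolding vw F torus_proj_eq_iff[OF G] by simp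
    then have "A' *v (A *v v - A *v w) \<in> G" by (rule A')
    then show "x = y"
      unfolding vw torus_proj_eq_iff[OF G] by (simp add: matrix_vector_mult_diff_distrib inverse)
  qed
  \<comment> \<open>The inverse of an affine map is affine, with linear part \<open>A'\<close> and
    translation part \<open>- (A' *v b)\<close>.\<close>
  have Finv: "F (torus_proj G (A' *v v + - (A' *v b))) = torus_proj G v" for v
    unfolding F by (simp add: matrix_vector_mult_diff_distrib inverse)
  have surj: "F ` ?X = ?X"
  proof
    show "F ` ?X \<subseteq> ?X" using F by (intro image_subsetI) (elim rangeE, simp)
    show "?X \<subseteq> F ` ?X"
    proof
      fix x assume "x \<in> ?X"
      then obtain v where "x = torus_proj G v" by (elim rangeE)
      then show "x \<in> F ` ?X" by (intro image_eqI[of _ _ "torus_proj G (A' *v v + - (A' *v b))"]) (simp_all only: Finv rangeI)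
    qed
  qed
  have inv: "inv_into ?X F (torus_proj G v) = torus_proj G (A' *v v + - (A' *v b))" for v
    by (rule inv_into_f_eq[OF inj _ Finv]) simp
  show ?thesis
    unfolding Aut_def biholomorphic_map_def mem_Collect_eq ftop_torus topspace_torus_topology
  proof (intro conjI)
    show "bij_betw F ?X ?X" using inj surj by (simp add: bij_betw_def)
    show "holomorphic_map (torus G) (torus G) F"
      using F by (rule holomorphic_map_torus_affine)
    show "holomorphic_map (torus G) (torus G) (inv_into ?X F)"
      using inv by (rule holomorphic_map_torus_affine)
  qed
qed

lemma matrix_vector_mult_scaleR_complex: "(T :: complex^'n^'m) *v (r *\<^sub>R x) = r *\<^sub>R (T *v x)"
  by (rule linear_scale[OF bounded_linear.linear[OF matrix_vector_mul_bounded_linear]])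

text \<open>The set is the sum of \<open>L\<close> and the kernel of \<open>T\<close>, the group to
  be divided out.\<close>

lemma zmod_subspace_kernel_plus:
  fixes T :: "complex^'n^'n"
  assumes L: "zmod.subspace L"
  shows "zmod.subspace {v. \<exists>l\<in>L. T *v v = T *v l}"
  unfolding zmod.subspace_def
proof (intro conjI ballI allI)
  show "0 \<in> {v. \<exists>l\<in>L. T *v v = T *v l}"
    using zmod.subspace_0[OF L] by blast
  fix x assume "x \<in> {v. \<exists>l\<in>L. T *v v = T *v l}"
  then obtain l where l: "l \<in> L" "T *v x = T *v l" by blast
  show "of_int c *\<^sub>R x \<in> {v. \<exists>l\<in>L. T *v v = T *v l}" for c
    using l zmod.subspace_scale[OF L l(1), of c]
    by (intro CollectI bexI[of _ "of_int c *\<^sub>R l"]) (simp_all add: matrix_vector_mult_scaleR_complex)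
  fix y assume "y \<in> {v. \<exists>l\<in>L. T *v v = T *v l}"
  then obtain m where m: "m \<in> L" "T *v y = T *v m" by blast
  show "x + y \<in> {v. \<exists>l\<in>L. T *v v = T *v l}"
    using l m zmod.subspace_add[OF L l(1) m(1)]
    by (intro CollectI bexI[of _ "l + m"]) (simp_all add: matrix_vector_right_distrib)
qed

text \<open>The coordinates of \<open>v\<close> are those of \<open>T *v v\<close> in a basis of the
  image of \<open>T\<close>; their common kernel is the kernel of \<open>T\<close>. On the group
  they take the same values as on \<open>L\<close>, and \<open>T\<close> maps \<open>L\<close> into
  itself, so the gap of \<open>L\<close> gives the required separation.\<close>

lemma quotient_coordinates_kernel:
  fixes T :: "complex^'n^'n"
  assumes L: "zmod.subspace L" "discrete L" and TL: "\<And>l. l \<in> L \<Longrightarrow> T *v l \<in> L" and T: "T *v x0 \<noteq> 0"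
  obtains d E s \<epsilon> where "quotient_coordinates {v. \<exists>l\<in>L. T *v v = T *v l} d E s \<epsilon>"
    "d > 0" "\<And>k i. T *v k = 0 \<Longrightarrow> E i k = 0"
proof -
  let ?W = "range (\<lambda>v. T *v v)"
  have subW: "vec.subspace ?W"
    by (rule vec.subspace_image[OF vec.subspace_UNIV])
  obtain B where B: "B \<subseteq> ?W" "vec.independent B" "?W \<subseteq> vec.span B" "card B = vec.dim ?W"
    by (rule vec.basis_exists)
  have finB: "finite B" using B(2) by (rule vec.finiteI_independent)
  define d where "d = card B"
  obtain \<beta> where \<beta>: "bij_betw \<beta> {..<d} B"
    using ex_bij_betw_nat_finite[OF finB] by (auto simp: atLeast0LessThan d_def)
  have \<beta>B: "\<beta> i \<in> B" if "i < d" for i using \<beta> that by (simp add: bij_betw_apply)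
  have \<beta>inj: "\<beta> i = \<beta> j \<longleftrightarrow> i = j" if "i < d" "j < d" for i j
    using \<beta> that by (auto simp: bij_betw_def inj_on_def)
  have inspan: "T *v v \<in> vec.span B" for v using B(3) by blast
  define E where "E i v = (if i < d then vec.representation B (T *v v) (\<beta> i) else 0)" for i v
  define s where "s i = (SOME x. T *v x = \<beta> i)" for i
  have s: "T *v s i = \<beta> i" if "i < d" for i
  proof -
    have "\<beta> i \<in> ?W" using \<beta>B[OF that] B(1) by blast
    then obtain x where "\<beta> i = T *v x" by (elim rangeE)
    then have "\<exists>x. T *v x = \<beta> i" by (intro exI[of _ x]) simp
    then show ?thesis unfolding s_def by (rule someI_ex)
  qed
  have Tsum: "T *v v = (\<Sum>i<d. E i v *s \<beta> i)" for v
  proof -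
    have "T *v v = (\<Sum>b\<in>B. vec.representation B (T *v v) b *s b)"
      by (rule vec.sum_representation_eq[OF B(2) inspan finB order_refl, symmetric])
    also have "\<dots> = (\<Sum>i<d. vec.representation B (T *v v) (\<beta> i) *s \<beta> i)"
      by (rule sum.reindex_bij_betw[OF \<beta>, symmetric])
    also have "\<dots> = (\<Sum>i<d. E i v *s \<beta> i)"
      by (intro sum.cong) (simp_all add: E_def)
    finally show ?thesis .
  qed
  have E_0: "E i k = 0" if "T *v k = 0" for k i
    unfolding E_def that by (simp add: vec.representation_zero)
  obtain e where e: "e > 0" "\<And>l. l \<in> L \<Longrightarrow> norm l < e \<Longrightarrow> l = 0"
    using discrete_subgroup_separated[OF L] by blast
  \<comment> \<open>If the coordinates are below \<open>e / C\<close>, the norm of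
    \<open>T *v g\<close> is at most \<open>e / C * (C - 1)\<close>, which lies below the gap
    \<open>e\<close>.\<close>
  define C where "C = 1 + (\<Sum>i<d. norm (\<beta> i))"
  have C: "C \<ge> 1" by (simp add: C_def sum_nonneg)
  have "quotient_coordinates {v. \<exists>l\<in>L. T *v v = T *v l} d E s (e / C)"
  proof
    show "zmod.subspace {v. \<exists>l\<in>L. T *v v = T *v l}" by (rule zmod_subspace_kernel_plus[OF L(1)])
    show "E i (v + w) = E i v + E i w" for i v w
      unfolding E_def by (simp add: matrix_vector_right_distrib vec.representation_add[OF B(2) inspan inspan])
    show "E i (c *s v) = c * E i v" for i c v
      unfolding E_def by (simp add: vector_scalar_commute vec.representation_scale[OF B(2) inspan])
    show "E i (s j) = (if i = j then 1 else 0)" if "i < d" "j < d" for i j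
      unfolding E_def using that
      by (simp add: s vec.representation_basis[OF B(2) \<beta>B[OF that(2)]] \<beta>inj)
    show "v \<in> {v. \<exists>l\<in>L. T *v v = T *v l}" if "\<And>i. i < d \<Longrightarrow> E i v = 0" for v
    proof -
      have "T *v v = 0" unfolding Tsum using that by simp
      then show ?thesis using zmod.subspace_0[OF L(1)] by (intro CollectI bexI[of _ 0]) simp_all
    qed
    show "e / C > 0" using e C by simp
    show "E i g = 0" if g: "g \<in> {v. \<exists>l\<in>L. T *v v = T *v l}" and small: "\<And>j. j < d \<Longrightarrow> cmod (E j g) < e / C"
      and "i < d" for g i
    proof -
      obtain l where l: "l \<in> L" "T *v g = T *v l" using g by blast
      have "norm (T *v g) \<le> (\<Sum>i<d. cmod (E i g) * norm (\<beta> i))"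
        unfolding Tsum[of g] by (rule order_trans[OF norm_sum]) (simp only: norm_scalar_mult order_refl)
      also have "\<dots> \<le> (\<Sum>i<d. e / C * norm (\<beta> i))"
        using small by (intro sum_mono mult_right_mono) (auto intro: less_imp_le)
      also have "\<dots> = e / C * (C - 1)"
        unfolding C_def by (simp add: sum_distrib_left[symmetric] del: times_divide_eq_left)
      also have "\<dots> < e" using e C by (simp add: field_simps)
      finally have "T *v l = 0" using e(2)[OF TL[OF l(1)]] l(2) by simp
      then show "E i g = 0" using E_0[of g i] l(2) by simp
    qed
  qed
  moreover have "d > 0"
  proof (rule ccontr)
    assume "\<not> d > 0"
    then show False using Tsum[of x0] T by simp
  qed
  ultimately show thesis using that E_0 by blast
qed

lemma le_complex_dim_torus:
  fixes L :: "(complex^'n) set"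
  assumes L: "zmod.subspace L" "discrete L"
  shows "enat (CARD('n)) \<le> complex_dim (torus L)"
proof -
  obtain \<iota> :: "nat \<Rightarrow> 'n" where \<iota>: "bij_betw \<iota> {..<CARD('n)} UNIV"
    using ex_bij_betw_nat_finite[of "UNIV :: 'n set"] by (auto simp: atLeast0LessThan)
  have \<iota>inj: "\<iota> i = \<iota> j \<longleftrightarrow> i = j" if "i < CARD('n)" "j < CARD('n)" for i j
    using \<iota> that by (auto simp: bij_betw_def inj_on_def)
  have \<iota>surj: "\<exists>i<CARD('n). j = \<iota> i" for j
  proof -
    have "j \<in> \<iota> ` {..<CARD('n)}" using \<iota> by (simp add: bij_betw_def)
    then show ?thesis by (elim imageE) auto
  qed
  obtain e where e: "e > 0" "\<And>l. l \<in> L \<Longrightarrow> norm l < e \<Longrightarrow> l = 0"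
    using discrete_subgroup_separated[OF L] by blast
  \<comment> \<open>The norm is at most the sum of the moduli of the coordinates, so the gap
    \<open>e\<close> is shared out equally among the \<open>CARD('n)\<close> of them.\<close>
  interpret quotient_coordinates L "CARD('n)" "\<lambda>i v. v $ \<iota> i" "\<lambda>i. axis (\<iota> i) 1" "e / CARD('n)"
  proof
    show "axis (\<iota> j) 1 $ \<iota> i = (if i = j then 1 else (0::complex))" if "i < CARD('n)" "j < CARD('n)" for i j
      using \<iota>inj[OF that] by (auto simp: axis_def)
    show "v \<in> L" if "\<And>i. i < CARD('n) \<Longrightarrow> v $ \<iota> i = 0" for v
    proof -
      have "v $ j = 0" for j using \<iota>surj[of j] that by blast
      then have "v = 0" by (simp add: vec_eq_iff)
      then show ?thesis using zmod.subspace_0[OF L(1)] by simp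
    qed
    show "g $ \<iota> i = 0" if g: "g \<in> L" and small: "\<And>j. j < CARD('n) \<Longrightarrow> cmod (g $ \<iota> j) < e / CARD('n)" for g i
    proof -
      have "cmod (g $ j) < e / CARD('n)" for j using \<iota>surj[of j] small by blast
      then have "(\<Sum>j\<in>UNIV. cmod (g $ j)) < (\<Sum>j\<in>(UNIV::'n set). e / CARD('n))"
        by (intro sum_strict_mono) auto
      then have "norm g < e"
        using L2_set_le_sum[of UNIV "\<lambda>j. norm (g $ j)"] by (simp add: norm_vec_def)
      then have "g = 0" using e(2)[OF g] by blast
      then show ?thesis by simp
    qed
  qed (use L e in \<open>simp_all\<close>)
  show ?thesis by (rule le_complex_dim)
qed

text \<open>\<open>A\<close> and \<open>A'\<close> commute with \<open>T\<close> and preserve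
  \<open>L\<close>, hence also the sum of \<open>L\<close> and the kernel of \<open>T\<close>, and
  \<open>f\<close> descends. Fibres are images of translates of the kernel, which are convex. The
  vector \<open>k\<close> lowers the dimension of the base, and \<open>x0\<close> keeps it
  positive.\<close>

lemma fibration_of_endomorphism:
  fixes L :: "(complex^'n) set" and T A A' :: "complex^'n^'n"
  assumes L: "zmod.subspace L" "discrete L"
    and TL: "\<And>l. l \<in> L \<Longrightarrow> T *v l \<in> L" and T: "T *v x0 \<noteq> 0" and k: "k \<noteq> 0" "T *v k = 0"
    and comm: "\<And>v. T *v (A *v v) = A *v (T *v v)"
    and inverse: "\<And>v. A *v (A' *v v) = v" "\<And>v. A' *v (A *v v) = v"
    and AL: "\<And>l. l \<in> L \<Longrightarrow> A *v l \<in> L" "\<And>l. l \<in> L \<Longrightarrow> A' *v l \<in> L"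
    and f: "\<And>v. f (torus_proj L v) = torus_proj L (A *v v + b)"
  shows "\<exists>(Y :: (complex^'n) set fspace) \<pi>. nontrivial_equivariant_fibration (torus L) f Y \<pi>"
proof -
  define G where "G = {v. \<exists>l\<in>L. T *v v = T *v l}"
  obtain d E s \<epsilon> where qc: "quotient_coordinates G d E s \<epsilon>" and d: "d > 0"
    and E0: "\<And>k i. T *v k = 0 \<Longrightarrow> E i k = 0"
    using quotient_coordinates_kernel[of L T x0] L TL T unfolding G_def by blast
  interpret quotient_coordinates G d E s \<epsilon> by (rule qc)
  have LG: "l \<in> G" if "l \<in> L" for l
    using that unfolding G_def by (intro CollectI bexI[of _ l]) simp_all
  have comm': "T *v (A' *v v) = A' *v (T *v v)" for v
    using comm[of "A' *v v"] inverse(2)[of "T *v (A' *v v)"] by (simp add: inverse)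
  have AG: "A *v g \<in> G" "A' *v g \<in> G" if "g \<in> G" for g
  proof -
    obtain l where l: "l \<in> L" "T *v g = T *v l" using \<open>g \<in> G\<close> unfolding G_def by blast
    show "A *v g \<in> G" unfolding G_def
      by (intro CollectI bexI[OF _ AL(1)[OF l(1)]]) (simp add: comm l)
    show "A' *v g \<in> G" unfolding G_def
      by (intro CollectI bexI[OF _ AL(2)[OF l(1)]]) (simp add: comm' l)
  qed
  \<comment> \<open>Writing the projection with \<open>mat 1\<close> and 0 makes it an instance of
    the lemmas on affine maps.\<close>
  obtain \<pi> where \<pi>: "\<And>v. \<pi> (torus_proj L v) = torus_proj G (mat 1 *v v + 0)"
    using torus_affine_descends[OF L(1) subgroup, of "mat 1" 0] LG by auto
  then have \<pi>v: "\<pi> (torus_proj L v) = torus_proj G v" for v by simp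
  obtain g where g: "\<And>v. g (torus_proj G v) = torus_proj G (A *v v + b)"
    using torus_affine_descends[OF subgroup subgroup AG(1), of b] by blast
  have gAut: "g \<in> Aut (torus G)"
    using Aut_torus_affine[OF subgroup inverse AG(2) g] .
  have conn: "connectedin (torus_topology L) {x \<in> range (torus_proj L). \<pi> x = torus_proj G v}" for v
  proof -
    have eq: "{x \<in> range (torus_proj L). \<pi> x = torus_proj G v} = torus_proj L ` {w. T *v (w - v) = 0}"
    proof (intro equalityI subsetI)
      fix x assume "x \<in> {x \<in> range (torus_proj L). \<pi> x = torus_proj G v}"
      then obtain w where w: "x = torus_proj L w" "\<pi> x = torus_proj G v" by (elim CollectE conjE rangeE)
      then have "w - v \<in> G" using torus_proj_eq_iff[OF subgroup] unfolding w(1) \<pi>v by blast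
      then obtain l where l: "l \<in> L" "T *v (w - v) = T *v l" unfolding G_def by blast
      have "torus_proj L (w - l) = x"
        unfolding w(1) torus_proj_eq_iff[OF L(1)] using zmod.subspace_neg[OF L(1) l(1)] by simp
      moreover have "T *v (w - l - v) = 0"
        using l(2) by (simp add: matrix_vector_mult_diff_distrib algebra_simps)
      ultimately show "x \<in> torus_proj L ` {w. T *v (w - v) = 0}" by (intro image_eqI[of _ _ "w - l"]) simp_all
    next
      fix x assume "x \<in> torus_proj L ` {w. T *v (w - v) = 0}"
      then obtain w where w: "x = torus_proj L w" "T *v (w - v) = 0" by blast
      have "w - v \<in> G" unfolding G_def using w(2) zmod.subspace_0[OF L(1)]
        by (intro CollectI bexI[of _ 0]) simp_all
      then show "x \<in> {x \<in> range (torus_proj L). \<pi> x = torus_proj G v}"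
        unfolding w(1) by (simp add: \<pi>v torus_proj_eq_iff[OF subgroup])
    qed
    have "convex {w. T *v (w - v) = 0}"
    proof (rule convexI)
      fix x y and p q :: real
      assume xy: "x \<in> {w. T *v (w - v) = 0}" "y \<in> {w. T *v (w - v) = 0}" and pq: "p + q = 1"
      have "p *\<^sub>R x + q *\<^sub>R y - v = p *\<^sub>R (x - v) + q *\<^sub>R (y - v) + ((p + q) *\<^sub>R v - v)"
        by (simp add: algebra_simps)
      also have "\<dots> = p *\<^sub>R (x - v) + q *\<^sub>R (y - v)" by (simp add: pq)
      finally show "p *\<^sub>R x + q *\<^sub>R y \<in> {w. T *v (w - v) = 0}"
        using xy by (simp add: matrix_vector_right_distrib matrix_vector_mult_scaleR_complex)
    qed
    then have "connectedin euclidean {w. T *v (w - v) = 0}"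
      using convex_connected by (simp add: connectedin_iff_connected)
    then show ?thesis
      unfolding eq by (rule connectedin_continuous_map_image[OF continuous_map_torus_proj])
  qed
  have "nontrivial_equivariant_fibration (torus L) f (torus G) \<pi>"
    unfolding nontrivial_equivariant_fibration_def ftop_torus topspace_torus_topology
  proof (intro conjI)
    show "complex_space (torus G)" by (rule complex_space_torus)
    show "normal_space (torus G)" by (rule normal_space_torus[OF subgroup])
    show "kaehler_space (torus G)" by (rule kaehler_space_torus)
    have "0 < enat d" using d by (simp add: zero_enat_def)
    then show "0 < complex_dim (torus G)" using le_complex_dim by (rule less_le_trans)
    show "complex_dim (torus G) < complex_dim (torus L)"
      using complex_dim_less[OF k(1) E0[OF k(2)]] le_complex_dim_torus[OF L] by (rule less_le_trans)
    show "holomorphic_map (torus L) (torus G) \<pi>"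
      using \<pi> by (rule holomorphic_map_torus_affine)
    show "\<pi> ` range (torus_proj L) = range (torus_proj G)"
      by (simp add: image_image \<pi>v)
    show "\<forall>y\<in>range (torus_proj G). connectedin (torus_topology L) {x \<in> range (torus_proj L). \<pi> x = y}"
      using conn by (intro ballI) (elim rangeE, simp)
    have "\<pi> (f (torus_proj L v)) = g (\<pi> (torus_proj L v))" for v
      unfolding f \<pi>v g ..
    then show "\<exists>g\<in>Aut (torus G). \<forall>x\<in>range (torus_proj L). \<pi> (f x) = g (\<pi> x)"
      using gAut by (intro bexI[of _ g] ballI) (elim rangeE, simp)
  qed
  then show ?thesis by (intro exI)
qed

section \<open>Automorphisms of a torus are affine\<close>

text \<open>Two points of a ball of radius \<rho> differ by less than \<open>2 * \<rho>\<close>,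
  hence by less than the gap \<open>e\<close>, so the projection is injective on the ball.\<close>

lemma torus_local_section:
  fixes L :: "(complex^'n) set"
  assumes L: "zmod.subspace L" and sep: "\<And>l. l \<in> L \<Longrightarrow> norm l < e \<Longrightarrow> l = 0" and \<rho>: "2 * \<rho> \<le> e"
  obtains sec where "\<And>w. w \<in> ball c \<rho> \<Longrightarrow> sec (torus_proj L w) = w"
    "\<And>i. sect (torus L) (torus_proj L ` ball c \<rho>) (\<lambda>y. sec y $ i)"
proof -
  define sec where "sec y = (SOME w. w \<in> ball c \<rho> \<and> torus_proj L w = y)" for y
  have sec: "sec (torus_proj L w) = w" if w: "w \<in> ball c \<rho>" for w
    unfolding sec_def
  proof (rule some_equality)
    fix x assume x: "x \<in> ball c \<rho> \<and> torus_proj L x = torus_proj L w"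
    then have "x - w \<in> L" by (simp only: torus_proj_eq_iff[OF L])
    moreover have "norm (x - w) < e"
      using conjunct1[OF x] w \<rho> norm_triangle_ineq4[of "c - w" "c - x"] by (simp add: dist_norm)
    ultimately have "x - w = 0" by (rule sep)
    then show "x = w" by simp
  qed (use w in simp)
  have "sect (torus L) (torus_proj L ` ball c \<rho>) (\<lambda>y. sec y $ i)" for i
    unfolding sect_torus
  proof (intro conjI allI impI)
    show "openin (torus_topology L) (torus_proj L ` ball c \<rho>)"
      by (rule openin_torus_proj_image[OF L open_ball])
    fix v assume "torus_proj L v \<in> torus_proj L ` ball c \<rho>"
    then obtain w where w: "w \<in> ball c \<rho>" "torus_proj L v = torus_proj L w" by (elim imageE)
    have "complex_differentiable_at ((\<lambda>y. sec y $ i) \<circ> torus_proj L) w"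
      by (rule complex_differentiable_at_cong[OF complex_differentiable_at_nth open_ball w(1)])
        (simp only: o_apply sec)
    then show "complex_differentiable_at ((\<lambda>y. sec y $ i) \<circ> torus_proj L) v"
      by (rule complex_differentiable_at_torus_proj_cong[OF L w(2)[symmetric]])
  qed
  with sec show thesis by (rule that)
qed

text \<open>Composing \<open>f\<close> with a local section near its value gives a holomorphic lift.
  Such local lifts are all that is needed below; no global lift is built from them.\<close>

lemma torus_map_local_lift:
  fixes L :: "(complex^'n) set"
  assumes L: "zmod.subspace L" "discrete L" and f: "holomorphic_map (torus L) (torus L) f"
    and c: "torus_proj L c = f (torus_proj L v1)" and r: "r > 0"
  obtains \<delta> \<Phi> where "\<delta> > 0" "\<And>v. v \<in> ball v1 \<delta> \<Longrightarrow> torus_proj L (\<Phi> v) = f (torus_proj L v)"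
    "\<And>v. v \<in> ball v1 \<delta> \<Longrightarrow> norm (\<Phi> v - c) < r"
    "\<And>v i. v \<in> ball v1 \<delta> \<Longrightarrow> complex_differentiable_at (\<lambda>v. \<Phi> v $ i) v"
proof -
  obtain e where e: "e > 0" "\<And>l. l \<in> L \<Longrightarrow> norm l < e \<Longrightarrow> l = 0"
    using discrete_subgroup_separated[OF L] by blast
  define \<rho> where "\<rho> = min r (e / 2)"
  have \<rho>: "\<rho> > 0" "2 * \<rho> \<le> e" "\<rho> \<le> r" using e(1) r by (auto simp: \<rho>_def)
  let ?U = "torus_proj L ` ball c \<rho>"
  obtain sec where sec: "\<And>w. w \<in> ball c \<rho> \<Longrightarrow> sec (torus_proj L w) = w"
    "\<And>i. sect (torus L) ?U (\<lambda>y. sec y $ i)"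
    by (rule torus_local_section[OF L(1) e(2) \<rho>(2), of c]; (assumption | rule that))
  let ?P = "{x \<in> topspace (ftop (torus L)). f x \<in> ?U}"
  have sectP: "sect (torus L) ?P ((\<lambda>y. sec y $ i) \<circ> f)" for i
    by (rule conjunct2[OF f[unfolded holomorphic_map_def], rule_format, OF sec(2)])
  have "openin (torus_topology L) ?P"
    \<comment> \<open>Any coordinate index will do, since openness of the domain is part of being a
      section.\<close>
    using sectP[of undefined] unfolding sect_torus by (rule conjunct1)
  then have "open (torus_proj L -` ?P)" by (rule open_vimage_torus_proj)
  moreover have "f (torus_proj L v1) \<in> ?U"
    unfolding c[symmetric] using \<rho>(1) by (intro imageI) simp
  then have "v1 \<in> torus_proj L -` ?P" by simp
  ultimately obtain \<delta> where \<delta>: "\<delta> > 0" "ball v1 \<delta> \<subseteq> torus_proj L -` ?P"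
    using open_contains_ball[of "torus_proj L -` ?P"] by meson
  have P: "torus_proj L v \<in> ?P" if "v \<in> ball v1 \<delta>" for v
    using subsetD[OF \<delta>(2) that] by (rule vimageD)
  define \<Phi> where "\<Phi> v = sec (f (torus_proj L v))" for v
  have \<Phi>: "torus_proj L (\<Phi> v) = f (torus_proj L v) \<and> norm (\<Phi> v - c) < r" if "v \<in> ball v1 \<delta>" for v
  proof -
    have "f (torus_proj L v) \<in> ?U" using P[OF that] by (simp only: mem_Collect_eq)
    then obtain w where w: "w \<in> ball c \<rho>" "f (torus_proj L v) = torus_proj L w" by (elim imageE)
    then have "\<Phi> v = w" unfolding \<Phi>_def w(2) by (intro sec(1))
    then show ?thesis using w(1) \<rho>(3) unfolding w(2) by (simp add: dist_norm norm_minus_commute)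
  qed
  have "complex_differentiable_at (\<lambda>v. \<Phi> v $ i) v" if "v \<in> ball v1 \<delta>" for v i
  proof -
    have "complex_differentiable_at (((\<lambda>y. sec y $ i) \<circ> f) \<circ> torus_proj L) v"
      by (rule sectP[of i, unfolded sect_torus, THEN conjunct2, rule_format, OF P[OF that]])
    then show ?thesis unfolding \<Phi>_def o_def .
  qed
  moreover have "torus_proj L (\<Phi> v) = f (torus_proj L v)" "norm (\<Phi> v - c) < r" if "v \<in> ball v1 \<delta>" for v
    using \<Phi>[OF that] by simp_all
  ultimately show thesis by (intro that[of \<delta> \<Phi>] \<delta>(1))
qed

text \<open>For small \<open>h\<close> the increment of \<open>f\<close> from \<open>v\<close> to
  \<open>v + h\<close> has a unique small representative in C^n. As a function of \<open>v\<close>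
  it is entire and bounded, hence constant by Liouville. The resulting function of \<open>h\<close>
  is additive near 0 and complex differentiable at 0, so it is given by a matrix, and summing small
  increments reaches every point.\<close>

lemma holomorphic_torus_map_affine:
  fixes L :: "(complex^'n) set"
  assumes lat: "lattice_group L" and f: "holomorphic_map (torus L) (torus L) f"
  obtains A b where "\<And>v. f (torus_proj L v) = torus_proj L (A *v v + b)"
proof -
  have L: "zmod.subspace L" "discrete L" using lat by (simp_all add: lattice_group_def)
  note eqL = torus_proj_eq_iff[OF L(1)]
  note diffL = zmod.subspace_diff[OF L(1)] and addL = zmod.subspace_add[OF L(1)] and negL = zmod.subspace_neg[OF L(1)]
  \<comment> \<open>An arbitrary lift without any continuity; only its values modulo
    \<open>L\<close> matter.\<close>
  define F where "F v = (SOME w. torus_proj L w = f (torus_proj L v))" for v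
  have F: "torus_proj L (F v) = f (torus_proj L v)" for v
  proof -
    have "f (torus_proj L v) \<in> range (torus_proj L)"
      using f unfolding holomorphic_map_def continuous_map_def by auto
    then have "\<exists>w. torus_proj L w = f (torus_proj L v)" by (elim rangeE) (rule exI, rule sym)
    then show ?thesis unfolding F_def by (rule someI_ex)
  qed
  obtain e where e: "e > 0" "\<And>l. l \<in> L \<Longrightarrow> norm l < e \<Longrightarrow> l = 0"
    using discrete_subgroup_separated[OF L] by blast
  \<comment> \<open>The increments \<open>D\<close> have norm below \<open>2 * \<eta>\<close> and
    their competitors below \<open>6 * \<eta>\<close>; the difference stays below the gap
    \<open>e\<close> of \<open>L\<close>, which gives uniqueness.\<close>
  define \<eta> where "\<eta> = e / 8"
  have \<eta>: "\<eta> > 0" using e(1) by (simp add: \<eta>_def)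
  have lift: "\<exists>\<delta> \<Phi>. \<delta> > 0 \<and> (\<forall>v\<in>ball v1 \<delta>. \<Phi> v - F v \<in> L \<and> norm (\<Phi> v - F v1) < \<eta> \<and>
      (\<forall>i. complex_differentiable_at (\<lambda>v. \<Phi> v $ i) v))" for v1
  proof -
    obtain \<delta> \<Phi> where \<delta>: "\<delta> > 0"
      and \<Phi>: "\<And>v. v \<in> ball v1 \<delta> \<Longrightarrow> torus_proj L (\<Phi> v) = f (torus_proj L v)"
      and near: "\<And>v. v \<in> ball v1 \<delta> \<Longrightarrow> norm (\<Phi> v - F v1) < \<eta>"
      and cd: "\<And>v i. v \<in> ball v1 \<delta> \<Longrightarrow> complex_differentiable_at (\<lambda>v. \<Phi> v $ i) v"
      by (rule torus_map_local_lift[OF L f F \<eta>]; (assumption | rule that))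
    have "\<Phi> v - F v \<in> L" if "v \<in> ball v1 \<delta>" for v
      unfolding eqL[symmetric] F by (rule \<Phi>[OF that])
    then show ?thesis
      by (intro exI[of _ \<delta>] exI[of _ \<Phi>] conjI ballI allI \<delta> near cd)
  qed
  obtain r where r: "\<And>v. \<exists>l\<in>L. norm (v - l) \<le> r"
    using lattice_group_cocompact[OF lat] by blast
  \<comment> \<open>Uniformity in \<open>v\<close>: translation by \<open>L\<close> brings
    \<open>v\<close> into the ball of radius \<open>r\<close>, and there a Lebesgue number of the
    cover by domains of local lifts serves as \<delta>.\<close>
  have "\<exists>\<delta>>0. \<forall>v h. norm h < \<delta> \<longrightarrow> (\<exists>w. norm w < 2 * \<eta> \<and> F (v + h) - F v - w \<in> L)"
  proof -
    define good where "good B \<longleftrightarrow> open B \<and> (\<exists>\<Phi> c. \<forall>v\<in>B. \<Phi> v - F v \<in> L \<and> norm (\<Phi> v - c) < \<eta>)"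
      for B :: "(complex^'n) set"
    have "\<exists>B. good B \<and> v \<in> B" for v
    proof -
      obtain \<delta> \<Phi> where "\<delta> > 0" "\<forall>x\<in>ball v \<delta>. \<Phi> x - F x \<in> L \<and> norm (\<Phi> x - F v) < \<eta>"
        using lift[of v] by blast
      then show ?thesis unfolding good_def
        by (intro exI[of _ "ball v \<delta>"] conjI exI[of _ \<Phi>] exI[of _ "F v"]) simp_all
    qed
    then have cover: "cball 0 r \<subseteq> \<Union>{B. good B}" by blast
    have opn: "open B" if "B \<in> {B. good B}" for B using that by (simp add: good_def)
    obtain \<delta> where \<delta>: "\<delta> > 0" "\<And>x. x \<in> cball 0 r \<Longrightarrow> \<exists>B\<in>{B. good B}. ball x \<delta> \<subseteq> B"
      by (rule Heine_Borel_lemma[OF compact_cball cover opn]; (assumption | rule that))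
    have "\<exists>w. norm w < 2 * \<eta> \<and> F (v + h) - F v - w \<in> L" if h: "norm h < \<delta>" for v h
    proof -
      obtain l where l: "l \<in> L" "norm (v - l) \<le> r" using r by blast
      define c where "c = v - l"
      have c: "c \<in> cball 0 r" using l by (simp add: c_def)
      obtain B where B: "good B" "ball c \<delta> \<subseteq> B" using \<delta>(2)[OF c] by blast
      obtain \<Phi> a where \<Phi>: "\<And>v. v \<in> B \<Longrightarrow> \<Phi> v - F v \<in> L \<and> norm (\<Phi> v - a) < \<eta>"
        using B(1) unfolding good_def by blast
      have "c \<in> ball c \<delta>" "c + h \<in> ball c \<delta>" using \<delta>(1) h by (simp_all add: dist_norm)
      then have cB: "c \<in> B" "c + h \<in> B" using B(2) by blast+
      have per: "F (x + l) - F x \<in> L" for x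
        unfolding eqL[symmetric] F by (simp add: torus_proj_add[OF L(1) l(1)])
      define w where "w = \<Phi> (c + h) - \<Phi> c"
      have "norm w < 2 * \<eta>"
        using \<Phi>[OF cB(1)] \<Phi>[OF cB(2)] norm_triangle_ineq4[of "\<Phi> (c + h) - a" "\<Phi> c - a"]
        by (simp add: w_def)
      have "F (v + h) - F v - w = (F (c + h + l) - F (c + h)) - (F (c + l) - F c)
          - (\<Phi> (c + h) - F (c + h)) + (\<Phi> c - F c)"
        by (simp add: w_def c_def algebra_simps)
      then have eqw: "F (v + h) - F v - w = (F (c + h + l) - F (c + h)) - (F (c + l) - F c)
          - (\<Phi> (c + h) - F (c + h)) + (\<Phi> c - F c)" .
      have "(F (c + h + l) - F (c + h)) - (F (c + l) - F c)
          - (\<Phi> (c + h) - F (c + h)) + (\<Phi> c - F c) \<in> L"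
        using \<Phi>[OF cB(1)] \<Phi>[OF cB(2)] by (intro addL[OF diffL[OF diffL[OF per per]]]) simp_all
      then have "F (v + h) - F v - w \<in> L" by (simp only: eqw)
      with \<open>norm w < 2 * \<eta>\<close> show ?thesis by (intro exI conjI)
    qed
    then show ?thesis using \<delta>(1) by blast
  qed
  then obtain \<delta> where \<delta>: "\<delta> > 0"
    "\<And>v h. norm h < \<delta> \<Longrightarrow> \<exists>w. norm w < 2 * \<eta> \<and> F (v + h) - F v - w \<in> L" by blast
  define D where "D h v = (SOME w. norm w < 2 * \<eta> \<and> F (v + h) - F v - w \<in> L)" for h v
  have D: "norm (D h v) < 2 * \<eta>" "F (v + h) - F v - D h v \<in> L" if "norm h < \<delta>" for h v
    using someI_ex[OF \<delta>(2)[OF that, of v]] unfolding D_def by blast+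
  have D_unique: "w = D h v" if h: "norm h < \<delta>" and w: "norm w < 6 * \<eta>" "F (v + h) - F v - w \<in> L" for w h v
  proof -
    have "(F (v + h) - F v - D h v) - (F (v + h) - F v - w) \<in> L" by (intro diffL D w h)
    then have "w - D h v \<in> L" by simp
    moreover have "norm (w - D h v) < e"
      using D(1)[OF h, of v] w(1) norm_triangle_ineq4[of w "D h v"] by (simp add: \<eta>_def)
    ultimately have "w - D h v = 0" by (rule e(2))
    then show ?thesis by simp
  qed
  have cdD: "complex_differentiable_at (\<lambda>v. D h v $ i) v1" if h: "norm h < \<delta>" for h v1 i
  proof -
    obtain \<delta>1 \<Phi>1 where 1: "\<delta>1 > 0" "\<forall>v\<in>ball v1 \<delta>1. \<Phi>1 v - F v \<in> L \<and> norm (\<Phi>1 v - F v1) < \<eta> \<and>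
      (\<forall>i. complex_differentiable_at (\<lambda>v. \<Phi>1 v $ i) v)" using lift by blast
    obtain \<delta>2 \<Phi>2 where 2: "\<delta>2 > 0" "\<forall>v\<in>ball (v1 + h) \<delta>2. \<Phi>2 v - F v \<in> L \<and> norm (\<Phi>2 v - F (v1 + h)) < \<eta> \<and>
      (\<forall>i. complex_differentiable_at (\<lambda>v. \<Phi>2 v $ i) v)" using lift by blast
    \<comment> \<open>The constant lattice vector that makes the difference of the two local lifts
      small at \<open>v1\<close>; by uniqueness the corrected difference equals \<open>D h v\<close>
      for all nearby \<open>v\<close>.\<close>
    define l0 where "l0 = F (v1 + h) - F v1 - D h v1"
    have l0: "l0 \<in> L" unfolding l0_def by (rule D(2)[OF h])
    let ?\<delta> = "min \<delta>1 \<delta>2"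
    have eq: "\<Phi>2 (v + h) - \<Phi>1 v - l0 = D h v" if v: "v \<in> ball v1 ?\<delta>" for v
    proof (rule D_unique[OF h])
      have v1: "v \<in> ball v1 \<delta>1" and v2: "v + h \<in> ball (v1 + h) \<delta>2" using v by (auto simp: dist_norm)
      have eq1: "\<Phi>2 (v + h) - \<Phi>1 v - l0 = (\<Phi>2 (v + h) - F (v1 + h)) - (\<Phi>1 v - F v1) + D h v1"
        by (simp add: l0_def)
      have "norm (\<Phi>2 (v + h) - F (v1 + h)) < \<eta>" "norm (\<Phi>1 v - F v1) < \<eta>"
        using 1(2) 2(2) v1 v2 by blast+
      then show "norm (\<Phi>2 (v + h) - \<Phi>1 v - l0) < 6 * \<eta>"
        unfolding eq1 using D(1)[OF h, of v1] norm_triangle_ineq[of "(\<Phi>2 (v + h) - F (v1 + h)) - (\<Phi>1 v - F v1)" "D h v1"]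
          norm_triangle_ineq4[of "\<Phi>2 (v + h) - F (v1 + h)" "\<Phi>1 v - F v1"] \<eta> by linarith
      have "F (v + h) - F v - (\<Phi>2 (v + h) - \<Phi>1 v - l0)
         = (\<Phi>1 v - F v) - (\<Phi>2 (v + h) - F (v + h)) + l0" by simp
      moreover have "\<Phi>1 v - F v \<in> L" "\<Phi>2 (v + h) - F (v + h) \<in> L" using 1(2) 2(2) v1 v2 by blast+
      ultimately show "F (v + h) - F v - (\<Phi>2 (v + h) - \<Phi>1 v - l0) \<in> L"
        using l0 by (simp only: addL diffL)
    qed
    have "complex_differentiable_at (\<lambda>v. \<Phi>2 (v + h) $ i - \<Phi>1 v $ i - l0 $ i) v1"
      using 1 2 by (intro complex_differentiable_at_diff complex_differentiable_at_const
          complex_differentiable_at_shift[of "\<lambda>v. \<Phi>2 v $ i"]) simp_all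
    then show ?thesis
    proof (rule complex_differentiable_at_cong[OF _ open_ball[of v1 ?\<delta>]])
      show "v1 \<in> ball v1 ?\<delta>" using 1 2 by simp
      show "\<Phi>2 (v + h) $ i - \<Phi>1 v $ i - l0 $ i = D h v $ i" if "v \<in> ball v1 ?\<delta>" for v
        unfolding eq[OF that, symmetric] by simp
    qed
  qed
  define d where "d h = D h 0" for h
  have Dd: "D h v = d h" if h: "norm h < \<delta>" for h v
  proof -
    have "D h v $ i = D h 0 $ i" for i
    proof (rule complex_differentiable_bounded_constant[of "\<lambda>v. D h v $ i"])
      show "bounded (range (\<lambda>v. D h v $ i))"
        using order_trans[OF Finite_Cartesian_Product.norm_nth_le less_imp_le[OF D(1)[OF h]]]
        by (intro boundedI[of _ "2 * \<eta>"]) (elim rangeE, simp)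
    qed (rule cdD[OF h])
    then show ?thesis by (simp add: d_def vec_eq_iff)
  qed
  have dF: "F (v + h) - F v - d h \<in> L" if "norm h < \<delta>" for v h
    using D(2)[OF that, of v] Dd[OF that] by simp
  have d_small: "norm (d h) < 2 * \<eta>" if "norm h < \<delta>" for h
    using D(1)[OF that] by (simp add: d_def)
  have d_unique: "w = d h" if "norm h < \<delta>" "norm w < 6 * \<eta>" "F h - F 0 - w \<in> L" for w h
    using D_unique[OF that(1,2), of 0] that(3) by (simp add: d_def)
  have d_add: "d (h + h') = d h + d h'" if h: "norm h < \<delta>" "norm h' < \<delta>" "norm (h + h') < \<delta>" for h h'
  proof (rule d_unique[symmetric, OF h(3)])
    show "norm (d h + d h') < 6 * \<eta>"
      using d_small[OF h(1)] d_small[OF h(2)] norm_triangle_ineq[of "d h" "d h'"] \<eta> by simp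
    have "F (h + h') - F 0 - (d h + d h') = (F (h + h') - F h - d h') + (F (0 + h) - F 0 - d h)"
      by simp
    then show "F (h + h') - F 0 - (d h + d h') \<in> L"
      using dF[OF h(2), of h] dF[OF h(1), of 0] by (simp only: addL)
  qed
  have d0: "d 0 = 0"
    using d_add[of 0 0] \<delta>(1) by simp
  \<comment> \<open>Additivity of \<open>d\<close> is available only for small arguments; the bound
    on \<open>real n *\<^sub>R h\<close> keeps all smaller multiples in range.\<close>
  have d_mult: "d (real k *\<^sub>R h) = real k *\<^sub>R d h" if "norm (real n *\<^sub>R h) < \<delta>" "k \<le> n" for k n h
    using that(2)
  proof (induction k)
    case 0
    then show ?case by (simp add: d0)
  next
    case (Suc k)
    have small: "norm (real j *\<^sub>R h) < \<delta>" if "j \<le> n" for j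
    proof -
      have "norm (real j *\<^sub>R h) \<le> norm (real n *\<^sub>R h)" using that by (simp add: mult_right_mono)
      then show ?thesis using \<open>norm (real n *\<^sub>R h) < \<delta>\<close> by simp
    qed
    have "d (real k *\<^sub>R h + h) = d (real k *\<^sub>R h) + d h"
    proof (rule d_add)
      show "norm (real k *\<^sub>R h) < \<delta>" using Suc.prems by (intro small) simp
      show "norm h < \<delta>" using small[of 1] Suc.prems by simp
      show "norm (real k *\<^sub>R h + h) < \<delta>" using small[OF Suc.prems] by (simp add: algebra_simps)
    qed
    then show ?case using Suc by (simp add: algebra_simps)
  qed
  have cd0: "complex_differentiable_at (\<lambda>h. d h $ i) 0" for i
  proof -
    obtain \<delta>1 \<Phi>1 where 1: "\<delta>1 > 0" "\<forall>v\<in>ball 0 \<delta>1. \<Phi>1 v - F v \<in> L \<and> norm (\<Phi>1 v - F 0) < \<eta> \<and>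
      (\<forall>i. complex_differentiable_at (\<lambda>v. \<Phi>1 v $ i) v)" using lift by blast
    have "complex_differentiable_at (\<lambda>h. \<Phi>1 h $ i - F 0 $ i) 0"
      using 1 by (intro complex_differentiable_at_diff complex_differentiable_at_const) simp
    then show ?thesis
    proof (rule complex_differentiable_at_cong[OF _ open_ball[of 0 "min \<delta> \<delta>1"]])
      show "0 \<in> ball 0 (min \<delta> \<delta>1)" using 1 \<delta> by simp
      fix h :: "complex^'n" assume "h \<in> ball 0 (min \<delta> \<delta>1)"
      then have h: "norm h < \<delta>" "h \<in> ball 0 \<delta>1" by simp_all
      have "\<Phi>1 h - F 0 = d h"
      proof (rule d_unique[OF h(1)])
        show "norm (\<Phi>1 h - F 0) < 6 * \<eta>" proof -
          have "norm (\<Phi>1 h - F 0) < \<eta>" using 1(2) h(2) by blast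
          then show ?thesis using \<eta> by simp
        qed
        have "\<Phi>1 h - F h \<in> L" using 1(2) h(2) by blast
        from negL[OF this] show "F h - F 0 - (\<Phi>1 h - F 0) \<in> L" by simp
      qed
      then show "\<Phi>1 h $ i - F 0 $ i = d h $ i" by (simp add: vec_eq_iff)
    qed
  qed
  define g' where "g' i = frechet_derivative (\<lambda>h. d h $ i) (at 0)" for i
  have g': "((\<lambda>h. d h $ i) has_derivative g' i) (at 0)" "g' i (c *s u) = c * g' i u" for i c u
    unfolding g'_def by (rule complex_differentiable_at_frechet[OF cd0])+
  define A where "A = matrix (\<lambda>h. \<chi> i. g' i h)"
  have "Vector_Spaces.linear (*s) (*s) (\<lambda>h. \<chi> i. g' i h)"
    by unfold_locales (simp_all add: vec_eq_iff g'(2) linear_add[OF has_derivative_linear[OF g'(1)]]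
        distrib_left distrib_right mult.assoc)
  then have A: "A *v h = (\<chi> i. g' i h)" for h
    unfolding A_def by (rule matrix_works)
  have dA: "d h = A *v h" if h: "norm h < \<delta>" for h
  proof -
    have "d h $ i = g' i h" for i
    proof (rule ccontr)
      assume ne: "d h $ i \<noteq> g' i h"
      \<comment> \<open>Half the discrepancy at \<open>h\<close> in relative size. By additivity the
        error at \<open>h\<close> is \<open>n\<close> times the error at \<open>h\<close> divided by
        \<open>n\<close>, and for large \<open>n\<close> differentiability at 0 bounds it by this
        half.\<close>
      define \<epsilon> where "\<epsilon> = cmod (d h $ i - g' i h) / (norm h + 1) / 2"
      have \<epsilon>: "\<epsilon> > 0" using ne unfolding \<epsilon>_def by (simp add: add_nonneg_pos)
      have "\<forall>e>0. \<exists>t>0. \<forall>y. norm (y - 0) < t \<longrightarrow>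
          norm (d y $ i - d 0 $ i - g' i (y - 0)) \<le> e * norm (y - 0)"
        using g'(1)[of i] unfolding has_derivative_at_alt by (rule conjunct2)
      from this[rule_format, OF \<epsilon>] obtain t where t: "t > 0" and
        "\<forall>y. norm (y - 0) < t \<longrightarrow> norm (d y $ i - d 0 $ i - g' i (y - 0)) \<le> \<epsilon> * norm (y - 0)"
        by (elim exE conjE) 
      then have t2: "norm (d y $ i - g' i y) \<le> \<epsilon> * norm y" if "norm y < t" for y
        using that by (simp add: d0)
      obtain n :: nat where n: "norm h / t < real n" using reals_Archimedean2 by blast
      have "0 \<le> norm h / t" using t by simp
      then have n0: "n > 0" using n by (metis le_less_trans of_nat_0_less_iff)
      define y where "y = (1 / real n) *\<^sub>R h"
      have hy: "h = real n *\<^sub>R y" using n0 by (simp add: y_def)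
      have "norm y < t" using n n0 t by (simp add: y_def field_simps)
      then have "norm (d y $ i - g' i y) \<le> \<epsilon> * norm y" by (rule t2)
      then have "real n * norm (d y $ i - g' i y) \<le> real n * (\<epsilon> * norm y)"
        by (intro mult_left_mono) simp_all
      moreover have "d h $ i - g' i h = real n *\<^sub>R (d y $ i - g' i y)"
      proof -
        have "d h = real n *\<^sub>R d y" using d_mult[of n y n] h unfolding hy by simp
        moreover have "g' i h = real n *\<^sub>R g' i y"
          unfolding hy by (rule linear_scale[OF has_derivative_linear[OF g'(1)]])
        ultimately show ?thesis by (simp add: scaleR_diff_right)
      qed
      then have "cmod (d h $ i - g' i h) = real n * norm (d y $ i - g' i y)" by simp
      moreover have "real n * (\<epsilon> * norm y) = \<epsilon> * norm h" unfolding hy by simp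
      ultimately have "cmod (d h $ i - g' i h) \<le> \<epsilon> * norm h" by simp
      also have "\<dots> \<le> \<epsilon> * (norm h + 1)" using \<epsilon> by simp
      also have "\<dots> = cmod (d h $ i - g' i h) / 2"
      proof -
        have "norm h + 1 > 0" by (simp add: add_nonneg_pos)
        then show ?thesis unfolding \<epsilon>_def by (simp add: field_simps)
      qed
      finally show False using ne by simp
    qed
    then show ?thesis by (simp add: A vec_eq_iff)
  qed
  have "F v - F 0 - A *v v \<in> L" for v
  proof -
    \<comment> \<open>An arbitrary \<open>v\<close> is cut into \<open>n\<close> equal steps short
      enough for \<open>d\<close>.\<close>
    obtain n :: nat where n: "norm v / \<delta> < real n" using reals_Archimedean2 by blast
    have "0 \<le> norm v / \<delta>" using \<delta>(1) by simp
    then have n0: "n > 0" using n by (metis le_less_trans of_nat_0_less_iff)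
    define y where "y = (1 / real n) *\<^sub>R v"
    have y: "norm y < \<delta>" using n n0 \<delta>(1) by (simp add: y_def field_simps)
    have "F (real k *\<^sub>R y) - F 0 - real k *\<^sub>R (A *v y) \<in> L" for k
    proof (induction k)
      case 0
      then show ?case using zmod.subspace_0[OF L(1)] by simp
    next
      case (Suc k)
      have "F (real (Suc k) *\<^sub>R y) - F 0 - real (Suc k) *\<^sub>R (A *v y)
        = (F (real k *\<^sub>R y + y) - F (real k *\<^sub>R y) - d y) + (F (real k *\<^sub>R y) - F 0 - real k *\<^sub>R (A *v y))"
        by (simp add: dA[OF y] algebra_simps)
      then show ?case using dF[OF y, of "real k *\<^sub>R y"] Suc by (simp only: addL)
    qed
    from this[of n] show ?thesis using n0 by (simp add: y_def matrix_vector_mult_scaleR_complex)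
  qed
  then have "f (torus_proj L v) = torus_proj L (A *v v + F 0)" for v
    unfolding F[symmetric] eqL by (simp add: algebra_simps)
  then show thesis using that by blast
qed

text \<open>Small positive real multiples of a value are again values, hence elements of
  \<open>L\<close> within the gap around 0.\<close>

lemma linear_into_discrete_eq_0:
  fixes M :: "complex^'n^'n"
  assumes L: "zmod.subspace L" "discrete L" and M: "\<And>v. M *v v \<in> L"
  shows "M *v v = 0"
proof -
  obtain e where e: "e > 0" "\<And>l. l \<in> L \<Longrightarrow> norm l < e \<Longrightarrow> l = 0"
    using discrete_subgroup_separated[OF L] by blast
  define t where "t = e / (norm (M *v v) + 1) / 2"
  have pos: "norm (M *v v) + 1 > 0" by (simp add: add_nonneg_pos)
  then have t: "t > 0" using e(1) unfolding t_def by simp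
  have "norm (t *\<^sub>R (M *v v)) \<le> t * (norm (M *v v) + 1)" using t by simp
  also have "\<dots> = e / 2" using pos unfolding t_def by (simp add: field_simps)
  also have "\<dots> < e" using e(1) by simp
  finally have "norm (t *\<^sub>R (M *v v)) < e" .
  moreover have "t *\<^sub>R (M *v v) \<in> L"
    using M[of "t *\<^sub>R v"] by (simp add: matrix_vector_mult_scaleR_complex)
  ultimately have "t *\<^sub>R (M *v v) = 0" by (intro e(2))
  then show ?thesis using t by simp
qed

text \<open>Both \<open>f\<close> and its inverse are affine. Their compositions are the identity
  only modulo \<open>L\<close>, but then the linear part minus the identity maps C^n into
  \<open>L\<close> and must vanish.\<close>

theorem Aut_torus_imp_affine:
  fixes L :: "(complex^'n) set"
  assumes lat: "lattice_group L" and f: "f \<in> Aut (torus L)"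
  obtains A A' b where "\<And>v. f (torus_proj L v) = torus_proj L (A *v v + b)"
    "\<And>v. A *v (A' *v v) = v" "\<And>v. A' *v (A *v v) = v"
    "\<And>l. l \<in> L \<Longrightarrow> A *v l \<in> L" "\<And>l. l \<in> L \<Longrightarrow> A' *v l \<in> L"
proof -
  have L: "zmod.subspace L" "discrete L" using lat by (simp_all add: lattice_group_def)
  note eqL = torus_proj_eq_iff[OF L(1)]
  let ?X = "range (torus_proj L)" and ?f' = "inv_into (range (torus_proj L)) f"
  have bij: "bij_betw f ?X ?X" and hf: "holomorphic_map (torus L) (torus L) f"
    and hf': "holomorphic_map (torus L) (torus L) ?f'"
    using f unfolding Aut_def biholomorphic_map_def by simp_all
  obtain A b where A: "\<And>v. f (torus_proj L v) = torus_proj L (A *v v + b)"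
    using holomorphic_torus_map_affine[OF lat hf] by blast
  obtain A' b' where A': "\<And>v. ?f' (torus_proj L v) = torus_proj L (A' *v v + b')"
    using holomorphic_torus_map_affine[OF lat hf'] by blast
  have 1: "?f' (f (torus_proj L v)) = torus_proj L v" for v
    using bij by (simp add: bij_betw_def)
  have 2: "f (?f' (torus_proj L v)) = torus_proj L v" for v
    using bij by (intro f_inv_into_f) (simp add: bij_betw_def)
  \<comment> \<open>\<open>l\<close> and 0 are the same point of the torus, so their images under
    the affine lift differ by an element of \<open>L\<close>.\<close>
  have AL: "M *v l \<in> L" if M: "\<And>v. F (torus_proj L v) = torus_proj L (M *v v + c)" and l: "l \<in> L"
    for F c l and M :: "complex^'n^'n"
  proof -
    have "torus_proj L l = torus_proj L 0" unfolding eqL using l by simp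
    then have "torus_proj L (M *v l + c) = torus_proj L (M *v 0 + c)" unfolding M[symmetric] by simp
    then show ?thesis unfolding eqL by simp
  qed
  have inverse: "M' *v (M *v v) = v" if M: "\<And>v. torus_proj L (M' *v (M *v v + c) + c') = torus_proj L v"
    for M M' :: "complex^'n^'n" and c c' v
  proof -
    have "M' *v (M *v v + c) + c' - v \<in> L" "M' *v c + c' \<in> L" for v
      using M[of v] M[of 0] unfolding eqL by simp_all
    from zmod.subspace_diff[OF L(1) this] have "(M' ** M - mat 1) *v v \<in> L" for v
      by (simp add: matrix_vector_mult_diff_rdistrib matrix_vector_mul_assoc[symmetric]
          matrix_vector_right_distrib algebra_simps)
    then have "(M' ** M - mat 1) *v v = 0"
      by (rule linear_into_discrete_eq_0[OF L])
    then show ?thesis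
      by (simp add: matrix_vector_mult_diff_rdistrib matrix_vector_mul_assoc[symmetric])
  qed
  show thesis
  proof (rule that[of A b A'])
    show "A' *v (A *v v) = v" for v
      using 1 unfolding A A' by (rule inverse)
    show "A *v (A' *v v) = v" for v
      using 2 unfolding A A' by (rule inverse)
    show "A *v l \<in> L" if "l \<in> L" for l using A that by (rule AL)
    show "A' *v l \<in> L" if "l \<in> L" for l using A' that by (rule AL)
  qed (rule A)
qed

section \<open>Smooth forms on a torus\<close>

lemma Ck_SucI:
  assumes "\<And>x. (g has_derivative g' x) (at x)" "\<And>v. Ck k (\<lambda>x. g' x v)"
  shows "Ck (Suc k) g"
proof -
  have "frechet_derivative g (at x) = g' x" for x
    by (rule frechet_derivative_at[OF assms(1), symmetric])
  moreover have "g differentiable (at x)" for x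
    using assms(1) by (rule differentiableI)
  ultimately show ?thesis using assms(2) by simp
qed

lemma Ck_SucD:
  assumes "Ck (Suc k) g"
  shows "(g has_derivative frechet_derivative g (at x)) (at x)" "Ck k (\<lambda>x. frechet_derivative g (at x) v)"
  using assms by (simp_all add: frechet_derivative_works[symmetric])

lemma Ck_imp_continuous: "Ck k g \<Longrightarrow> continuous_on UNIV g"
proof (cases k)
  case (Suc k')
  assume "Ck k g"
  then have "\<And>x. g differentiable (at x)" using Suc by simp
  then have "\<And>x. isCont g x" by (rule differentiable_imp_continuous_within)
  then show ?thesis by (simp add: continuous_on_eq_continuous_at)
qed simp

lemma Ck_const: "Ck k (\<lambda>x. c)"
proof (induction k arbitrary: c)
  case (Suc k)
  show ?case by (rule Ck_SucI[OF has_derivative_const Suc])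
qed simp

lemma Ck_add: "Ck k g \<Longrightarrow> Ck k h \<Longrightarrow> Ck k (\<lambda>x. g x + h x)"
proof (induction k arbitrary: g h)
  case 0
  then show ?case by (simp add: continuous_on_add)
next
  case (Suc k)
  show ?case
    by (rule Ck_SucI[OF has_derivative_add[OF Ck_SucD(1)[OF Suc.prems(1)] Ck_SucD(1)[OF Suc.prems(2)]]])
      (rule Suc.IH[OF Ck_SucD(2)[OF Suc.prems(1)] Ck_SucD(2)[OF Suc.prems(2)]])
qed

lemma Ck_cmult: "Ck k g \<Longrightarrow> Ck k (\<lambda>x. c * g x)"
proof (induction k arbitrary: g)
  case 0
  then show ?case by (simp add: continuous_on_mult_left)
next
  case (Suc k)
  show ?case
    by (rule Ck_SucI[OF has_derivative_mult_right[OF Ck_SucD(1)[OF Suc.prems]]])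
      (rule Suc.IH[OF Ck_SucD(2)[OF Suc.prems]])
qed

lemma Ck_affine:
  assumes B: "bounded_linear B"
  shows "Ck k g \<Longrightarrow> Ck k (\<lambda>x. g (B x + b))"
proof (induction k arbitrary: g)
  case 0
  then have "continuous_on UNIV g" by simp
  then have "continuous_on UNIV (\<lambda>x. g (B x + b))"
    by (rule continuous_on_compose2)
      (auto intro!: continuous_on_add linear_continuous_on[OF B])
  then show ?case by simp
next
  case (Suc k)
  have "((\<lambda>x. B x + b) has_derivative B) (at x)" for x
    using has_derivative_add[OF bounded_linear_imp_has_derivative[OF B] has_derivative_const] by simp
  from has_derivative_compose[OF this Ck_SucD(1)[OF Suc.prems]]
  show ?case by (rule Ck_SucI) (rule Suc.IH[OF Ck_SucD(2)[OF Suc.prems]])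
qed

lemma frechet_derivative_affine:
  assumes B: "bounded_linear B" and g: "Ck (Suc k) g"
  shows "frechet_derivative (\<lambda>x. g (B x + b)) (at x) = (\<lambda>u. frechet_derivative g (at (B x + b)) (B u))"
proof -
  have "((\<lambda>x. B x + b) has_derivative B) (at x)"
    using has_derivative_add[OF bounded_linear_imp_has_derivative[OF B] has_derivative_const] by simp
  from has_derivative_compose[OF this Ck_SucD(1)[OF g]]
  show ?thesis by (rule frechet_derivative_at[symmetric])
qed

text \<open>With weight 1 this is the average over the segment from \<open>x\<close> to
  \<open>x + e\<close>; with weight 1 - t it will produce primitives.\<close>

definition "line_integral \<kappa> e g x = integral {0..1} (\<lambda>t::real. \<kappa> t * g (x + t *\<^sub>R e))"
  for \<kappa> :: "real \<Rightarrow> complex" and e :: "'a::euclidean_space" and g :: "'a \<Rightarrow> complex" and x :: 'a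

lemma continuous_on_line:
  fixes g :: "'a::euclidean_space \<Rightarrow> complex"
  assumes "continuous_on UNIV g"
  shows "continuous_on S (\<lambda>t::real. g (x + t *\<^sub>R e))"
  by (rule continuous_on_compose2[OF assms]) (auto intro!: continuous_intros)

lemma line_integrand_integrable:
  fixes g :: "'a::euclidean_space \<Rightarrow> complex"
  assumes "continuous_on {0..1} \<kappa>" "continuous_on UNIV g"
  shows "(\<lambda>t::real. \<kappa> t * g (x + t *\<^sub>R e)) integrable_on {0..1}"
  by (intro integrable_continuous_real continuous_on_mult assms(1) continuous_on_line[OF assms(2)])

lemma line_integral_add:
  assumes "continuous_on {0..1} \<kappa>" "continuous_on UNIV g" "continuous_on UNIV h"
  shows "line_integral \<kappa> e (\<lambda>x. g x + h x) x = line_integral \<kappa> e g x + line_integral \<kappa> e h x"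
  unfolding line_integral_def distrib_left
  by (rule integral_add[OF line_integrand_integrable[OF assms(1,2)] line_integrand_integrable[OF assms(1,3)]])

lemma line_integral_cmult: "line_integral \<kappa> e (\<lambda>x. c * g x) x = c * line_integral \<kappa> e g x"
  unfolding line_integral_def mult.left_commute[of _ c] by (rule integral_mult_right)

lemma line_integral_diff:
  assumes "continuous_on {0..1} \<kappa>" "continuous_on UNIV g" "continuous_on UNIV h"
  shows "line_integral \<kappa> e (\<lambda>x. g x - h x) x = line_integral \<kappa> e g x - line_integral \<kappa> e h x"
  unfolding line_integral_def right_diff_distrib
  by (rule integral_diff[OF line_integrand_integrable[OF assms(1,2)] line_integrand_integrable[OF assms(1,3)]])

lemma line_integral_has_derivative:
  fixes g :: "'a::euclidean_space \<Rightarrow> complex"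
  assumes \<kappa>: "continuous_on {0..1} \<kappa>" and g: "Ck (Suc k) g"
  shows "(line_integral \<kappa> e g has_derivative (\<lambda>u. line_integral \<kappa> e (\<lambda>y. frechet_derivative g (at y) u) x)) (at x)"
  unfolding line_integral_def[abs_def]
proof (rule has_derivative_integral_translates[where U = UNIV])
  show "g differentiable (at y)" for y using Ck_SucD(1)[OF g] by (rule differentiableI)
  show "continuous_on UNIV (\<lambda>y. frechet_derivative g (at y) u)" for u
    using Ck_SucD(2)[OF g] by (rule Ck_imp_continuous)
  show "continuous_on {0..1} (\<lambda>t. t *\<^sub>R e)" by (intro continuous_intros)
qed (use \<kappa> in simp_all)

lemma Ck_line_integral:
  fixes g :: "'a::euclidean_space \<Rightarrow> complex"
  assumes \<kappa>: "continuous_on {0..1} \<kappa>"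
  shows "Ck k g \<Longrightarrow> Ck k (line_integral \<kappa> e g)"
proof (induction k arbitrary: g)
  case 0
  then have g: "continuous_on UNIV g" by simp
  have "continuous_on (UNIV \<times> cbox 0 1) (\<lambda>z::'a \<times> real. \<kappa> (snd z) * g (fst z + snd z *\<^sub>R e))"
  proof (rule continuous_on_mult)
    show "continuous_on (UNIV \<times> cbox 0 1) (\<lambda>z::'a \<times> real. \<kappa> (snd z))"
      by (rule continuous_on_compose2[OF \<kappa> continuous_on_snd[OF continuous_on_id]]) auto
    show "continuous_on (UNIV \<times> cbox 0 1) (\<lambda>z::'a \<times> real. g (fst z + snd z *\<^sub>R e))"
      by (rule continuous_on_compose2[OF g]) (auto intro!: continuous_intros)
  qed
  then have "continuous_on (UNIV \<times> cbox 0 1) (\<lambda>(x, t). \<kappa> t * g (x + t *\<^sub>R e))"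
    by (simp add: case_prod_unfold)
  from integral_continuous_on_param[OF this] have "continuous_on UNIV (line_integral \<kappa> e g)"
    unfolding line_integral_def[abs_def] by simp
  then show ?case by simp
next
  case (Suc k)
  show ?case
    by (rule Ck_SucI[OF line_integral_has_derivative[OF \<kappa> Suc.prems]]) (rule Suc.IH[OF Ck_SucD(2)[OF Suc.prems]])
qed

lemma has_vector_derivative_line:
  fixes g :: "'a::euclidean_space \<Rightarrow> complex"
  assumes "Ck (Suc k) g"
  shows "((\<lambda>t::real. g (x + t *\<^sub>R e)) has_vector_derivative frechet_derivative g (at (x + t *\<^sub>R e)) e) (at t within S)"
proof -
  have 1: "((\<lambda>t::real. x + t *\<^sub>R e) has_derivative (\<lambda>t. t *\<^sub>R e)) (at t within S)"
    by (auto intro!: derivative_eq_intros)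
  have "((\<lambda>t::real. g (x + t *\<^sub>R e)) has_derivative (\<lambda>r. frechet_derivative g (at (x + t *\<^sub>R e)) (r *\<^sub>R e))) (at t within S)"
    by (rule has_derivative_compose[OF 1 Ck_SucD(1)[OF assms]])
  then show ?thesis
    unfolding has_vector_derivative_def
    by (simp add: linear_scale[OF has_derivative_linear[OF Ck_SucD(1)[OF assms]]])
qed

text \<open>The fundamental theorem of calculus and integration by parts; the weight 1 - t vanishes
  at the far end, so only the boundary term \<open>- g x\<close> remains.\<close>

lemma line_integral_derivative:
  fixes g :: "'a::euclidean_space \<Rightarrow> complex"
  assumes "Ck (Suc k) g"
  shows "line_integral (\<lambda>t. 1) e (\<lambda>y. frechet_derivative g (at y) e) x = g (x + e) - g x"
    and "line_integral (\<lambda>t. 1 - of_real t) e (\<lambda>y. frechet_derivative g (at y) e) x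
      = line_integral (\<lambda>t. 1) e g x - g x"
proof -
  let ?D = "\<lambda>y. frechet_derivative g (at y) e"
  have "((\<lambda>t::real. ?D (x + t *\<^sub>R e)) has_integral (g (x + 1 *\<^sub>R e) - g (x + 0 *\<^sub>R e))) {0..1}"
    by (rule fundamental_theorem_of_calculus[OF zero_le_one has_vector_derivative_line[OF assms]])
  then show "line_integral (\<lambda>t. 1) e ?D x = g (x + e) - g x"
    unfolding line_integral_def by (simp add: integral_unique)
  have "((\<lambda>t::real. (1 - of_real t) * ?D (x + t *\<^sub>R e) - 1 * g (x + t *\<^sub>R e)) has_integral
     ((1 - of_real 1) * g (x + 1 *\<^sub>R e) - (1 - of_real 0) * g (x + 0 *\<^sub>R e))) {0..1}"
  proof (rule fundamental_theorem_of_calculus)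
    fix t :: real
    have "((\<lambda>t::real. 1 - complex_of_real t) has_vector_derivative (0 - of_real 1)) (at t within {0..1})"
      by (intro has_vector_derivative_diff has_vector_derivative_const
          bounded_linear.has_vector_derivative[OF bounded_linear_of_real] has_vector_derivative_id)
    from has_vector_derivative_mult[OF this has_vector_derivative_line[OF assms]]
    show "((\<lambda>t::real. (1 - complex_of_real t) * g (x + t *\<^sub>R e)) has_vector_derivative
        (1 - of_real t) * ?D (x + t *\<^sub>R e) - 1 * g (x + t *\<^sub>R e)) (at t within {0..1})"
      by simp
  qed simp
  then have "integral {0..1} (\<lambda>t::real. (1 - of_real t) * ?D (x + t *\<^sub>R e) - 1 * g (x + t *\<^sub>R e)) = - g x"
    by (simp add: integral_unique)
  moreover have "(\<lambda>t::real. (1 - of_real t) * ?D (x + t *\<^sub>R e)) integrable_on {0..1}"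
    by (intro line_integrand_integrable Ck_imp_continuous[OF Ck_SucD(2)[OF assms]] continuous_intros)
  moreover have "(\<lambda>t::real. 1 * g (x + t *\<^sub>R e)) integrable_on {0..1}"
    by (intro line_integrand_integrable[of "\<lambda>t. 1"] Ck_imp_continuous[OF assms] continuous_intros)
  ultimately have eq: "line_integral (\<lambda>t. 1 - of_real t) e ?D x - line_integral (\<lambda>t. 1) e g x = - g x"
    unfolding line_integral_def by (simp only: integral_diff)
  have "p = q - r" if "p - q = - r" for p q r :: complex
    using that by (simp add: algebra_simps)
  from this[OF eq] show "line_integral (\<lambda>t. 1 - of_real t) e ?D x = line_integral (\<lambda>t. 1) e g x - g x" .
qed

subsection \<open>Closed forms are cohomologous to constant forms\<close>

lemma linear_line_integral:
  assumes \<kappa>: "continuous_on {0..1} \<kappa>" and lin: "\<And>y. linear (h y)" and cont: "\<And>u. continuous_on UNIV (\<lambda>y. h y u)"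
  shows "linear (\<lambda>u. line_integral \<kappa> e (\<lambda>y. h y u) x)"
proof (rule linearI)
  show "line_integral \<kappa> e (\<lambda>y. h y (u + v)) x = line_integral \<kappa> e (\<lambda>y. h y u) x + line_integral \<kappa> e (\<lambda>y. h y v) x" for u v
    unfolding linear_add[OF lin] by (rule line_integral_add[OF \<kappa> cont cont])
  show "line_integral \<kappa> e (\<lambda>y. h y (r *\<^sub>R u)) x = r *\<^sub>R line_integral \<kappa> e (\<lambda>y. h y u) x" for r u
    unfolding linear_scale[OF lin] scaleR_conv_of_real by (rule line_integral_cmult)
qed

lemma smooth_form2D:
  assumes "smooth_form2 L \<omega>"
  shows "linear (\<omega> x u)" "linear (\<lambda>u. \<omega> x u v)" "\<omega> x u u = 0" "l \<in> L \<Longrightarrow> \<omega> (x + l) = \<omega> x"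
    "Ck k (\<lambda>x. \<omega> x u v)" "continuous_on UNIV (\<lambda>x. \<omega> x u v)"
proof -
  note \<omega> = assms[unfolded smooth_form2_def]
  note bil = \<omega>[THEN conjunct1, THEN spec, THEN conjunct1, unfolded bilinear_def]
  show "linear (\<omega> x u)" by (rule bil[THEN conjunct1, THEN spec])
  show "linear (\<lambda>u. \<omega> x u v)" by (rule bil[THEN conjunct2, THEN spec])
  show "\<omega> x u u = 0" by (rule \<omega>[THEN conjunct1, THEN spec, THEN conjunct2, THEN spec])
  show "\<omega> (x + l) = \<omega> x" if "l \<in> L"
    by (rule \<omega>[THEN conjunct2, THEN conjunct1, THEN spec, THEN bspec, OF that])
  show Ck: "Ck k (\<lambda>x. \<omega> x u v)" for k
    by (rule \<omega>[THEN conjunct2, THEN conjunct2, THEN spec, THEN spec, THEN spec])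
  show "continuous_on UNIV (\<lambda>x. \<omega> x u v)" by (rule Ck_imp_continuous[OF Ck])
qed

lemma smooth_form1D:
  assumes "smooth_form1 L \<eta>"
  shows "linear (\<eta> x)" "l \<in> L \<Longrightarrow> \<eta> (x + l) = \<eta> x" "Ck k (\<lambda>x. \<eta> x u)"
proof -
  note \<eta> = assms[unfolded smooth_form1_def]
  show "linear (\<eta> x)" by (rule \<eta>[THEN conjunct1, THEN spec])
  show "\<eta> (x + l) = \<eta> x" if "l \<in> L"
    by (rule \<eta>[THEN conjunct2, THEN conjunct1, THEN spec, THEN bspec, OF that])
  show "Ck k (\<lambda>x. \<eta> x u)"
    by (rule \<eta>[THEN conjunct2, THEN conjunct2, THEN spec, THEN spec])
qed

definition "avg_form e \<omega> = (\<lambda>x u v. line_integral (\<lambda>t. 1) e (\<lambda>y. \<omega> y u v) x)"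
text \<open>The contraction of \<omega> with the constant field \<open>e\<close>, integrated along
  the segment: the homotopy operator between averaging and the identity.\<close>

definition "prim_form e \<omega> = (\<lambda>x u. line_integral (\<lambda>t. 1 - of_real t) e (\<lambda>y. \<omega> y e u) x)"

lemma line_integral_periodic:
  assumes "\<And>x. g (x + l) = g x"
  shows "line_integral \<kappa> e g (x + l) = line_integral \<kappa> e g x"
proof -
  have "g (x + l + t *\<^sub>R e) = g (x + t *\<^sub>R e)" for t
  proof -
    have "x + l + t *\<^sub>R e = (x + t *\<^sub>R e) + l" by (simp only: add_ac)
    then show ?thesis by (simp only: assms)
  qed
  then show ?thesis by (simp only: line_integral_def)
qed

lemma closed_form2D:
  assumes "closed_form2 L \<omega>"
  shows "smooth_form2 L \<omega>"
    "frechet_derivative (\<lambda>y. \<omega> y v w) (at x) u - frechet_derivative (\<lambda>y. \<omega> y u w) (at x) v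
     + frechet_derivative (\<lambda>y. \<omega> y u v) (at x) w = 0"
proof -
  show "smooth_form2 L \<omega>" using assms unfolding closed_form2_def by (rule conjunct1)
  have "\<forall>x u v w. ext_deriv2 \<omega> x u v w = 0" using assms unfolding closed_form2_def by (rule conjunct2)
  then show "frechet_derivative (\<lambda>y. \<omega> y v w) (at x) u - frechet_derivative (\<lambda>y. \<omega> y u w) (at x) v
     + frechet_derivative (\<lambda>y. \<omega> y u v) (at x) w = 0"
    unfolding ext_deriv2_def by (elim allE)
qed

lemma frechet_derivative_line_integral:
  assumes "continuous_on {0..1} \<kappa>" "Ck (Suc 0) g"
  shows "frechet_derivative (line_integral \<kappa> e g) (at x) u = line_integral \<kappa> e (\<lambda>y. frechet_derivative g (at y) u) x"
  by (rule fun_cong[OF frechet_derivative_at[OF line_integral_has_derivative[OF assms], symmetric]])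

lemma closed_form2_avg_form:
  assumes cl: "closed_form2 L \<omega>"
  shows "closed_form2 L (avg_form e \<omega>)"
proof -
  note \<omega> = smooth_form2D[OF closed_form2D(1)[OF cl]]
  have k1: "continuous_on {0..1} (\<lambda>t::real. 1 :: complex)" by simp
  have "smooth_form2 L (avg_form e \<omega>)"
    unfolding smooth_form2_def bilinear_def
  proof (intro conjI allI ballI)
    show "linear (avg_form e \<omega> x u)" for x u
      unfolding avg_form_def by (rule linear_line_integral[OF k1 \<omega>(1) \<omega>(6)])
    show "linear (\<lambda>u. avg_form e \<omega> x u v)" for x v
      unfolding avg_form_def by (rule linear_line_integral[OF k1 \<omega>(2) \<omega>(6)])
    show "avg_form e \<omega> x u u = 0" for x u
      unfolding avg_form_def \<omega>(3) by (simp add: line_integral_def)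
    show "avg_form e \<omega> (x + l) = avg_form e \<omega> x" if "l \<in> L" for x l
      unfolding avg_form_def by (intro ext line_integral_periodic) (simp only: \<omega>(4)[OF that])
    show "Ck k (\<lambda>x. avg_form e \<omega> x u v)" for k u v
      unfolding avg_form_def by (rule Ck_line_integral[OF k1 \<omega>(5)])
  qed
  moreover have "ext_deriv2 (avg_form e \<omega>) x u v w = 0" for x u v w
  proof -
    have cont: "continuous_on UNIV (\<lambda>y. frechet_derivative (\<lambda>y. \<omega> y u v) (at y) w)" for u v w
      by (rule Ck_imp_continuous[OF Ck_SucD(2)[OF \<omega>(5)]])
    have "ext_deriv2 (avg_form e \<omega>) x u v w
      = line_integral (\<lambda>t. 1) e (\<lambda>y. frechet_derivative (\<lambda>y. \<omega> y v w) (at y) u) x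
      - line_integral (\<lambda>t. 1) e (\<lambda>y. frechet_derivative (\<lambda>y. \<omega> y u w) (at y) v) x
      + line_integral (\<lambda>t. 1) e (\<lambda>y. frechet_derivative (\<lambda>y. \<omega> y u v) (at y) w) x"
      unfolding ext_deriv2_def avg_form_def by (simp only: frechet_derivative_line_integral[OF k1 \<omega>(5)])
    also have "\<dots> = line_integral (\<lambda>t. 1) e (\<lambda>y. frechet_derivative (\<lambda>y. \<omega> y v w) (at y) u
       - frechet_derivative (\<lambda>y. \<omega> y u w) (at y) v + frechet_derivative (\<lambda>y. \<omega> y u v) (at y) w) x"
      by (simp only: line_integral_add[OF k1 continuous_on_diff[OF cont cont] cont] line_integral_diff[OF k1 cont cont])
    also have "\<dots> = 0"
      by (simp only: closed_form2D(2)[OF cl]) (simp add: line_integral_def)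
    finally show ?thesis .
  qed
  ultimately show ?thesis unfolding closed_form2_def by (intro conjI allI)
qed

text \<open>By Cartan's formula the exterior derivative of the contraction of a closed form with
  \<open>e\<close> is its derivative in direction \<open>e\<close>. Integrating this by parts
  against the weight 1 - t gives the average minus the form.\<close>

lemma avg_form_exact:
  assumes cl: "closed_form2 L \<omega>"
  shows "exact_form2 L (\<lambda>x u v. avg_form e \<omega> x u v - \<omega> x u v)"
  unfolding exact_form2_def
proof (intro exI[of _ "prim_form e \<omega>"] conjI)
  note \<omega> = smooth_form2D[OF closed_form2D(1)[OF cl]]
  have k: "continuous_on {0..1} (\<lambda>t::real. 1 - complex_of_real t)" by (intro continuous_intros)
  show "smooth_form1 L (prim_form e \<omega>)"
    unfolding smooth_form1_def
  proof (intro conjI allI ballI)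
    show "linear (prim_form e \<omega> x)" for x
      unfolding prim_form_def by (rule linear_line_integral[OF k \<omega>(1) \<omega>(6)])
    show "prim_form e \<omega> (x + l) = prim_form e \<omega> x" if "l \<in> L" for x l
      unfolding prim_form_def by (intro ext line_integral_periodic) (simp only: \<omega>(4)[OF that])
    show "Ck k (\<lambda>x. prim_form e \<omega> x u)" for k u
      unfolding prim_form_def by (rule Ck_line_integral[OF k \<omega>(5)])
  qed
  have cont: "continuous_on UNIV (\<lambda>y. frechet_derivative (\<lambda>y. \<omega> y u v) (at y) w)" for u v w
    by (rule Ck_imp_continuous[OF Ck_SucD(2)[OF \<omega>(5)]])
  have "ext_deriv1 (prim_form e \<omega>) x u v = avg_form e \<omega> x u v - \<omega> x u v" for x u v
  proof -
    have "ext_deriv1 (prim_form e \<omega>) x u v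
      = line_integral (\<lambda>t. 1 - of_real t) e (\<lambda>y. frechet_derivative (\<lambda>y. \<omega> y e v) (at y) u
         - frechet_derivative (\<lambda>y. \<omega> y e u) (at y) v) x"
      unfolding ext_deriv1_def prim_form_def
      by (simp only: frechet_derivative_line_integral[OF k \<omega>(5)] line_integral_diff[OF k cont cont])
    also have "(\<lambda>y. frechet_derivative (\<lambda>y. \<omega> y e v) (at y) u - frechet_derivative (\<lambda>y. \<omega> y e u) (at y) v)
       = (\<lambda>y. frechet_derivative (\<lambda>y. \<omega> y u v) (at y) e)"
    proof
      fix y
      have gen: "q - r = p" if "p - q + r = 0" for p q r :: complex
      proof -
        have "q - r = p - (p - q + r)" by simp
        then show ?thesis unfolding that by simp
      qed
      show "frechet_derivative (\<lambda>y. \<omega> y e v) (at y) u - frechet_derivative (\<lambda>y. \<omega> y e u) (at y) v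
         = frechet_derivative (\<lambda>y. \<omega> y u v) (at y) e"
        by (rule gen[OF closed_form2D(2)[OF cl]])
    qed
    also have "line_integral (\<lambda>t. 1 - of_real t) e (\<lambda>y. frechet_derivative (\<lambda>y. \<omega> y u v) (at y) e) x
       = avg_form e \<omega> x u v - \<omega> x u v"
      unfolding avg_form_def by (rule line_integral_derivative(2)[OF \<omega>(5)])
    finally show ?thesis .
  qed
  then show "(\<lambda>x u v. avg_form e \<omega> x u v - \<omega> x u v) = ext_deriv1 (prim_form e \<omega>)"
    by (intro ext) (simp only:)
qed

text \<open>The derivative of the average in direction \<open>e\<close> is the difference of the
  values of \<omega> at the ends of the segment, which is 0 by periodicity.\<close>

lemma avg_form_invariant:
  assumes cl: "closed_form2 L \<omega>" and e: "e \<in> L"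
  shows "avg_form e \<omega> (x + r *\<^sub>R e) = avg_form e \<omega> x"
proof (intro ext)
  fix u v
  note \<omega> = smooth_form2D[OF closed_form2D(1)[OF cl]]
  have k1: "continuous_on {0..1} (\<lambda>t::real. 1 :: complex)" by simp
  let ?a = "line_integral (\<lambda>t. 1) e (\<lambda>y. \<omega> y u v)"
  have zero: "((\<lambda>t::real. ?a (x + t *\<^sub>R e)) has_vector_derivative 0) (at t within UNIV)" for t
  proof -
    have "frechet_derivative ?a (at (x + t *\<^sub>R e)) e = \<omega> (x + t *\<^sub>R e + e) u v - \<omega> (x + t *\<^sub>R e) u v"
      unfolding frechet_derivative_line_integral[OF k1 \<omega>(5)] by (rule line_integral_derivative(1)[OF \<omega>(5)])
    also have "\<dots> = 0" by (simp only: \<omega>(4)[OF e] diff_self)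
    finally have eq: "frechet_derivative ?a (at (x + t *\<^sub>R e)) e = 0" .
    have "((\<lambda>t::real. ?a (x + t *\<^sub>R e)) has_vector_derivative frechet_derivative ?a (at (x + t *\<^sub>R e)) e) (at t within UNIV)"
      by (rule has_vector_derivative_line[OF Ck_line_integral[OF k1 \<omega>(5)]])
    then show ?thesis unfolding eq .
  qed
  obtain c where c: "\<And>t. t \<in> UNIV \<Longrightarrow> ?a (x + t *\<^sub>R e) = c"
    by (rule has_vector_derivative_zero_constant[OF convex_UNIV zero]) (rule that)
  show "avg_form e \<omega> (x + r *\<^sub>R e) u v = avg_form e \<omega> x u v"
    unfolding avg_form_def using c[of r] c[of 0] by simp
qed

lemma exact_form2_zero: "exact_form2 L (\<lambda>x u v. 0)"
  unfolding exact_form2_def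
proof (intro exI[of _ "\<lambda>x u. 0"] conjI)
  show "smooth_form1 L (\<lambda>x u. 0)"
    unfolding smooth_form1_def by (intro conjI allI ballI Ck_const linear_0) (simp_all add: linear_iff)
  show "(\<lambda>x u v. 0) = ext_deriv1 (\<lambda>x u. 0)"
    by (intro ext) (simp add: ext_deriv1_def frechet_derivative_const)
qed

lemma exact_form2_combine:
  assumes "exact_form2 L \<omega>" "exact_form2 L \<omega>'"
  shows "exact_form2 L (\<lambda>x u v. \<omega> x u v + c * \<omega>' x u v)"
proof -
  obtain \<eta> where \<eta>: "smooth_form1 L \<eta>" "\<omega> = ext_deriv1 \<eta>" using assms(1) unfolding exact_form2_def by (elim exE conjE) (rule that)
  obtain \<eta>' where \<eta>': "smooth_form1 L \<eta>'" "\<omega>' = ext_deriv1 \<eta>'" using assms(2) unfolding exact_form2_def by (elim exE conjE) (rule that)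
  note s = smooth_form1D[OF \<eta>(1)] and s' = smooth_form1D[OF \<eta>'(1)]
  define \<zeta> where "\<zeta> x u = \<eta> x u + c * \<eta>' x u" for x u
  have "smooth_form1 L \<zeta>"
    unfolding smooth_form1_def
  proof (intro conjI allI ballI)
    show "linear (\<zeta> x)" for x
      by (rule linearI)
        (simp_all add: \<zeta>_def linear_add[OF s(1)] linear_add[OF s'(1)] linear_scale[OF s(1)] linear_scale[OF s'(1)]
          algebra_simps)
    show "\<zeta> (x + l) = \<zeta> x" if "l \<in> L" for x l
      by (intro ext) (simp only: \<zeta>_def s(2)[OF that] s'(2)[OF that])
    show "Ck k (\<lambda>x. \<zeta> x u)" for k u
      unfolding \<zeta>_def by (intro Ck_add Ck_cmult s(3) s'(3))
  qed
  moreover have "frechet_derivative (\<lambda>y. \<zeta> y v) (at x) u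
     = frechet_derivative (\<lambda>y. \<eta> y v) (at x) u + c * frechet_derivative (\<lambda>y. \<eta>' y v) (at x) u" for x u v
    unfolding \<zeta>_def
    by (rule fun_cong[OF frechet_derivative_at[OF has_derivative_add[OF Ck_SucD(1)[OF s(3)]
        has_derivative_mult_right[OF Ck_SucD(1)[OF s'(3)]]], symmetric]])
  then have "(\<lambda>x u v. \<omega> x u v + c * \<omega>' x u v) = ext_deriv1 \<zeta>"
    unfolding \<eta>(2) \<eta>'(2) by (intro ext) (simp add: ext_deriv1_def algebra_simps)
  ultimately show ?thesis unfolding exact_form2_def by (intro exI conjI)
qed

text \<open>Averages are taken over one vector after the other; each new average keeps the
  invariances already gained.\<close>

lemma closed_form2_cohomologous_invariant:
  assumes "finite B" "B \<subseteq> L" "closed_form2 L \<omega>"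
  shows "\<exists>\<omega>'. closed_form2 L \<omega>' \<and> exact_form2 L (\<lambda>x u v. \<omega>' x u v - \<omega> x u v) \<and>
    (\<forall>e\<in>B. \<forall>x r. \<omega>' (x + r *\<^sub>R e) = \<omega>' x)"
  using assms
proof (induction B rule: finite_induct)
  case empty
  then show ?case using exact_form2_zero by (intro exI[of _ \<omega>]) simp
next
  case (insert e B)
  have BL: "B \<subseteq> L" and e: "e \<in> L" using insert.prems(1) by simp_all
  obtain \<omega>' where \<omega>': "closed_form2 L \<omega>'" "exact_form2 L (\<lambda>x u v. \<omega>' x u v - \<omega> x u v)"
    "\<forall>e\<in>B. \<forall>x r. \<omega>' (x + r *\<^sub>R e) = \<omega>' x"
    using insert.IH[OF BL insert.prems(2)] by (elim exE conjE) (rule that)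
  have "exact_form2 L (\<lambda>x u v. (avg_form e \<omega>' x u v - \<omega>' x u v) + 1 * (\<omega>' x u v - \<omega> x u v))"
    by (rule exact_form2_combine[OF avg_form_exact[OF \<omega>'(1)] \<omega>'(2)])
  then have "exact_form2 L (\<lambda>x u v. avg_form e \<omega>' x u v - \<omega> x u v)" by simp
  moreover have "avg_form e \<omega>' (x + r *\<^sub>R b) = avg_form e \<omega>' x" if "b \<in> insert e B" for b x r
  proof (cases "b = e")
    case True
    then show ?thesis using avg_form_invariant[OF \<omega>'(1) e] by simp
  next
    case False
    then have "b \<in> B" using that by simp
    then have inv: "\<omega>' (y + r *\<^sub>R b) = \<omega>' y" for y
      by (rule \<omega>'(3)[THEN bspec, THEN spec, THEN spec])
    show ?thesis unfolding avg_form_def by (intro ext line_integral_periodic) (simp only: inv)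
  qed
  ultimately show ?case
    by (intro exI[of _ "avg_form e \<omega>'"] conjI closed_form2_avg_form[OF \<omega>'(1)] ballI allI)
qed

text \<open>The directions of invariance form a real subspace. It contains a basis of
  \<open>L\<close>, so it is the whole space and the averaged form is constant.\<close>

lemma closed_form2_cohomologous_const:
  assumes lat: "lattice_group L" and cl: "closed_form2 L \<omega>"
  obtains \<beta> where "bilinear \<beta>" "exact_form2 L (\<lambda>x u v. \<beta> u v - \<omega> x u v)"
proof -
  obtain B where B: "finite B" "span B = UNIV" "L = zmod.span B"
    using lattice_group_basis[OF lat] .
  have BL: "B \<subseteq> L" unfolding B(3) by (rule zmod.span_superset)
  obtain \<omega>' where \<omega>': "closed_form2 L \<omega>'" "exact_form2 L (\<lambda>x u v. \<omega>' x u v - \<omega> x u v)"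
    "\<forall>e\<in>B. \<forall>x r. \<omega>' (x + r *\<^sub>R e) = \<omega>' x"
    using closed_form2_cohomologous_invariant[OF B(1) BL cl] by (elim exE conjE) (rule that)
  have "Real_Vector_Spaces.subspace {d. \<forall>x r. \<omega>' (x + r *\<^sub>R d) = \<omega>' x}"
    unfolding Real_Vector_Spaces.subspace_def
  proof (intro conjI ballI allI CollectI)
    fix a b x and r c :: real
    assume "a \<in> {d. \<forall>x r. \<omega>' (x + r *\<^sub>R d) = \<omega>' x}"
    then have a: "\<omega>' (x + r *\<^sub>R a) = \<omega>' x" for x r by (elim CollectE allE)
    show "\<omega>' (x + r *\<^sub>R (c *\<^sub>R a)) = \<omega>' x" using a[of x "r * c"] by simp
    assume "b \<in> {d. \<forall>x r. \<omega>' (x + r *\<^sub>R d) = \<omega>' x}"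
    then have b: "\<omega>' (x + r *\<^sub>R b) = \<omega>' x" for x r by (elim CollectE allE)
    have "\<omega>' (x + r *\<^sub>R (a + b)) = \<omega>' ((x + r *\<^sub>R a) + r *\<^sub>R b)" by (simp add: algebra_simps)
    then show "\<omega>' (x + r *\<^sub>R (a + b)) = \<omega>' x" by (simp only: a b)
  qed simp
  moreover have "B \<subseteq> {d. \<forall>x r. \<omega>' (x + r *\<^sub>R d) = \<omega>' x}"
    by (intro subsetI CollectI) (rule \<omega>'(3)[THEN bspec])
  ultimately have "span B \<subseteq> {d. \<forall>x r. \<omega>' (x + r *\<^sub>R d) = \<omega>' x}"
    by (intro span_minimal)
  then have "x \<in> {d. \<forall>x r. \<omega>' (x + r *\<^sub>R d) = \<omega>' x}" for x unfolding B(2) by (rule subsetD) simp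
  note inv = CollectD[OF this, rule_format]
  have "\<omega>' (0 + 1 *\<^sub>R x) = \<omega>' 0" for x by (rule inv)
  then have const: "\<omega>' x = \<omega>' 0" for x by simp
  show thesis
  proof (rule that[of "\<omega>' 0"])
    show "bilinear (\<omega>' 0)"
      using closed_form2D(1)[OF \<omega>'(1)] unfolding smooth_form2_def by (elim conjE allE)
    show "exact_form2 L (\<lambda>x u v. \<omega>' 0 u v - \<omega> x u v)"
    proof -
      have "\<omega>' x u v - \<omega> x u v = \<omega>' 0 u v - \<omega> x u v" for x u v
        by (subst const) (rule refl)
      then show ?thesis using \<omega>'(2) by presburger
    qed
  qed
qed

text \<open>Stokes on the parallelogram spanned by two lattice vectors: the integral of a constant
  form is its value on them, while the integrals of the periodic primitive over opposite edges
  cancel. Bilinearity extends this from \<open>L\<close> to its span.\<close>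

lemma const_exact_form2_eq_0:
  assumes lat: "lattice_group L" and \<beta>: "bilinear \<beta>" and ex: "exact_form2 L (\<lambda>x. \<beta>)"
  shows "\<beta> u v = 0"
proof -
  obtain \<eta> where \<eta>: "smooth_form1 L \<eta>" "(\<lambda>x. \<beta>) = ext_deriv1 \<eta>"
    using ex unfolding exact_form2_def by (elim exE conjE) (rule that)
  note s = smooth_form1D[OF \<eta>(1)]
  have k1: "continuous_on {0..1} (\<lambda>t::real. 1 :: complex)" by simp
  have onL: "\<beta> l l' = 0" if l: "l \<in> L" "l' \<in> L" for l l'
  proof -
    have d: "\<beta> l l' = frechet_derivative (\<lambda>y. \<eta> y l') (at x) l - frechet_derivative (\<lambda>y. \<eta> y l) (at x) l'" for x
      using fun_cong[OF fun_cong[OF fun_cong[OF \<eta>(2), of x], of l], of l'] by (simp only: ext_deriv1_def)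
    have cont: "continuous_on UNIV (\<lambda>y. frechet_derivative (\<lambda>y. \<eta> y u) (at y) w)" for u w
      by (rule Ck_imp_continuous[OF Ck_SucD(2)[OF s(3)]])
    \<comment> \<open>The integral of the primitive over the edge \<open>l\<close> starting at a
      variable point; its increment along \<open>l'\<close> compares two opposite edges.\<close>
    define g where "g = line_integral (\<lambda>t. 1) l (\<lambda>y. \<eta> y l)"
    have Dg: "frechet_derivative g (at x) l' = - \<beta> l l'" for x
    proof -
      have "\<beta> l l' = line_integral (\<lambda>t. 1) l (\<lambda>y. \<beta> l l') x"
        by (simp add: line_integral_def)
      also have "\<dots> = line_integral (\<lambda>t. 1) l (\<lambda>y. frechet_derivative (\<lambda>y. \<eta> y l') (at y) l
          - frechet_derivative (\<lambda>y. \<eta> y l) (at y) l') x"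
        by (simp only: d[symmetric])
      also have "\<dots> = (\<eta> (x + l) l' - \<eta> x l') - frechet_derivative g (at x) l'"
        unfolding g_def
        by (simp only: line_integral_diff[OF k1 cont cont] line_integral_derivative(1)[OF s(3)]
            frechet_derivative_line_integral[OF k1 s(3)])
      finally show ?thesis by (simp add: s(2)[OF l(1)])
    qed
    have Ckg: "Ck k g" for k unfolding g_def by (rule Ck_line_integral[OF k1 s(3)])
    have "- \<beta> l l' = line_integral (\<lambda>t. 1) l' (\<lambda>y. frechet_derivative g (at y) l') 0"
      by (simp only: Dg) (simp add: line_integral_def)
    also have "\<dots> = g (0 + l') - g 0" by (rule line_integral_derivative(1)[OF Ckg])
    also have "\<dots> = 0"
      unfolding g_def using line_integral_periodic[of "\<lambda>y. \<eta> y l" l'] by (simp only: s(2)[OF l(2)] diff_self)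
    finally show ?thesis by simp
  qed
  have lin: "linear (\<beta> u)" "linear (\<lambda>u. \<beta> u v)" for u v
    by (rule \<beta>[unfolded bilinear_def, THEN conjunct1, THEN spec] \<beta>[unfolded bilinear_def, THEN conjunct2, THEN spec])+
  have sp: "x \<in> span L" for x using lattice_group_span[OF lat] by simp
  have "\<beta> l v = 0" if "l \<in> L" for l
    by (rule linear_eq_0_on_span[OF lin(1) onL[OF that] sp])
  then show ?thesis
    by (rule linear_eq_0_on_span[OF lin(2) _ sp])
qed

subsection \<open>Eigenvalues on the cohomology of type (1,1)\<close>

text \<open>\<open>torus_lift\<close> chooses an unspecified continuous lift. It differs from the
  affine one by a continuous function with values in the discrete group \<open>L\<close>, whose
  level set through 0 is open and closed.\<close>

lemma torus_lift_affine:
  fixes L :: "(complex^'n) set"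
  assumes L: "zmod.subspace L" "discrete L" and f: "\<And>v. f (torus_proj L v) = torus_proj L (A *v v + b)"
  obtains b' where "torus_lift L f = (\<lambda>v. A *v v + b')"
proof -
  define \<Phi> where "\<Phi> = torus_lift L f"
  have contA: "continuous_on UNIV (\<lambda>v. A *v v + b)"
    by (intro continuous_on_add continuous_on_const bounded_linear.continuous_on[OF matrix_vector_mul_bounded_linear] continuous_on_id)
  then have "continuous_on UNIV (\<lambda>v. A *v v + b) \<and> (\<forall>v. torus_proj L (A *v v + b) = f (torus_proj L v))"
    by (intro conjI allI f[symmetric])
  then have \<Phi>: "continuous_on UNIV \<Phi> \<and> (\<forall>v. torus_proj L (\<Phi> v) = f (torus_proj L v))"
    unfolding \<Phi>_def torus_lift_def
    by (rule someI[where P="\<lambda>\<Phi>. continuous_on UNIV \<Phi> \<and> (\<forall>v. torus_proj L (\<Phi> v) = f (torus_proj L v))"])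
  have inL: "\<Phi> v - (A *v v + b) \<in> L" for v
    unfolding torus_proj_eq_iff[OF L(1), symmetric] f[symmetric] by (rule \<Phi>[THEN conjunct2, THEN spec])
  obtain e where e: "e > 0" "\<And>l. l \<in> L \<Longrightarrow> norm l < e \<Longrightarrow> l = 0"
    using discrete_subgroup_separated[OF L] by (metis (no_types, lifting))
  define \<delta> where "\<delta> v = \<Phi> v - (A *v v + b)" for v
  have cont: "continuous_on UNIV \<delta>"
    unfolding \<delta>_def[abs_def] by (rule continuous_on_diff[OF conjunct1[OF \<Phi>] contA])
  have "closed {v. \<delta> v = \<delta> 0}"
    by (rule closed_Collect_eq[OF cont continuous_on_const])
  moreover have "{v. \<delta> v = \<delta> 0} = {v. norm (\<delta> v - \<delta> 0) < e}"
  proof (intro Collect_cong iffI)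
    fix v assume "\<delta> v = \<delta> 0"
    then have "norm (\<delta> v - \<delta> 0) = 0" by (simp only: diff_self norm_zero)
    then show "norm (\<delta> v - \<delta> 0) < e" using e(1) by linarith
  next
    fix v assume "norm (\<delta> v - \<delta> 0) < e"
    then have "\<delta> v - \<delta> 0 = 0"
      by (intro e(2)) (simp_all only: \<delta>_def zmod.subspace_diff[OF L(1) inL inL])
    then show "\<delta> v = \<delta> 0" by (simp only: right_minus_eq)
  qed
  moreover have "open {v. norm (\<delta> v - \<delta> 0) < e}"
    by (intro open_Collect_less continuous_on_norm continuous_on_diff continuous_on_const cont)
  ultimately have "{v. \<delta> v = \<delta> 0} = {} \<or> {v. \<delta> v = \<delta> 0} = UNIV"
    by (intro clopen[THEN iffD1] conjI) (simp_all only:)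
  moreover have "0 \<in> {v. \<delta> v = \<delta> 0}" by (rule CollectI, rule refl)
  ultimately have "{v. \<delta> v = \<delta> 0} = UNIV" by (metis empty_iff)
  define c where "c = \<delta> 0"
  have c: "\<Phi> v - (A *v v + b) = c" for v
  proof -
    have "v \<in> {v. \<delta> v = \<delta> 0}" by (simp only: \<open>{v. \<delta> v = \<delta> 0} = UNIV\<close> UNIV_I)
    then show ?thesis by (simp only: c_def mem_Collect_eq \<delta>_def)
  qed
  have "\<Phi> v = A *v v + (b + c)" for v
  proof -
    have "\<Phi> v = (\<Phi> v - (A *v v + b)) + (A *v v + b)" by simp
    then show ?thesis unfolding c by (simp only: add_ac)
  qed
  then show thesis by (intro that[of "b + c"]) (simp add: \<Phi>_def fun_eq_iff)
qed

section \<open>Pullback of forms and the induced maps on classes\<close>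

lemma pullback2_affine:
  fixes A :: "complex^'n^'n"
  shows "pullback2 (\<lambda>v. A *v v + b) \<omega> x u v = \<omega> (A *v x + b) (A *v u) (A *v v)"
proof -
  have "((\<lambda>v. A *v v + b) has_derivative (\<lambda>v. A *v v)) (at x)"
    using has_derivative_add[OF bounded_linear_imp_has_derivative[OF matrix_vector_mul_bounded_linear[of A]] has_derivative_const]
    by simp
  then show ?thesis
    unfolding pullback2_def by (simp only: frechet_derivative_at[symmetric])
qed

lemma closed_form2_pullback:
  fixes A :: "complex^'n^'n"
  assumes AL: "\<And>l. l \<in> L \<Longrightarrow> A *v l \<in> L" and cl: "closed_form2 L \<omega>"
  shows "closed_form2 L (\<lambda>x u v. \<omega> (A *v x + b) (A *v u) (A *v v))"
  unfolding closed_form2_def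
proof (intro conjI allI)
  note s = smooth_form2D[OF closed_form2D(1)[OF cl]]
  have lin: "linear (\<lambda>v. A *v v)" by (rule bounded_linear.linear[OF matrix_vector_mul_bounded_linear])
  show "smooth_form2 L (\<lambda>x u v. \<omega> (A *v x + b) (A *v u) (A *v v))"
    unfolding smooth_form2_def bilinear_def
  proof (intro conjI allI ballI)
    show "linear (\<lambda>v. \<omega> (A *v x + b) (A *v u) (A *v v))" for x u
      using linear_compose[OF lin s(1)] unfolding o_def .
    show "linear (\<lambda>u. \<omega> (A *v x + b) (A *v u) (A *v v))" for x v
      using linear_compose[OF lin s(2)] unfolding o_def .
    show "\<omega> (A *v x + b) (A *v u) (A *v u) = 0" for x u by (rule s(3))
    show "(\<lambda>u v. \<omega> (A *v (x + l) + b) (A *v u) (A *v v)) = (\<lambda>u v. \<omega> (A *v x + b) (A *v u) (A *v v))"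
      if "l \<in> L" for x l
    proof -
      have "A *v (x + l) + b = (A *v x + b) + A *v l" by (simp add: matrix_vector_right_distrib)
      then show ?thesis by (simp only: s(4)[OF AL[OF that]])
    qed
    show "Ck k (\<lambda>x. \<omega> (A *v x + b) (A *v u) (A *v v))" for k u v
      by (rule Ck_affine[OF matrix_vector_mul_bounded_linear s(5)])
  qed
  show "ext_deriv2 (\<lambda>x u v. \<omega> (A *v x + b) (A *v u) (A *v v)) x u v w = 0" for x u v w
    unfolding ext_deriv2_def frechet_derivative_affine[OF matrix_vector_mul_bounded_linear s(5)]
    by (rule closed_form2D(2)[OF cl])
qed

lemma exact_form2_pullback:
  fixes A :: "complex^'n^'n"
  assumes AL: "\<And>l. l \<in> L \<Longrightarrow> A *v l \<in> L" and ex: "exact_form2 L \<omega>"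
  shows "exact_form2 L (\<lambda>x u v. \<omega> (A *v x + b) (A *v u) (A *v v))"
proof -
  obtain \<eta> where \<eta>: "smooth_form1 L \<eta>" "\<omega> = ext_deriv1 \<eta>"
    using ex unfolding exact_form2_def by (elim exE conjE) (rule that)
  note s = smooth_form1D[OF \<eta>(1)]
  have lin: "linear (\<lambda>v. A *v v)" by (rule bounded_linear.linear[OF matrix_vector_mul_bounded_linear])
  show ?thesis
    unfolding exact_form2_def
  proof (intro exI[of _ "\<lambda>x u. \<eta> (A *v x + b) (A *v u)"] conjI)
    show "smooth_form1 L (\<lambda>x u. \<eta> (A *v x + b) (A *v u))"
      unfolding smooth_form1_def
    proof (intro conjI allI ballI)
      show "linear (\<lambda>u. \<eta> (A *v x + b) (A *v u))" for x
        using linear_compose[OF lin s(1)] unfolding o_def .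
      show "(\<lambda>u. \<eta> (A *v (x + l) + b) (A *v u)) = (\<lambda>u. \<eta> (A *v x + b) (A *v u))" if "l \<in> L" for x l
      proof -
        have "A *v (x + l) + b = (A *v x + b) + A *v l" by (simp add: matrix_vector_right_distrib)
        then show ?thesis by (simp only: s(2)[OF AL[OF that]])
      qed
      show "Ck k (\<lambda>x. \<eta> (A *v x + b) (A *v u))" for k u
        by (rule Ck_affine[OF matrix_vector_mul_bounded_linear s(3)])
    qed
    show "(\<lambda>x u v. \<omega> (A *v x + b) (A *v u) (A *v v)) = ext_deriv1 (\<lambda>x u. \<eta> (A *v x + b) (A *v u))"
      unfolding \<eta>(2) ext_deriv1_def[abs_def] frechet_derivative_affine[OF matrix_vector_mul_bounded_linear s(3)] ..
  qed
qed

lemma coh_class_eqI: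
  assumes ex: "exact_form2 L (\<lambda>x u v. \<omega> x u v - \<omega>' x u v)"
  shows "coh_class L \<omega> = coh_class L \<omega>'"
proof -
  have 1: "exact_form2 L (\<lambda>x u v. \<zeta> x u v - \<omega>' x u v)" if "exact_form2 L (\<lambda>x u v. \<zeta> x u v - \<omega> x u v)" for \<zeta>
    using exact_form2_combine[OF that ex, of 1] by simp
  have 2: "exact_form2 L (\<lambda>x u v. \<zeta> x u v - \<omega> x u v)" if "exact_form2 L (\<lambda>x u v. \<zeta> x u v - \<omega>' x u v)" for \<zeta>
    using exact_form2_combine[OF that ex, of "-1"] by simp
  show ?thesis
    unfolding coh_class_def
    by (intro Collect_cong conj_cong refl iffI) (erule 1, erule 2)
qed

lemma coh_class_self: "closed_form2 L \<omega> \<Longrightarrow> \<omega> \<in> coh_class L \<omega>"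
  unfolding coh_class_def using exact_form2_zero by simp

lemma coh_classD: "\<zeta> \<in> coh_class L \<omega> \<Longrightarrow> exact_form2 L (\<lambda>x u v. \<zeta> x u v - \<omega> x u v)"
  unfolding coh_class_def by (elim CollectE conjE)

text \<open>Once \<open>T\<close> respects cohomology, the union over all representatives in
  \<open>induced\<close> collapses to one class.\<close>

lemma induced_coh_class:
  assumes "closed_form2 L \<omega>"
    and "\<And>\<zeta>. exact_form2 L (\<lambda>x u v. \<zeta> x u v - \<omega> x u v) \<Longrightarrow> exact_form2 L (\<lambda>x u v. T \<zeta> x u v - T \<omega> x u v)"
  shows "induced L T (coh_class L \<omega>) = coh_class L (T \<omega>)"
proof -
  have "coh_class L (T \<zeta>) = coh_class L (T \<omega>)" if "\<zeta> \<in> coh_class L \<omega>" for \<zeta>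
    by (rule coh_class_eqI[OF assms(2)[OF coh_classD[OF that]]])
  then have "induced L T (coh_class L \<omega>) = (\<Union>\<zeta>\<in>coh_class L \<omega>. coh_class L (T \<omega>))"
    unfolding induced_def by (intro SUP_cong refl)
  then show ?thesis using coh_class_self[OF assms(1)] by (metis UN_constant empty_iff)
qed

text \<open>This serves the upper bound for the dynamical degree. Since exact constant forms vanish,
  the eigenvalue equation between classes becomes an identity between constant bilinear
  forms.\<close>

lemma H11_eigenvalue_invariant_form:
  fixes A :: "complex^'n^'n"
  assumes lat: "lattice_group L" and f: "\<And>v. f (torus_proj L v) = torus_proj L (A *v v + b)"
    and AL: "\<And>l. l \<in> L \<Longrightarrow> A *v l \<in> L" and ev: "H11_eigenvalue L f \<mu>"
  obtains \<beta> where "bilinear \<beta>" "\<exists>u v. \<beta> u v \<noteq> 0" "\<And>u v. \<beta> (A *v u) (A *v v) = \<mu> * \<beta> u v"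
proof -
  have L: "zmod.subspace L" "discrete L" using lat by (simp_all add: lattice_group_def)
  obtain b' where lift: "torus_lift L f = (\<lambda>v. A *v v + b')"
    by (rule torus_lift_affine[OF L f])
  obtain \<omega> where \<omega>: "closed_form2 L \<omega>" and ne: "coh_class L \<omega> \<noteq> coh_class L (\<lambda>x u v. 0)"
    and eq: "H11_pullback L f (coh_class L \<omega>) = H11_scale L \<mu> (coh_class L \<omega>)"
    using ev unfolding H11_eigenvalue_def H11_def
    by (elim bexE imageE CollectE conjE) (rule that, assumption, simp_all only: simp_thms)
  define T where "T \<zeta> = (\<lambda>x u v. \<zeta> (A *v x + b') (A *v u) (A *v v))" for \<zeta> :: "complex^'n \<Rightarrow> complex^'n \<Rightarrow> complex^'n \<Rightarrow> complex"
  have pb: "pullback2 (torus_lift L f) = T"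
    unfolding lift T_def by (intro ext) (rule pullback2_affine)
  obtain \<beta> where \<beta>: "bilinear \<beta>" "exact_form2 L (\<lambda>x u v. \<beta> u v - \<omega> x u v)"
    by (rule closed_form2_cohomologous_const[OF lat \<omega>])
  have "T \<omega> \<in> coh_class L (T \<omega>)"
    unfolding T_def by (rule coh_class_self[OF closed_form2_pullback[OF AL \<omega>]])
  then have "T \<omega> \<in> H11_pullback L f (coh_class L \<omega>)"
    unfolding H11_pullback_def induced_def pb by (rule UN_I[OF coh_class_self[OF \<omega>]])
  then have "T \<omega> \<in> H11_scale L \<mu> (coh_class L \<omega>)" by (simp only: eq)
  then obtain \<omega>' where \<omega>': "\<omega>' \<in> coh_class L \<omega>" "T \<omega> \<in> coh_class L (\<lambda>x u v. \<mu> * \<omega>' x u v)"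
    unfolding H11_scale_def induced_def by (elim UN_E) (rule that)
  note e1 = exact_form2_pullback[OF AL \<beta>(2), where b = b'] and e2 = coh_classD[OF \<omega>'(2)] and e3 = coh_classD[OF \<omega>'(1)]
  \<comment> \<open>A chain of cohomologies from the pullback of \<beta> through
    \<open>T \<omega>\<close> and \<mu> times \<open>\<omega>'\<close> to \<mu> times \<omega>; the
    next step replaces \<omega> by \<beta>.\<close>
  have "exact_form2 L (\<lambda>x u v. ((\<beta> (A *v u) (A *v v) - T \<omega> x u v) + 1 * (T \<omega> x u v - \<mu> * \<omega>' x u v))
      + \<mu> * (\<omega>' x u v - \<omega> x u v))"
    using exact_form2_combine[OF exact_form2_combine[OF e1 e2] e3] unfolding T_def .
  from exact_form2_combine[OF this \<beta>(2), of "- \<mu>"]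
  have ex: "exact_form2 L (\<lambda>x u v. \<beta> (A *v u) (A *v v) - \<mu> * \<beta> u v)"
    by (simp add: algebra_simps)
  have lin: "linear (\<lambda>v. A *v v)" by (rule bounded_linear.linear[OF matrix_vector_mul_bounded_linear])
  have linb: "linear (\<beta> u)" "linear (\<lambda>u. \<beta> u v)" for u v
    by (rule \<beta>(1)[unfolded bilinear_def, THEN conjunct1, THEN spec] \<beta>(1)[unfolded bilinear_def, THEN conjunct2, THEN spec])+
  have "bilinear (\<lambda>u v. \<beta> (A *v u) (A *v v) - \<mu> * \<beta> u v)"
    unfolding bilinear_def
    by (intro conjI allI linearI)
      (simp_all add: linear_add[OF lin] linear_scale[OF lin] linear_add[OF linb(1)] linear_add[OF linb(2)]
        linear_scale[OF linb(1)] linear_scale[OF linb(2)] algebra_simps)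
  from const_exact_form2_eq_0[OF lat this ex]
  have "\<beta> (A *v u) (A *v v) = \<mu> * \<beta> u v" for u v by (simp only: right_minus_eq)
  moreover have "\<exists>u v. \<beta> u v \<noteq> 0"
  proof (rule ccontr)
    assume "\<not> ?thesis"
    then have "\<beta> u v = 0" for u v by simp
    then have "exact_form2 L (\<lambda>x u v. 0 - \<omega> x u v)" using \<beta>(2) by (simp only:)
    then have "coh_class L (\<lambda>x u v. 0) = coh_class L \<omega>" by (rule coh_class_eqI)
    then show False using ne by simp
  qed
  ultimately show thesis using \<beta>(1) by (intro that)
qed

text \<open>This serves the lower bound. A left eigenvector is a linear form \<open>ell\<close> that
  the pullback multiplies by \<alpha>, so its wedge product with its conjugate is a constant form of
  type (1,1) multiplied by the squared modulus of \<alpha>.\<close>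

lemma H11_eigenvalue_of_covector:
  fixes A :: "complex^'n^'n" and w :: "complex^'n"
  assumes lat: "lattice_group L" and f: "\<And>v. f (torus_proj L v) = torus_proj L (A *v v + b)"
    and AL: "\<And>l. l \<in> L \<Longrightarrow> A *v l \<in> L"
    and ev: "\<And>u. (\<Sum>j\<in>UNIV. w $ j * (A *v u) $ j) = \<alpha> * (\<Sum>j\<in>UNIV. w $ j * u $ j)" and w: "w \<noteq> 0"
  shows "H11_eigenvalue L f (\<alpha> * cnj \<alpha>)"
proof -
  have L: "zmod.subspace L" "discrete L" using lat by (simp_all add: lattice_group_def)
  obtain b' where lift: "torus_lift L f = (\<lambda>v. A *v v + b')"
    by (rule torus_lift_affine[OF L f])
  define T where "T \<zeta> = (\<lambda>x u v. \<zeta> (A *v x + b') (A *v u) (A *v v))" for \<zeta> :: "complex^'n \<Rightarrow> complex^'n \<Rightarrow> complex^'n \<Rightarrow> complex"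
  have pb: "pullback2 (torus_lift L f) = T"
    unfolding lift T_def by (intro ext) (rule pullback2_affine)
  define ell where "ell u = (\<Sum>j\<in>UNIV. w $ j * u $ j)" for u
  have lin: "ell (u + v) = ell u + ell v" "ell (r *\<^sub>R u) = r *\<^sub>R ell u" for u v r
    unfolding ell_def by (simp_all add: sum.distrib distrib_left scaleR_right.sum)
  define \<beta> where "\<beta> u v = ell u * cnj (ell v) - ell v * cnj (ell u)" for u v
  have bil: "bilinear \<beta>"
    unfolding bilinear_def \<beta>_def[abs_def]
    by (intro conjI allI linearI) (simp_all add: lin scaleR_conv_of_real[where 'a=complex] algebra_simps)
  have T\<beta>: "T (\<lambda>x. \<beta>) = (\<lambda>x u v. (\<alpha> * cnj \<alpha>) * \<beta> u v)"
  proof -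
    have "ell (A *v u) = \<alpha> * ell u" for u unfolding ell_def by (rule ev)
    then show ?thesis unfolding T_def \<beta>_def by (intro ext) (simp add: algebra_simps)
  qed
  have cl: "closed_form2 L (\<lambda>x. \<beta>)"
    unfolding closed_form2_def smooth_form2_def
  proof (intro conjI allI ballI)
    show "\<beta> u u = 0" for u by (simp add: \<beta>_def)
    show "Ck k (\<lambda>x. \<beta> u v)" for k u v by (rule Ck_const)
    show "ext_deriv2 (\<lambda>x. \<beta>) x u v w = 0" for x u v w
      by (simp add: ext_deriv2_def frechet_derivative_const)
  qed (rule bil refl)+
  have t11: "type11 (\<lambda>x. \<beta>)"
    unfolding type11_def
  proof (intro exI[of _ "\<lambda>x j k. w $ j * cnj (w $ k)"] allI)
    fix u v :: "complex^'n"
    have prod: "ell u * cnj (ell v) = (\<Sum>j\<in>UNIV. \<Sum>k\<in>UNIV. (w $ j * u $ j) * (cnj (w $ k) * cnj (v $ k)))" for u v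
      unfolding ell_def cnj_sum complex_cnj_mult by (rule sum_product)
    show "\<beta> u v = (\<Sum>j\<in>UNIV. \<Sum>k\<in>UNIV. w $ j * cnj (w $ k) * (u $ j * cnj (v $ k) - v $ j * cnj (u $ k)))"
      unfolding \<beta>_def prod by (simp add: sum_subtractf[symmetric] algebra_simps)
  qed
  have ne: "coh_class L (\<lambda>x. \<beta>) \<noteq> coh_class L (\<lambda>x u v. 0)"
  proof
    assume "coh_class L (\<lambda>x. \<beta>) = coh_class L (\<lambda>x u v. 0)"
    then have "(\<lambda>x. \<beta>) \<in> coh_class L (\<lambda>x u v. 0)" using coh_class_self[OF cl] by (simp only:)
    from coh_classD[OF this] have "exact_form2 L (\<lambda>x. \<beta>)" by simp
    note zero = const_exact_form2_eq_0[OF lat bil this]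
    obtain j where j: "w $ j \<noteq> 0" using w by (metis vec_eq_iff zero_index)
    define u :: "complex^'n" where "u = axis j 1"
    have c: "ell (c *s u) = c * w $ j" for c
    proof -
      have "ell (c *s u) = (\<Sum>k\<in>UNIV. if k = j then c * w $ j else 0)"
        unfolding ell_def u_def by (intro sum.cong) (simp_all add: axis_def)
      then show ?thesis by simp
    qed
    \<comment> \<open>The form vanishes on pairs of real multiples of \<open>u\<close>; on
      \<open>u\<close> and \<i> times \<open>u\<close> it is \<open>-2 * \<i>\<close> times the
      squared modulus of \<open>w $ j\<close>.\<close>
    have "\<beta> (1 *s u) (\<i> *s u) = 0" by (rule zero)
    then have "w $ j * cnj (w $ j) = 0"
      unfolding \<beta>_def c by (simp add: algebra_simps)
    then show False using j by simp
  qed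
  have "H11_pullback L f (coh_class L (\<lambda>x. \<beta>)) = coh_class L (T (\<lambda>x. \<beta>))"
    unfolding H11_pullback_def pb
  proof (rule induced_coh_class[OF cl])
    fix \<zeta> assume "exact_form2 L (\<lambda>x u v. \<zeta> x u v - \<beta> u v)"
    from exact_form2_pullback[OF AL this, where b = b']
    show "exact_form2 L (\<lambda>x u v. T \<zeta> x u v - T (\<lambda>x. \<beta>) x u v)" unfolding T_def .
  qed
  moreover have "H11_scale L (\<alpha> * cnj \<alpha>) (coh_class L (\<lambda>x. \<beta>)) = coh_class L (\<lambda>x u v. (\<alpha> * cnj \<alpha>) * \<beta> u v)"
    unfolding H11_scale_def
  proof (rule induced_coh_class[OF cl])
    fix \<zeta> assume "exact_form2 L (\<lambda>x u v. \<zeta> x u v - \<beta> u v)"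
    from exact_form2_combine[OF exact_form2_zero this, of "\<alpha> * cnj \<alpha>"]
    show "exact_form2 L (\<lambda>x u v. (\<alpha> * cnj \<alpha>) * \<zeta> x u v - (\<alpha> * cnj \<alpha>) * \<beta> u v)"
      by (simp only: add_0_left right_diff_distrib)
  qed
  ultimately have "H11_pullback L f (coh_class L (\<lambda>x. \<beta>)) = H11_scale L (\<alpha> * cnj \<alpha>) (coh_class L (\<lambda>x. \<beta>))"
    unfolding T\<beta> by (simp only:)
  moreover have "coh_class L (\<lambda>x. \<beta>) \<in> H11 L"
    unfolding H11_def by (intro imageI CollectI conjI cl t11)
  ultimately show ?thesis
    unfolding H11_eigenvalue_def using ne by (intro bexI[of _ "coh_class L (\<lambda>x. \<beta>)"] conjI)
qed

section \<open>Salem numbers\<close>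

lemma of_rat_poly_pcompose:
  "poly (map_poly of_rat (pcompose p q)) (x :: complex) = poly (map_poly of_rat p) (poly (map_poly of_rat q) x)"
  by (simp add: poly_pcompose hom_distribs)

lemma of_rat_poly_pderiv:
  "map_poly of_rat (pderiv (map_poly rat_of_int P)) = pderiv (map_poly complex_of_int P)"
  by (intro poly_eqI) (simp add: coeff_map_poly coeff_pderiv of_rat_mult of_rat_add)

text \<open>What an eigenvalue \<open>x\<close> on C^n contributes to the characteristic polynomial
  on the lattice.\<close>

definition "conj_quad x = [:- x, 1:] * [:- cnj x, 1:]"

text \<open>It lets the derivative, which has rational coefficients when \<open>Q\<close> has,
  detect multiple roots.\<close>

lemma poly_pderiv_linear_factor:
  fixes x :: complex
  assumes "Q = [:- x, 1:] * R"
  shows "poly (pderiv Q) x = poly R x"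
  unfolding assms pderiv_mult by (simp add: pderiv_pCons)

text \<open>Here \<open>a\<close>, \<open>b\<close>, \<open>c\<close> are the moduli of the three
  eigenvalues and \<open>w\<close> is the modulus of a partner of the smallest one. The three values
  allowed for \<open>c * w\<close> are the possible moduli of conjugates of the Salem number, the
  square of \<open>a\<close>. In all cases compatible with the product 1 it follows that
  \<open>a * c = 1\<close>.\<close>

lemma salem_moduli:
  fixes a b c :: real
  assumes abc: "a * b * c = 1" "a \<ge> b" "b \<ge> c" "c > 0" and a: "a > 1"
    and w: "w = a \<or> w = b \<or> w = c" and cw: "c * w = a\<^sup>2 \<or> c * w = 1 / a\<^sup>2 \<or> c * w = 1"
  shows "b = 1 \<and> c = 1 / a"
proof -
  have c1: "c < 1"
  proof (rule ccontr)
    assume "\<not> c < 1"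
    then have "1 \<le> b * c" using abc mult_mono[of 1 b 1 c] by simp
    then have "a * 1 \<le> a * (b * c)" using a by (intro mult_left_mono) simp_all
    moreover have "a * (b * c) = 1" using abc(1) by (simp add: mult.assoc)
    ultimately show False using a by linarith
  qed
  have b0: "b > 0" using abc by simp
  have wa: "w \<le> a" and w0: "w > 0" using w abc b0 a by auto
  have "c * w < a * a"
  proof -
    have "c * w < 1 * w" using c1 w0 by (intro mult_strict_right_mono)
    also have "\<dots> \<le> a * a" using wa a mult_mono[of 1 a w a] w0 by simp
    finally show ?thesis .
  qed
  then have "c * w = 1 / a\<^sup>2 \<or> c * w = 1"
    using cw by (auto simp: power2_eq_square)
  then consider (1) "c * w = 1" | (2) "c * w * (a * a) = 1"
    using a by (auto simp: power2_eq_square field_simps)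
  then have "a * c = 1"
  proof cases
    case 1
    have "w > 1"
    proof (rule ccontr)
      assume "\<not> w > 1"
      then have "c * w \<le> c * 1" using abc by (intro mult_left_mono) simp_all
      then show False using 1 c1 by simp
    qed
    from w show ?thesis
    proof (elim disjE)
      assume "w = a" then show ?thesis using 1 by (simp add: mult.commute)
    next
      assume "w = b"
      then have "a = 1" using 1 abc(1) by (metis mult.commute mult.left_commute mult.right_neutral)
      then show ?thesis using a by simp
    next
      assume "w = c" then show ?thesis using \<open>w > 1\<close> c1 by simp
    qed
  next
    case 2
    from w show ?thesis
    proof (elim disjE)
      assume wa: "w = a"
      have "c * (a * a * a) = c * (a * b)"
        using 2 abc(1) unfolding wa by (simp add: mult_ac)
      then have "a * (a * a) = a * b" using abc by simp
      then have "a * a = b" using a by simp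
      moreover have "a * 1 < a * a" using a by (intro mult_strict_left_mono) simp_all
      ultimately show ?thesis using abc by simp
    next
      assume wb: "w = b"
      have "(a * b * c) * a = 1" using 2 unfolding wb by (simp add: mult_ac)
      then show ?thesis using abc a by simp
    next
      assume wc: "w = c"
      have "(a * c) * (a * c) = 1" using 2 unfolding wc by (simp add: mult_ac)
      then have "(a * c)\<^sup>2 = 1" by (simp add: power2_eq_square)
      then have "a * c = 1 \<or> a * c = - 1" by (simp only: power2_eq_1_iff)
      moreover have "a * c > 0" using a abc by simp
      ultimately show ?thesis by linarith
    qed
  qed
  moreover from this have "b = 1"
    using abc(1) by (metis mult.assoc mult.commute mult.right_neutral)
  ultimately show ?thesis
    using a by (simp add: field_simps)
qed

text \<open>The arithmetic information that survives in the second case of the proof, stated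
  symmetrically in the eigenvalues so that they can be ordered by modulus. The third clause says
  that they have the same rational annihilators; the last one evaluates \<open>D\<close> through all
  six roots of \<open>P\<close>.\<close>

definition galois_data :: "int poly \<Rightarrow> rat poly \<Rightarrow> rat poly \<Rightarrow> complex \<Rightarrow> complex \<Rightarrow> complex \<Rightarrow> bool" where
  "galois_data P m D x y z \<longleftrightarrow>
     map_poly of_int P = conj_quad x * conj_quad y * conj_quad z \<and>
     cmod x * cmod y * cmod z = 1 \<and>
     (\<forall>u\<in>{x, y, z}. \<forall>v\<in>{x, y, z}. \<forall>q :: rat poly.
        poly (map_poly of_rat q) u = 0 \<longrightarrow> poly (map_poly of_rat q) v = 0) \<and>
     (\<forall>t. poly (map_poly of_rat D) t =
        (\<Prod>w\<leftarrow>[x, y, z]. poly (map_poly of_rat m) (t * w) * poly (map_poly of_rat m) (t * cnj w)))"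

lemma galois_data_swap:
  assumes "galois_data P m D x y z"
  shows "galois_data P m D y x z" "galois_data P m D x z y"
proof -
  have set: "{y, x, z} = {x, y, z}" "{x, z, y} = {x, y, z}" by blast+
  have quad: "conj_quad y * conj_quad x * conj_quad z = conj_quad x * conj_quad y * conj_quad z"
    "conj_quad x * conj_quad z * conj_quad y = conj_quad x * conj_quad y * conj_quad z"
    by (simp_all only: mult_ac)
  have norm: "cmod y * cmod x * cmod z = cmod x * cmod y * cmod z"
    "cmod x * cmod z * cmod y = cmod x * cmod y * cmod z"
    by (simp_all only: mult_ac)
  have list: "(\<Prod>w\<leftarrow>[y, x, z]. F w) = (\<Prod>w\<leftarrow>[x, y, z]. F w)"
    "(\<Prod>w\<leftarrow>[x, z, y]. F w) = (\<Prod>w\<leftarrow>[x, y, z]. F w)" for F :: "complex \<Rightarrow> complex"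
    by (simp_all add: mult_ac)
  show "galois_data P m D y x z"
    using assms unfolding galois_data_def set(1) quad(1) norm(1) list(1) .
  show "galois_data P m D x z y"
    using assms unfolding galois_data_def set(2) quad(2) norm(2) list(2) .
qed

text \<open>A rational polynomial vanishes at all of \<open>x, y, z\<close> or at none. By \<open>D\<close>, each of them has a
  partner among \<open>x, y, z\<close> and their conjugates such that the product is conjugate to \<open>l\<close>. The moduli
  then force \<open>\<bar>y\<bar> = 1\<close>, and \<open>y\<close> can only be its own partner; so \<open>m\<close> vanishes at \<open>x\<^sup>2\<close>, and \<open>x\<close> is
  real. It is thus a double root of \<open>P\<close>, while \<open>y\<close> is a simple one.\<close>

lemma galois_data_ordered_contradiction:
  assumes gd: "galois_data P m D x y z" and ord: "cmod x \<ge> cmod y" "cmod y \<ge> cmod z"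
    and l: "l = (cmod x)\<^sup>2" "l > 1"
    and m: "poly (map_poly of_rat m) (complex_of_real l) = 0" "poly (map_poly of_rat m) (1 :: complex) \<noteq> 0"
    and salem: "\<And>w :: complex. poly (map_poly of_rat m) w = 0 \<Longrightarrow> w \<noteq> of_real l \<Longrightarrow> w \<noteq> of_real (1 / l) \<Longrightarrow> cmod w = 1"
  shows False
proof -
  let ?m = "map_poly of_rat m :: complex poly"
  have P: "map_poly of_int P = conj_quad x * conj_quad y * conj_quad z"
    and norm1: "cmod x * cmod y * cmod z = 1"
    and tr: "\<And>u v q. u \<in> {x, y, z} \<Longrightarrow> v \<in> {x, y, z} \<Longrightarrow> poly (map_poly of_rat q) u = 0 \<Longrightarrow> poly (map_poly of_rat q) v = 0"
    and D: "\<And>t. poly (map_poly of_rat D) t =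
        (\<Prod>w\<leftarrow>[x, y, z]. poly ?m (t * w) * poly ?m (t * cnj w))"
    using gd unfolding galois_data_def by blast+
  define a where "a = cmod x"
  have a: "a > 1"
  proof (rule ccontr)
    assume "\<not> a > 1"
    then have "a * a \<le> 1 * 1" by (intro mult_mono) (simp_all add: a_def)
    then show False using l by (simp add: a_def power2_eq_square)
  qed
  have x0: "x \<noteq> 0" using a by (auto simp: a_def)
  have z0: "cmod z > 0" using norm1 by (metis mult_zero_right norm_eq_zero zero_less_norm_iff zero_neq_one)
  have mod: "cmod w = a\<^sup>2 \<or> cmod w = 1 / a\<^sup>2 \<or> cmod w = 1" if "poly ?m w = 0" for w
  proof -
    have "w = of_real l \<or> w = of_real (1 / l) \<or> cmod w = 1" using salem[OF that] by blast
    then show ?thesis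
    proof (elim disjE)
      assume "w = of_real l" then show ?thesis using l by (simp add: a_def norm_power)
    next
      assume "w = of_real (1 / l)"
      then have "cmod w = \<bar>1 / l\<bar>" by (simp only: norm_of_real)
      then show ?thesis using l by (simp add: a_def)
    qed simp
  qed
  \<comment> \<open>The partner of \<open>x\<close> is its own conjugate, because
    \<open>x * cnj x\<close> is \<open>l\<close>. Hence \<open>D\<close> vanishes at
    \<open>x\<close>, and the transfer of rational roots gives partners to \<open>y\<close> and
    \<open>z\<close>.\<close>
  have partner: "\<exists>w\<in>{x, y, z}. poly ?m (u * w) = 0 \<or> poly ?m (u * cnj w) = 0" if u: "u \<in> {x, y, z}" for u
  proof -
    have "x * cnj x = of_real l" unfolding l by (rule complex_norm_square[symmetric])
    then have "poly ?m (x * cnj x) = 0" using m(1) by simp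
    then have "poly (map_poly of_rat D) x = 0" unfolding D by simp
    then have "poly (map_poly of_rat D) u = 0" using u by (intro tr[of x u D]) simp_all
    then show ?thesis unfolding D by (simp add: disj_assoc)
  qed
  obtain w where "w \<in> {x, y, z}" "poly ?m (z * w) = 0 \<or> poly ?m (z * cnj w) = 0"
    using partner[of z] by blast
  moreover from this have "cmod z * cmod w = a\<^sup>2 \<or> cmod z * cmod w = 1 / a\<^sup>2 \<or> cmod z * cmod w = 1"
    using mod[of "z * w"] mod[of "z * cnj w"] by (auto simp: norm_mult)
  ultimately have bc: "cmod y = 1 \<and> cmod z = 1 / a"
    using norm1 ord z0 a by (intro salem_moduli[where w = "cmod w"]) (auto simp: a_def)
  have yy: "y * cnj y = 1"
    using complex_norm_square[of y] bc by simp
  have "poly ?m (y * y) = 0"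
  proof -
    obtain w where w: "w \<in> {x, y, z}" "poly ?m (y * w) = 0 \<or> poly ?m (y * cnj w) = 0"
      using partner[of y] by blast
    then have "cmod y * cmod w = a\<^sup>2 \<or> cmod y * cmod w = 1 / a\<^sup>2 \<or> cmod y * cmod w = 1"
      using mod[of "y * w"] mod[of "y * cnj w"] by (auto simp: norm_mult)
    then have cw: "cmod w = a\<^sup>2 \<or> cmod w = 1 / a\<^sup>2 \<or> cmod w = 1"
      using bc by simp
    have "w \<noteq> x"
    proof
      assume "w = x"
      then have "a = a\<^sup>2 \<or> a = 1 / a\<^sup>2 \<or> a = 1" using cw by (simp add: a_def)
      moreover have "a < a\<^sup>2" using a by (simp add: power2_eq_square)
      moreover have "1 / a\<^sup>2 < 1" using \<open>a < a\<^sup>2\<close> a by simp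
      ultimately show False using a by linarith
    qed
    moreover have "w \<noteq> z"
    proof
      assume "w = z"
      then have "1 / a = a\<^sup>2 \<or> 1 / a = 1 / a\<^sup>2 \<or> 1 / a = 1" using cw bc by simp
      moreover have "1 / a < 1" using a by simp
      moreover have "1 < a\<^sup>2" "1 / a\<^sup>2 < 1 / a" using a by (simp_all add: power2_eq_square field_simps less_1_mult)
      ultimately show False by linarith
    qed
    ultimately have "w = y" using w(1) by blast
    \<comment> \<open>The partner of \<open>y\<close> cannot be its conjugate:
      \<open>y * cnj y\<close> is 1, which is not a root of \<open>m\<close>.\<close>
    then show ?thesis using w(2) yy m(2) by auto
  qed
  \<comment> \<open>Composition with the square turns a root \<open>y * y\<close> of
    \<open>m\<close> into a root \<open>y\<close> of a rational polynomial, to which the transfer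
    from \<open>y\<close> to \<open>x\<close> applies.\<close>
  then have "poly (map_poly of_rat (pcompose m [:0, 0, 1:])) y = 0"
    unfolding of_rat_poly_pcompose by (simp add: map_poly_pCons)
  then have "poly (map_poly of_rat (pcompose m [:0, 0, 1:])) x = 0"
    by (intro tr[of y x]) simp_all
  then have "poly ?m (x * x) = 0"
    unfolding of_rat_poly_pcompose by (simp add: map_poly_pCons)
  have "x * x = of_real l"
  proof (rule ccontr)
    assume ne: "x * x \<noteq> of_real l"
    have n: "cmod (x * x) = l" using l by (simp add: norm_mult power2_eq_square)
    have "x * x \<noteq> of_real (1 / l)"
    proof
      assume "x * x = of_real (1 / l)"
      then have "l = \<bar>1 / l\<bar>" using n by (metis norm_of_real)
      then have "l * l = 1" using l(2) by (simp add: field_simps)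
      then show False using l(2) less_1_mult[of l l] by simp
    qed
    then have "cmod (x * x) = 1" using salem[OF \<open>poly ?m (x * x) = 0\<close> ne] by blast
    then show False using n l(2) by simp
  qed
  then have "x * x = x * cnj x" unfolding l by (simp only: complex_norm_square)
  then have xreal: "cnj x = x" using x0 by simp
  let ?P' = "pderiv (map_poly of_int P) :: complex poly"
  have "poly ?P' x = poly ([:- x, 1:] * (conj_quad y * conj_quad z)) x"
    by (rule poly_pderiv_linear_factor) (simp only: P conj_quad_def xreal mult_ac)
  then have "poly (map_poly of_rat (pderiv (map_poly rat_of_int P))) x = 0"
    unfolding of_rat_poly_pderiv by simp
  then have "poly (map_poly of_rat (pderiv (map_poly rat_of_int P))) y = 0"
    by (intro tr[of x y]) simp_all
  then have "poly ?P' y = 0" unfolding of_rat_poly_pderiv .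
  moreover have "poly ?P' y = poly ([:- cnj y, 1:] * (conj_quad x * conj_quad z)) y"
    by (rule poly_pderiv_linear_factor) (simp only: P conj_quad_def mult_ac)
  moreover have "poly [:- c, 1:] t = t - c" for c t :: complex by simp
  ultimately have "(y - cnj y) * ((y - x) * (y - cnj x) * ((y - z) * (y - cnj z))) = 0"
    by (simp only: conj_quad_def poly_mult)
  \<comment> \<open>The other roots have modulus \<open>a\<close> or \<open>1 / a\<close>, different
    from 1, so only \<open>y = cnj y\<close> could make \<open>y\<close> a double root; then
    \<open>y * y\<close> would be 1, which is not a root of \<open>m\<close>.\<close>
  then have "y = cnj y \<or> y = x \<or> y = cnj x \<or> y = z \<or> y = cnj z" by simp
  moreover have "y \<noteq> cnj y"
  proof
    assume "y = cnj y"
    then have "y * y = 1" using yy by simp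
    then show False using \<open>poly ?m (y * y) = 0\<close> m(2) by simp
  qed
  moreover have "1 / a < 1" using a by simp
  then have "cmod z < cmod y" using bc by metis
  moreover have "cmod y < cmod x" using bc a by (simp add: a_def)
  ultimately show False by (metis complex_mod_cnj less_irrefl)
qed

text \<open>The two transpositions of \<open>galois_data_swap\<close> generate all orders, so the
  moduli may be assumed to be descending.\<close>

theorem galois_data_salem_contradiction:
  assumes gd: "galois_data P m D x y z"
    and l: "l = (Max {cmod x, cmod y, cmod z})\<^sup>2" "l > 1"
    and m: "poly (map_poly of_rat m) (complex_of_real l) = 0" "poly (map_poly of_rat m) (1 :: complex) \<noteq> 0"
    and salem: "\<And>w :: complex. poly (map_poly of_rat m) w = 0 \<Longrightarrow> w \<noteq> of_real l \<Longrightarrow> w \<noteq> of_real (1 / l) \<Longrightarrow> cmod w = 1"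
  shows False
proof -
  have ordered: False if "galois_data P m D u v w" "cmod u \<ge> cmod v" "cmod v \<ge> cmod w"
    "{cmod x, cmod y, cmod z} = {cmod u, cmod v, cmod w}" for u v w
  proof -
    have "Max {cmod x, cmod y, cmod z} = cmod u"
      unfolding that(4) using that(2,3) by (intro Max_eqI) auto
    then show False
      using galois_data_ordered_contradiction[OF that(1-3) _ l(2) m salem] l(1) by simp
  qed
  note swap = galois_data_swap
  have 1: "galois_data P m D y x z" and 2: "galois_data P m D x z y" using swap[OF gd] by blast+
  have 3: "galois_data P m D y z x" using swap(2)[OF 1] .
  have 4: "galois_data P m D z x y" using swap(1)[OF 2] .
  have 5: "galois_data P m D z y x" using swap(2)[OF 4] .
  consider "cmod x \<ge> cmod y \<and> cmod y \<ge> cmod z" | "cmod y \<ge> cmod x \<and> cmod x \<ge> cmod z"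
    | "cmod x \<ge> cmod z \<and> cmod z \<ge> cmod y" | "cmod y \<ge> cmod z \<and> cmod z \<ge> cmod x"
    | "cmod z \<ge> cmod x \<and> cmod x \<ge> cmod y" | "cmod z \<ge> cmod y \<and> cmod y \<ge> cmod x"
    by linarith
  then show False
    by cases (use ordered[OF gd] ordered[OF 1] ordered[OF 2] ordered[OF 3] ordered[OF 4] ordered[OF 5]
      in \<open>auto simp: insert_commute\<close>)
qed

text \<open>An irreducible polynomial with root 1 is a scalar multiple of the linear polynomial at
  1, which has no root greater than 1.\<close>

lemma salem_number_min_poly:
  assumes "salem_number l"
  obtains m :: "rat poly" where "poly (map_poly of_rat m) (complex_of_real l) = 0"
    "poly (map_poly of_rat m) (1 :: complex) \<noteq> 0"
    "\<And>w :: complex. poly (map_poly of_rat m) w = 0 \<Longrightarrow> w \<noteq> of_real l \<Longrightarrow> w \<noteq> of_real (1 / l) \<Longrightarrow> cmod w = 1"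
proof -
  have l: "l > 1" and "galois_conjugate (of_real l) (of_real (1 / l))"
    and conj: "\<And>z. galois_conjugate (of_real l) z \<Longrightarrow> z \<noteq> of_real l \<Longrightarrow> z \<noteq> of_real (1 / l) \<Longrightarrow> cmod z = 1"
    using assms unfolding salem_number_def by blast+
  then obtain m :: "rat poly" where m: "irreducible m" "poly (map_poly of_rat m) (complex_of_real l) = 0"
    unfolding galois_conjugate_def by blast
  have "poly (map_poly of_rat m) (1 :: complex) \<noteq> 0"
  proof
    assume "poly (map_poly of_rat m) (1 :: complex) = 0"
    then have "of_rat (poly m 1) = (0 :: complex)"
      by (metis of_rat_1 of_rat_hom.poly_map_poly)
    then have "poly m 1 = 0" by simp
    then have "[:-1, 1:] dvd m" by (simp add: poly_eq_0_iff_dvd)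
    then obtain k where k: "m = [:-1, 1:] * k" by (elim dvdE)
    have "\<not> is_unit [:-1, 1 :: rat:]" by (simp add: is_unit_iff_degree)
    then have "is_unit k" using m(1) k irreducibleD by blast
    moreover have "k \<noteq> 0" using m(1) k by auto
    ultimately have "degree k = 0" by (simp add: is_unit_iff_degree)
    then obtain c where "k = [:c:]" by (rule degree_eq_zeroE)
    with \<open>k \<noteq> 0\<close> have c: "k = [:c:]" "c \<noteq> 0" by simp_all
    have "poly (map_poly of_rat m) (complex_of_real l) = (of_real l - 1) * of_rat c"
      unfolding k c by (simp add: of_rat_hom.map_poly_pCons_hom of_rat_minus algebra_simps)
    then have "complex_of_real l = 1" using m(2) c by simp
    then show False using l by simp
  qed
  moreover have "cmod w = 1" if "poly (map_poly of_rat m) w = 0" "w \<noteq> of_real l" "w \<noteq> of_real (1 / l)" for w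
  proof (rule conj)
    show "galois_conjugate (of_real l) w"
      unfolding galois_conjugate_def using m that(1) by blast
  qed (use that in simp_all)
  ultimately show thesis using m(2) by (intro that)
qed

section \<open>Polynomials in a matrix\<close>

text \<open>Coefficients from an arbitrary commutative ring, one per exponent below the last
  argument, allow evaluation over polynomials in t with the k-th coefficient multiplied by the k-th
  power of t.\<close>

primrec matrix_poly :: "(nat \<Rightarrow> 'a) \<Rightarrow> 'a::comm_ring_1 Matrix.mat \<Rightarrow> nat \<Rightarrow> 'a Matrix.mat" where
  "matrix_poly f A 0 = 0\<^sub>m (dim_row A) (dim_row A)"
| "matrix_poly f A (Suc k) = matrix_poly f A k + f k \<cdot>\<^sub>m (A ^\<^sub>m k)"

lemma matrix_poly_carrier: "A \<in> carrier_mat n n \<Longrightarrow> matrix_poly f A k \<in> carrier_mat n n"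
proof (induction k)
  case (Suc k)
  then show ?case by (simp add: pow_carrier_mat)
qed auto

lemma (in comm_ring_hom) matrix_poly_hom:
  assumes "A \<in> carrier_mat n n"
  shows "map_mat hom (matrix_poly f A k) = matrix_poly (\<lambda>i. hom (f i)) (map_mat hom A) k"
proof (induction k)
  case 0
  then show ?case using assms by (intro eq_matI) auto
next
  case (Suc k)
  have "map_mat hom (matrix_poly f A k + f k \<cdot>\<^sub>m (A ^\<^sub>m k))
      = map_mat hom (matrix_poly f A k) + hom (f k) \<cdot>\<^sub>m map_mat hom (A ^\<^sub>m k)"
    by (intro eq_matI) (simp_all add: carrier_matD[OF matrix_poly_carrier[OF assms]]
        carrier_matD[OF pow_carrier_mat[OF assms]] carrier_matD[OF assms] hom_add hom_mult split: if_splits)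
  then show ?case using Suc by (simp add: mat_hom_pow[OF assms])
qed

lemma matrix_poly_similar:
  assumes A: "A \<in> carrier_mat n n" and sim: "similar_mat_wit A B P Q"
  shows "matrix_poly f A k = P * matrix_poly f B k * Q"
proof (induction k)
  note s = similar_mat_witD2[OF A sim]
  case 0
  then show ?case using s by simp
next
  case (Suc k)
  note s = similar_mat_witD2[OF A sim]
  note c = matrix_poly_carrier[OF s(5), of f k] pow_carrier_mat[OF s(5), of k]
  have "P * (matrix_poly f B k + f k \<cdot>\<^sub>m (B ^\<^sub>m k)) * Q
      = P * matrix_poly f B k * Q + P * (f k \<cdot>\<^sub>m (B ^\<^sub>m k)) * Q"
    using s c by (simp add: mult_add_distrib_mat[of _ n n _ n] add_mult_distrib_mat[of _ n n _ _ n])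
  also have "P * (f k \<cdot>\<^sub>m (B ^\<^sub>m k)) = f k \<cdot>\<^sub>m (P * (B ^\<^sub>m k))"
    by (rule mult_smult_distrib[OF s(6) c(2)])
  also have "f k \<cdot>\<^sub>m (P * (B ^\<^sub>m k)) * Q = f k \<cdot>\<^sub>m (P * (B ^\<^sub>m k) * Q)"
    by (rule mult_smult_assoc_mat[OF mult_carrier_mat[OF s(6) c(2)] s(7)])
  also have "P * (B ^\<^sub>m k) * Q = A ^\<^sub>m k"
    by (rule similar_mat_wit_pow_id[OF sim, symmetric])
  finally show ?case using Suc by simp
qed

lemma upper_triangular_mult_aux:
  fixes B C :: "'a::comm_ring_1 Matrix.mat"
  assumes c: "B \<in> carrier_mat n n" "C \<in> carrier_mat n n" and ut: "upper_triangular B" "upper_triangular C"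
  shows "upper_triangular (B * C)" "i < n \<Longrightarrow> (B * C) $$ (i, i) = B $$ (i, i) * C $$ (i, i)"
proof -
  have e: "(B * C) $$ (i, j) = (\<Sum>k\<in>{0..<n}. B $$ (i, k) * C $$ (k, j))" if "i < n" "j < n" for i j
    using that c by (simp add: scalar_prod_def)
  have z: "B $$ (i, j) = 0" "C $$ (i, j) = 0" if "j < i" "i < n" for i j
    using that ut c by (simp_all add: upper_triangularD)
  show "upper_triangular (B * C)"
  proof (rule upper_triangularI)
    fix i j assume ij: "j < i" "i < dim_row (B * C)"
    then have i: "i < n" using c by simp
    have "B $$ (i, k) * C $$ (k, j) = 0" if "k < n" for k
      using z(1)[of k i] z(2)[of j k] that i ij(1) by (cases "k < i") auto
    then have "(\<Sum>k\<in>{0..<n}. B $$ (i, k) * C $$ (k, j)) = 0"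
      by (intro sum.neutral) simp
    then show "(B * C) $$ (i, j) = 0" using e i ij(1) by simp
  qed
  assume i: "i < n"
  have "B $$ (i, k) * C $$ (k, i) = (if k = i then B $$ (i, i) * C $$ (i, i) else 0)" if "k \<in> {0..<n}" for k
    using z(1)[of k i] z(2)[of i k] that i by (cases k i rule: linorder_cases) auto
  then have "(\<Sum>k\<in>{0..<n}. B $$ (i, k) * C $$ (k, i)) = (\<Sum>k\<in>{0..<n}. if k = i then B $$ (i, i) * C $$ (i, i) else 0)"
    by (intro sum.cong refl)
  then show "(B * C) $$ (i, i) = B $$ (i, i) * C $$ (i, i)" using e[OF i i] i by simp
qed

lemma upper_triangular_pow:
  fixes B :: "'a::comm_ring_1 Matrix.mat"
  assumes B: "B \<in> carrier_mat n n" "upper_triangular B"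
  shows "upper_triangular (B ^\<^sub>m k) \<and> (\<forall>i<n. (B ^\<^sub>m k) $$ (i, i) = B $$ (i, i) ^ k)"
proof (induction k)
  case 0
  then show ?case using B by (auto intro!: upper_triangularI)
next
  case (Suc k)
  note m = upper_triangular_mult_aux[OF pow_carrier_mat[OF B(1)] B(1) conjunct1[OF Suc] B(2)]
  show ?case using m Suc by (simp add: mult.commute)
qed

lemma upper_triangular_matrix_poly:
  fixes B :: "'a::comm_ring_1 Matrix.mat"
  assumes B: "B \<in> carrier_mat n n" "upper_triangular B"
  shows "upper_triangular (matrix_poly f B k) \<and> (\<forall>i<n. matrix_poly f B k $$ (i, i) = (\<Sum>j<k. f j * B $$ (i, i) ^ j))"
proof (induction k)
  case 0
  then show ?case using B by (auto intro!: upper_triangularI)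
next
  case (Suc k)
  note c = matrix_poly_carrier[OF B(1), of f k] pow_carrier_mat[OF B(1), of k]
  note p = upper_triangular_pow[OF B, of k]
  have "upper_triangular (matrix_poly f B k + f k \<cdot>\<^sub>m (B ^\<^sub>m k))"
  proof (rule upper_triangularI)
    fix i j assume "j < i" "i < dim_row (matrix_poly f B k + f k \<cdot>\<^sub>m (B ^\<^sub>m k))"
    then show "(matrix_poly f B k + f k \<cdot>\<^sub>m (B ^\<^sub>m k)) $$ (i, j) = 0"
      using c B(1) upper_triangularD[OF conjunct1[OF Suc], of j i] upper_triangularD[OF conjunct1[OF p], of j i]
      by simp
  qed
  then show ?case using Suc p c B(1) by simp
qed

section \<open>Eigenvalues read off triangular forms\<close>

lemma triangularize:
  fixes A :: "complex Matrix.mat"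
  assumes A: "A \<in> carrier_mat n n" and cp: "char_poly A = (\<Prod>e\<leftarrow>es. [:- e, 1:])"
  obtains B P Q where "similar_mat_wit A B P Q" "upper_triangular B" "Matrix.diag_mat B = es"
proof -
  obtain B P Q where "schur_decomposition A es = (B, P, Q)" by (metis prod_cases3)
  from schur_decomposition[OF A cp this] show thesis by (elim conjE) (rule that)
qed

lemma det_matrix_poly:
  fixes A :: "complex Matrix.mat"
  assumes A: "A \<in> carrier_mat n n" and cp: "char_poly A = (\<Prod>e\<leftarrow>es. [:- e, 1:])"
  shows "Determinant.det (matrix_poly f A k) = (\<Prod>e\<leftarrow>es. \<Sum>j<k. f j * e ^ j)"
proof -
  obtain B P Q where B: "similar_mat_wit A B P Q" "upper_triangular B" "Matrix.diag_mat B = es"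
    using triangularize[OF A cp] .
  note s = similar_mat_witD2[OF A B(1)]
  have "similar_mat (matrix_poly f A k) (matrix_poly f B k)"
    by (rule similar_matI[of _ _ P Q n])
      (use s matrix_poly_carrier[OF A] matrix_poly_carrier[OF s(5)] matrix_poly_similar[OF A B(1)] in auto)
  then have "Determinant.det (matrix_poly f A k) = Determinant.det (matrix_poly f B k)"
    by (rule det_similar)
  also have "\<dots> = prod_list (Matrix.diag_mat (matrix_poly f B k))"
    by (rule det_upper_triangular[OF conjunct1[OF upper_triangular_matrix_poly[OF s(5) B(2)]] matrix_poly_carrier[OF s(5)]])
  also have "Matrix.diag_mat (matrix_poly f B k) = map (\<lambda>e. \<Sum>j<k. f j * e ^ j) es"
    using upper_triangular_matrix_poly[OF s(5) B(2), of f k] matrix_poly_carrier[OF s(5), of f k] s(5)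
    unfolding B(3)[symmetric] diag_mat_def by (simp add: o_def)
  finally show ?thesis .
qed

text \<open>\<open>D\<close> is the determinant of m(t M) over the rational polynomials in t.
  Evaluation at a complex number is a ring homomorphism, so it commutes with the determinant, and
  triangularisation then shows the product over the eigenvalues.\<close>

lemma rational_poly_det:
  fixes M :: "int Matrix.mat" and m :: "rat poly"
  assumes M: "M \<in> carrier_mat n n" and cp: "char_poly (map_mat complex_of_int M) = (\<Prod>e\<leftarrow>es. [:- e, 1:])"
  shows "\<exists>D :: rat poly. \<forall>t :: complex. poly (map_poly of_rat D) t = (\<Prod>e\<leftarrow>es. poly (map_poly of_rat m) (t * e))"
proof -
  \<comment> \<open>The length is \<open>Suc (degree m)\<close> because \<open>matrix_poly\<close>
    sums over the exponents strictly below it.\<close>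
  define D where "D = Determinant.det (matrix_poly (\<lambda>k. monom (coeff m k) k) (map_mat (\<lambda>a. [:of_int a:]) M) (Suc (degree m)))"
  have "poly (map_poly of_rat D) t = (\<Prod>e\<leftarrow>es. poly (map_poly of_rat m) (t * e))" for t :: complex
  proof -
    interpret r: map_poly_comm_ring_hom "of_rat :: rat \<Rightarrow> complex" ..
    interpret h: comm_ring_hom "\<lambda>p. poly (map_poly (of_rat :: rat \<Rightarrow> complex) p) t"
      by unfold_locales (simp_all add: r.hom_add r.hom_mult)
    have M': "map_mat (\<lambda>a. [:rat_of_int a:]) M \<in> carrier_mat n n" using M by simp
    have "map_mat (\<lambda>p. poly (map_poly (of_rat :: rat \<Rightarrow> complex) p) t) (map_mat (\<lambda>a. [:rat_of_int a:]) M) = map_mat complex_of_int M"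
    proof (intro eq_matI)
      have "map_poly of_rat [:c:] = [:of_rat c :: complex:]" for c
        by (intro poly_eqI) (simp add: coeff_map_poly coeff_pCons split: nat.split)
      then show "map_mat (\<lambda>p. poly (map_poly (of_rat :: rat \<Rightarrow> complex) p) t) (map_mat (\<lambda>a. [:rat_of_int a:]) M) $$ (i, j)
          = map_mat complex_of_int M $$ (i, j)"
        if "i < dim_row (map_mat complex_of_int M)" "j < dim_col (map_mat complex_of_int M)" for i j
        using that by simp
    qed simp_all
    then have "poly (map_poly of_rat D) t
        = Determinant.det (matrix_poly (\<lambda>k. of_rat (coeff m k) * t ^ k) (map_mat complex_of_int M) (Suc (degree m)))"
      unfolding D_def h.hom_det[symmetric] h.matrix_poly_hom[OF M'] by (simp add: map_poly_monom poly_monom)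
    also have "\<dots> = (\<Prod>e\<leftarrow>es. \<Sum>j<Suc (degree m). of_rat (coeff m j) * t ^ j * e ^ j)"
      by (rule det_matrix_poly[OF _ cp]) (use M in simp)
    also have "\<dots> = (\<Prod>e\<leftarrow>es. poly (map_poly of_rat m) (t * e))"
      by (intro arg_cong[of _ _ prod_list] map_cong refl)
        (simp add: poly_altdef degree_map_poly coeff_map_poly power_mult_distrib lessThan_Suc_atMost mult.assoc del: sum.lessThan_Suc)
    finally show ?thesis .
  qed
  then show ?thesis by blast
qed

text \<open>Choose a non-zero entry of \<open>W\<close> with the smallest index sum
  \<open>i + j\<close>. In the same entry of the product, triangularity of \<open>B\<close> kills
  all contributions with a larger row or column index, and minimality kills the rest, so only a
  multiple of that entry is left.\<close>

lemma triangular_congruence_eigenvalue: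
  fixes M W :: "complex Matrix.mat"
  assumes B: "B \<in> carrier_mat n n" "upper_triangular B" and W: "W \<in> carrier_mat n n" "W \<noteq> 0\<^sub>m n n"
    and eq: "transpose_mat B * W * B = \<mu> \<cdot>\<^sub>m W"
  shows "\<exists>i<n. \<exists>j<n. \<mu> = B $$ (i, i) * B $$ (j, j)"
proof -
  have "\<exists>i j. i < n \<and> j < n \<and> W $$ (i, j) \<noteq> 0"
  proof (rule ccontr)
    assume "\<not> ?thesis"
    then have "W = 0\<^sub>m n n" using W(1) by (intro eq_matI) auto
    then show False using W(2) by simp
  qed
  then have "\<exists>s i j. i < n \<and> j < n \<and> W $$ (i, j) \<noteq> 0 \<and> i + j = s" by blast
  then obtain s where s: "\<exists>i j. i < n \<and> j < n \<and> W $$ (i, j) \<noteq> 0 \<and> i + j = s"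
    and min: "\<And>t. t < s \<Longrightarrow> \<not> (\<exists>i j. i < n \<and> j < n \<and> W $$ (i, j) \<noteq> 0 \<and> i + j = t)"
    using exists_least_iff[of "\<lambda>s. \<exists>i j. i < n \<and> j < n \<and> W $$ (i, j) \<noteq> 0 \<and> i + j = s"] by auto
  from s obtain i j where ij: "i < n" "j < n" "W $$ (i, j) \<noteq> 0" "i + j = s" by blast
  have z: "B $$ (k, l) = 0" if "l < k" "k < n" for k l
    using upper_triangularD[OF B(2) that(1)] that(2) B(1) by simp
  define c where "c = B $$ (i, i) * (W $$ (i, j) * B $$ (j, j))"
  have "(transpose_mat B * W * B) $$ (i, j) = (\<Sum>k\<in>{0..<n}. B $$ (k, i) * (\<Sum>l\<in>{0..<n}. W $$ (k, l) * B $$ (l, j)))"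
    using ij B(1) W(1) by (simp add: scalar_prod_def)
  also have "\<dots> = (\<Sum>k\<in>{0..<n}. \<Sum>l\<in>{0..<n}. if k = i then (if l = j then c else 0) else 0)"
    unfolding sum_distrib_left
  proof (intro sum.cong refl)
    fix l k assume lk: "l \<in> {0..<n}" "k \<in> {0..<n}"
    show "B $$ (k, i) * (W $$ (k, l) * B $$ (l, j)) = (if k = i then (if l = j then c else 0) else 0)"
    proof (cases "k > i \<or> l > j \<or> (k = i \<and> l = j)")
      case True
      then show ?thesis using z[of i k] z[of j l] lk by (auto simp: c_def)
    next
      case False
      then have "k + l < s" using ij(4) by auto
      then have "W $$ (k, l) = 0" using min[of "k + l"] lk by auto
      then show ?thesis using False by auto
    qed
  qed
  also have "\<dots> = (\<Sum>k\<in>{0..<n}. if k = i then c else 0)"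
  proof (intro sum.cong refl)
    fix k show "(\<Sum>l\<in>{0..<n}. if k = i then (if l = j then c else 0) else 0) = (if k = i then c else 0)"
      using ij(2) by (cases "k = i") simp_all
  qed
  also have "\<dots> = c" using ij(1) by simp
  finally have "\<mu> * W $$ (i, j) = (B $$ (i, i) * B $$ (j, j)) * W $$ (i, j)"
    using ij W(1) unfolding eq c_def by (simp add: mult_ac)
  then have "\<mu> = B $$ (i, i) * B $$ (j, j)" using ij(3) by simp
  then show ?thesis using ij by blast
qed

text \<open>A change of basis turns the matrix of a bilinear form into
  \<open>transpose_mat P * W * P\<close>, so the Schur form of \<open>M\<close> reduces the claim to
  triangular matrices. It bounds eigenvalues on bilinear forms without constructing a tensor
  square.\<close>

lemma congruence_eigenvalue:
  fixes M W :: "complex Matrix.mat"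
  assumes M: "M \<in> carrier_mat n n" and cp: "char_poly M = (\<Prod>e\<leftarrow>es. [:- e, 1:])"
    and W: "W \<in> carrier_mat n n" "W \<noteq> 0\<^sub>m n n" and eq: "transpose_mat M * W * M = \<mu> \<cdot>\<^sub>m W"
  shows "\<exists>a\<in>set es. \<exists>b\<in>set es. \<mu> = a * b"
proof -
  obtain B P Q where B: "similar_mat_wit M B P Q" "upper_triangular B" "Matrix.diag_mat B = es"
    using triangularize[OF M cp] .
  note s = similar_mat_witD2[OF M B(1)]
  note asc = assoc_mult_mat[of _ n n _ n _ n]
  define V where "V = transpose_mat P * W * P"
  have V: "V \<in> carrier_mat n n" using s W by (simp add: V_def)
  have PB: "P * B = M * P"
    using s by (simp add: asc)
  have "transpose_mat B * V * B = transpose_mat (P * B) * W * (P * B)"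
    using s W(1) by (simp add: V_def asc transpose_mult[OF s(6) s(5)])
  also have "\<dots> = transpose_mat P * (transpose_mat M * W * M) * P"
    unfolding PB using s(4-7) W(1) M by (simp add: asc transpose_mult[OF M s(6)])
  also have "\<dots> = \<mu> \<cdot>\<^sub>m V"
    unfolding eq V_def using s W(1)
    by (simp add: mult_smult_distrib[of _ n n _ n] mult_smult_assoc_mat[of _ n n _ n])
  finally have eqV: "transpose_mat B * V * B = \<mu> \<cdot>\<^sub>m V" .
  have "V \<noteq> 0\<^sub>m n n"
  proof
    assume V0: "V = 0\<^sub>m n n"
    have tQ: "transpose_mat Q * transpose_mat P = 1\<^sub>m n"
      using transpose_mult[OF s(6) s(7)] s(1) by simp
    have "W = (transpose_mat Q * transpose_mat P) * W * (P * Q)"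
      using W(1) by (simp add: tQ s(1))
    also have "\<dots> = transpose_mat Q * V * Q"
      using s(5-7) W(1) by (simp add: V_def asc)
    also have "\<dots> = 0\<^sub>m n n" using s by (simp add: V0)
    finally show False using W(2) by simp
  qed
  from triangular_congruence_eigenvalue[OF s(5) B(2) V this eqV]
  obtain i j where ij: "i < n" "j < n" "\<mu> = B $$ (i, i) * B $$ (j, j)" by blast
  have "B $$ (i, i) \<in> set es" "B $$ (j, j) \<in> set es"
    using ij s(5) unfolding B(3)[symmetric] diag_mat_def by auto
  then show ?thesis using ij(3) by blast
qed

section \<open>The characteristic polynomial on the lattice\<close>

text \<open>The enumeration \<iota> of the index type links matrices indexed by a type with matrices
  of explicit size.\<close>

definition coord_mat :: "(nat \<Rightarrow> 'n::finite) \<Rightarrow> nat \<Rightarrow> complex^'n^'n \<Rightarrow> complex Matrix.mat" where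
  "coord_mat \<iota> n A = Matrix.mat n n (\<lambda>(i, j). A $ \<iota> i $ \<iota> j)"

lemma coord_mat_carrier: "coord_mat \<iota> n A \<in> carrier_mat n n"
  by (simp add: coord_mat_def)

lemma matrix_vector_mult_index:
  fixes A :: "complex^'n^'n" and \<iota> :: "nat \<Rightarrow> 'n"
  assumes "bij_betw \<iota> {0..<n} UNIV"
  shows "(A *v v) $ l = (\<Sum>k\<in>{0..<n}. A $ l $ \<iota> k * v $ \<iota> k)"
  unfolding matrix_vector_mult_def using sum.reindex_bij_betw[OF assms, of "\<lambda>k. A $ l $ k * v $ k"] by simp

lemma eigenvector_of_char_poly_root:
  fixes A :: "complex^'n^'n" and \<iota> :: "nat \<Rightarrow> 'n"
  assumes \<iota>: "bij_betw \<iota> {0..<n} UNIV" and x: "poly (char_poly (coord_mat \<iota> n A)) x = 0"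
  shows "\<exists>v. v \<noteq> 0 \<and> A *v v = x *s v"
proof -
  let ?J = "coord_mat \<iota> n A"
  obtain v where v: "v \<in> carrier_vec n" "v \<noteq> 0\<^sub>v n" "?J *\<^sub>v v = x \<cdot>\<^sub>v v"
    using x unfolding eigenvalue_root_char_poly[OF coord_mat_carrier, symmetric] eigenvalue_def eigenvector_def
    by (auto simp: coord_mat_def)
  define w :: "complex^'n" where "w = (\<chi> l. vec_index v (inv_into {0..<n} \<iota> l))"
  have w: "w $ \<iota> i = vec_index v i" if "i < n" for i
    using that bij_betw_imp_inj_on[OF \<iota>] by (simp add: w_def)
  have ex: "\<exists>i<n. l = \<iota> i" for l
    using bij_betw_imp_surj_on[OF \<iota>] by (metis UNIV_I atLeastLessThan_iff imageE)
  have "w \<noteq> 0"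
  proof
    assume "w = 0"
    then have "vec_index v i = 0" if "i < n" for i using w[OF that] by simp
    then have "v = 0\<^sub>v n" using v(1) by (intro eq_vecI) auto
    then show False using v(2) by simp
  qed
  moreover have "A *v w = x *s w"
  proof (rule vec_eq_iff[THEN iffD2], rule allI)
    fix l
    obtain i where i: "i < n" "l = \<iota> i" using ex by blast
    have "(A *v w) $ l = (\<Sum>k\<in>{0..<n}. ?J $$ (i, k) * vec_index v k)"
      unfolding matrix_vector_mult_index[OF \<iota>] using i w by (intro sum.cong) (simp_all add: coord_mat_def)
    also have "\<dots> = vec_index (?J *\<^sub>v v) i"
      using i v(1) by (simp add: scalar_prod_def coord_mat_def)
    finally show "(A *v w) $ l = (x *s w) $ l" unfolding v(3) using i v(1) w by simp
  qed
  ultimately show ?thesis by blast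
qed

lemma coord_mat_transpose:
  "coord_mat \<iota> n (Finite_Cartesian_Product.transpose A) = transpose_mat (coord_mat \<iota> n A)"
  by (intro eq_matI) (auto simp: coord_mat_def Finite_Cartesian_Product.transpose_def)

text \<open>An eigenvector of the transpose, which has the same characteristic polynomial.\<close>

lemma covector_of_char_poly_root:
  fixes A :: "complex^'n^'n" and \<iota> :: "nat \<Rightarrow> 'n"
  assumes \<iota>: "bij_betw \<iota> {0..<n} UNIV" and x: "poly (char_poly (coord_mat \<iota> n A)) x = 0"
  shows "\<exists>w. w \<noteq> 0 \<and> (\<forall>u. (\<Sum>j\<in>UNIV. w $ j * (A *v u) $ j) = x * (\<Sum>j\<in>UNIV. w $ j * u $ j))"
proof -
  have "poly (char_poly (coord_mat \<iota> n (Finite_Cartesian_Product.transpose A))) x = 0"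
    unfolding coord_mat_transpose char_poly_transpose_mat[OF coord_mat_carrier] by (rule x)
  then obtain w where w: "w \<noteq> 0" "Finite_Cartesian_Product.transpose A *v w = x *s w"
    using eigenvector_of_char_poly_root[OF \<iota>] by blast
  have "(\<Sum>j\<in>UNIV. w $ j * (A *v u) $ j) = x * (\<Sum>j\<in>UNIV. w $ j * u $ j)" for u
  proof -
    have "(\<Sum>j\<in>UNIV. w $ j * (A *v u) $ j) = (\<Sum>k\<in>UNIV. (\<Sum>j\<in>UNIV. A $ j $ k * w $ j) * u $ k)"
      unfolding matrix_vector_mult_def vec_lambda_beta sum_distrib_left sum_distrib_right
      by (subst sum.swap) (simp add: mult_ac)
    also have "\<dots> = (\<Sum>k\<in>UNIV. (Finite_Cartesian_Product.transpose A *v w) $ k * u $ k)"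
      by (simp add: matrix_vector_mult_def Finite_Cartesian_Product.transpose_def)
    finally show ?thesis unfolding w(2) by (simp add: sum_distrib_left mult_ac)
  qed
  with w(1) show ?thesis by blast
qed

text \<open>The rank is written \<open>n + n\<close> to match the splitting into coordinates and
  their conjugates.\<close>

locale lattice_basis =
  fixes L :: "(complex^'n) set" and b :: "nat \<Rightarrow> complex^'n" and \<iota> :: "nat \<Rightarrow> 'n" and n :: nat
  assumes inj: "inj_on b {0..<n + n}" and ind: "independent (b ` {0..<n + n})"
    and span: "span (b ` {0..<n + n}) = UNIV" and L_eq: "L = zmod.span (b ` {0..<n + n})"
    and bij: "bij_betw \<iota> {0..<n} UNIV"
begin

lemma coeff_zero:
  assumes "(\<Sum>i\<in>{0..<n + n}. r i *\<^sub>R b i) = 0" "i < n + n"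
  shows "r i = 0"
proof -
  let ?I = "{0..<n + n}"
  have "(\<Sum>v\<in>b ` ?I. r (inv_into ?I b v) *\<^sub>R v) = (\<Sum>i\<in>?I. r i *\<^sub>R b i)"
    unfolding sum.reindex[OF inj] o_def by (intro sum.cong refl) (simp add: inv_into_f_f[OF inj])
  then have "r (inv_into ?I b (b i)) = 0"
    using independentD[OF ind, of "b ` ?I" "\<lambda>v. r (inv_into ?I b v)" "b i"] assms by simp
  then show ?thesis using inv_into_f_f[OF inj, of i] assms(2) by simp
qed

lemma coeff_unique:
  assumes "(\<Sum>i\<in>{0..<n + n}. r i *\<^sub>R b i) = (\<Sum>i\<in>{0..<n + n}. s i *\<^sub>R b i)" "i < n + n"
  shows "r i = s i"
  using coeff_zero[of "\<lambda>i. r i - s i" i] assms by (simp add: scaleR_diff_left sum_subtractf)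

definition represents :: "complex^'n^'n \<Rightarrow> int Matrix.mat \<Rightarrow> bool" where
  "represents A M \<longleftrightarrow> M \<in> carrier_mat (n + n) (n + n) \<and>
     (\<forall>j<n + n. A *v b j = (\<Sum>i\<in>{0..<n + n}. of_int (M $$ (i, j)) *\<^sub>R b i))"

lemma lattice_matrix:
  assumes AL: "\<And>l. l \<in> L \<Longrightarrow> A *v l \<in> L"
  obtains M where "represents A M"
proof -
  have "\<exists>u :: nat \<Rightarrow> int. A *v b j = (\<Sum>i\<in>{0..<n + n}. of_int (u i) *\<^sub>R b i)" if "j < n + n" for j
  proof -
    have "b j \<in> L" unfolding L_eq using that by (intro zmod.span_base) simp
    then have "A *v b j \<in> zmod.span (b ` {0..<n + n})" using AL L_eq by blast
    then obtain u :: "complex^'n \<Rightarrow> int" where "A *v b j = (\<Sum>v\<in>b ` {0..<n + n}. of_int (u v) *\<^sub>R v)"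
      by (auto simp: zmod.span_finite)
    then have "A *v b j = (\<Sum>i\<in>{0..<n + n}. of_int (u (b i)) *\<^sub>R b i)" by (simp add: sum.reindex[OF inj])
    then show ?thesis by (intro exI[of _ "\<lambda>i. u (b i)"])
  qed
  then have "\<forall>j. \<exists>u :: nat \<Rightarrow> int. j < n + n \<longrightarrow> A *v b j = (\<Sum>i\<in>{0..<n + n}. of_int (u i) *\<^sub>R b i)"
    by blast
  from choice[OF this] obtain U :: "nat \<Rightarrow> nat \<Rightarrow> int"
    where U: "\<forall>j<n + n. A *v b j = (\<Sum>i\<in>{0..<n + n}. of_int (U j i) *\<^sub>R b i)"
    by (elim exE) (rule that)
  show thesis
  proof (rule that[of "Matrix.mat (n + n) (n + n) (\<lambda>(i, j). U j i)"], unfold represents_def, intro conjI allI impI)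
    fix j assume j: "j < n + n"
    have "A *v b j = (\<Sum>i\<in>{0..<n + n}. of_int (U j i) *\<^sub>R b i)" using U j by blast
    also have "\<dots> = (\<Sum>i\<in>{0..<n + n}. of_int (Matrix.mat (n + n) (n + n) (\<lambda>(i, j). U j i) $$ (i, j)) *\<^sub>R b i)"
      using j by (intro sum.cong refl) simp
    finally show "A *v b j = (\<Sum>i\<in>{0..<n + n}. of_int (Matrix.mat (n + n) (n + n) (\<lambda>(i, j). U j i) $$ (i, j)) *\<^sub>R b i)" .
  qed simp
qed

text \<open>The matrix of \<open>A'\<close> is an integral inverse, so the determinant is a unit of
  the integers.\<close>

lemma matrix_unimodular:
  assumes M: "represents A M" and M': "represents A' M'" and inverse: "\<And>v. A *v (A' *v v) = v"
  shows "\<bar>Determinant.det M\<bar> = 1"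
proof -
  let ?I = "{0..<n + n}"
  have c: "M \<in> carrier_mat (n + n) (n + n)" "M' \<in> carrier_mat (n + n) (n + n)"
    using M M' by (simp_all add: represents_def)
  have "(M * M') $$ (k, j) = (if k = j then 1 else 0)" if kj: "k < n + n" "j < n + n" for k j
  proof -
    have "(\<Sum>k\<in>?I. (if k = j then 1 else 0 :: real) *\<^sub>R b k) = (\<Sum>k\<in>?I. if k = j then b j else 0)"
      by (intro sum.cong) auto
    also have "\<dots> = A *v (A' *v b j)" unfolding inverse using kj by simp
    also have "\<dots> = A *v (\<Sum>i\<in>?I. of_int (M' $$ (i, j)) *\<^sub>R b i)"
      using M' kj unfolding represents_def by simp
    also have "\<dots> = (\<Sum>i\<in>?I. of_int (M' $$ (i, j)) *\<^sub>R (A *v b i))"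
      using linear_sum[OF bounded_linear.linear[OF matrix_vector_mul_bounded_linear[of A]], of "\<lambda>i. of_int (M' $$ (i, j)) *\<^sub>R b i" ?I]
      by (simp add: matrix_vector_mult_scaleR_complex)
    also have "\<dots> = (\<Sum>i\<in>?I. \<Sum>k\<in>?I. (of_int (M' $$ (i, j)) * of_int (M $$ (k, i))) *\<^sub>R b k)"
      using M unfolding represents_def by (intro sum.cong refl) (simp add: scaleR_sum_right)
    also have "\<dots> = (\<Sum>k\<in>?I. of_int ((M * M') $$ (k, j)) *\<^sub>R b k)"
      by (subst sum.swap, intro sum.cong refl)
        (use c kj in \<open>simp add: scalar_prod_def scaleR_sum_left mult.commute\<close>)
    finally have "(if k = j then 1 else 0 :: real) = of_int ((M * M') $$ (k, j))"
      by (rule coeff_unique[OF _ kj(1)])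
    then have "of_int ((M * M') $$ (k, j)) = (of_int (if k = j then 1 else 0) :: real)" by (simp split: if_splits)
    then show ?thesis by (simp only: of_int_eq_iff)
  qed
  then have "M * M' = 1\<^sub>m (n + n)" using c by (intro eq_matI) auto
  then have "Determinant.det M * Determinant.det M' = 1" using det_mult[OF c] by simp
  then have "\<bar>Determinant.det M * Determinant.det M'\<bar> = 1" by simp
  then show ?thesis by (rule abs_zmult_eq_1)
qed

lemma sum_double: "(\<Sum>k\<in>{0..<n + n}. g k) = (\<Sum>k\<in>{0..<n}. g k) + (\<Sum>k\<in>{0..<n}. g (k + n))"
  using sum.atLeastLessThan_concat[of 0 n "n + n" g] sum.shift_bounds_nat_ivl[of g 0 n n] by simp

text \<open>A kernel vector and its conjugate both give complex linear relations between the
  \<open>b k\<close>. Their sum and difference show that the real and the imaginary parts are real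
  relations, which are trivial.\<close>

lemma period_matrix_nonsingular:
  "Determinant.det (Matrix.mat (n + n) (n + n) (\<lambda>(i, j). if i < n then b j $ \<iota> i else cnj (b j $ \<iota> (i - n)))) \<noteq> 0"
proof
  let ?S = "Matrix.mat (n + n) (n + n) (\<lambda>(i, j). if i < n then b j $ \<iota> i else cnj (b j $ \<iota> (i - n)))"
  let ?I = "{0..<n + n}"
  assume "Determinant.det ?S = 0"
  moreover have "?S \<in> carrier_mat (n + n) (n + n)" by simp
  ultimately obtain v where v: "v \<in> carrier_vec (n + n)" "v \<noteq> 0\<^sub>v (n + n)" "?S *\<^sub>v v = 0\<^sub>v (n + n)"
    using det_0_iff_vec_prod_zero[of ?S "n + n"] by blast
  have row: "(\<Sum>k\<in>?I. ?S $$ (i, k) * vec_index v k) = 0" if "i < n + n" for i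
  proof -
    have "vec_index (?S *\<^sub>v v) i = (\<Sum>k\<in>?I. ?S $$ (i, k) * vec_index v k)"
      using that v(1) by (simp add: scalar_prod_def)
    then show ?thesis unfolding v(3) using that by simp
  qed
  have 1: "(\<Sum>k\<in>?I. vec_index v k * b k $ \<iota> i) = 0" if "i < n" for i
    using row[of i] that by (simp add: mult.commute)
  have 2: "(\<Sum>k\<in>?I. cnj (vec_index v k) * b k $ \<iota> i) = 0" if "i < n" for i
  proof -
    have "(\<Sum>k\<in>?I. cnj (b k $ \<iota> i) * vec_index v k) = 0" using row[of "i + n"] that by simp
    then have "cnj (\<Sum>k\<in>?I. cnj (b k $ \<iota> i) * vec_index v k) = 0" by simp
    then show ?thesis by (simp add: mult.commute)
  qed
  have ex: "\<exists>i<n. l = \<iota> i" for l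
    using bij_betw_imp_surj_on[OF bij] by (metis UNIV_I atLeastLessThan_iff imageE)
  have "(\<Sum>k\<in>?I. (2 * Re (vec_index v k)) *\<^sub>R b k) = 0"
  proof (rule vec_eq_iff[THEN iffD2], rule allI)
    fix l obtain i where i: "i < n" "l = \<iota> i" using ex by blast
    have "(\<Sum>k\<in>?I. (2 * Re (vec_index v k)) *\<^sub>R b k) $ l = (\<Sum>k\<in>?I. vec_index v k * b k $ \<iota> i + cnj (vec_index v k) * b k $ \<iota> i)"
      unfolding sum_component vector_scaleR_component i(2) scaleR_conv_of_real[where 'a=complex] distrib_right[symmetric] complex_add_cnj by simp
    then show "(\<Sum>k\<in>?I. (2 * Re (vec_index v k)) *\<^sub>R b k) $ l = 0 $ l"
      unfolding sum.distrib 1[OF i(1)] 2[OF i(1)] by simp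
  qed
  from coeff_zero[OF this] have re: "Re (vec_index v k) = 0" if "k < n + n" for k using that by simp
  have "(\<Sum>k\<in>?I. (2 * Im (vec_index v k)) *\<^sub>R b k) = 0"
  proof (rule vec_eq_iff[THEN iffD2], rule allI)
    fix l obtain i where i: "i < n" "l = \<iota> i" using ex by blast
    have "\<i> * (\<Sum>k\<in>?I. (2 * Im (vec_index v k)) *\<^sub>R b k) $ l = (\<Sum>k\<in>?I. vec_index v k * b k $ \<iota> i - cnj (vec_index v k) * b k $ \<iota> i)"
      unfolding sum_component vector_scaleR_component i(2) scaleR_conv_of_real[where 'a=complex] left_diff_distrib[symmetric] complex_diff_cnj sum_distrib_left
      by (intro sum.cong refl) (simp add: mult_ac)
    then show "(\<Sum>k\<in>?I. (2 * Im (vec_index v k)) *\<^sub>R b k) $ l = 0 $ l"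
      unfolding sum_subtractf 1[OF i(1)] 2[OF i(1)] by simp
  qed
  from coeff_zero[OF this] have im: "Im (vec_index v k) = 0" if "k < n + n" for k using that by simp
  have "v = 0\<^sub>v (n + n)" using v(1) re im by (intro eq_vecI) (auto simp: complex_eq_iff)
  then show False using v(2) by simp
qed

text \<open>The period matrix \<open>S\<close>, with the lattice basis in its upper and the
  conjugates in its lower half, carries the integral matrix into the block diagonal matrix
  \<open>D\<close> of \<open>A\<close> and its conjugate.\<close>

lemma char_poly_lattice:
  assumes M: "represents A M" and cp: "char_poly (coord_mat \<iota> n A) = (\<Prod>e\<leftarrow>es. [:- e, 1:])"
  shows "char_poly (map_mat complex_of_int M) = (\<Prod>e\<leftarrow>es @ map cnj es. [:- e, 1:])"
proof -
  let ?I = "{0..<n + n}" and ?J = "coord_mat \<iota> n A" and ?M = "map_mat complex_of_int M"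
  define S where "S = Matrix.mat (n + n) (n + n) (\<lambda>(i, j). if i < n then b j $ \<iota> i else cnj (b j $ \<iota> (i - n)))"
  define D where "D = Matrix.mat (n + n) (n + n) (\<lambda>(i, j). if i < n then if j < n then A $ \<iota> i $ \<iota> j else 0
    else if j < n then 0 else cnj (A $ \<iota> (i - n) $ \<iota> (j - n)))"
  have c: "S \<in> carrier_mat (n + n) (n + n)" "D \<in> carrier_mat (n + n) (n + n)" "?M \<in> carrier_mat (n + n) (n + n)"
    using M by (simp_all add: S_def D_def represents_def)
  have "S * ?M = D * S"
  proof (rule eq_matI)
    fix i j assume "i < dim_row (D * S)" "j < dim_col (D * S)"
    then have ij: "i < n + n" "j < n + n" using c by simp_all
    have Mc: "(\<Sum>k\<in>?I. complex_of_int (M $$ (k, j)) * b k $ l) = (A *v b j) $ l" for l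
      using M ij(2) unfolding represents_def by (simp add: scaleR_conv_of_real[where 'a=complex])
    have lhs: "(S * ?M) $$ (i, j) = (\<Sum>k\<in>?I. S $$ (i, k) * complex_of_int (M $$ (k, j)))"
      using ij c M by (simp add: scalar_prod_def represents_def)
    have rhs: "(D * S) $$ (i, j) = (\<Sum>k\<in>?I. D $$ (i, k) * S $$ (k, j))"
      using ij c by (simp add: scalar_prod_def)
    show "(S * ?M) $$ (i, j) = (D * S) $$ (i, j)"
    proof (cases "i < n")
      case True
      have "(\<Sum>k\<in>?I. S $$ (i, k) * complex_of_int (M $$ (k, j))) = (A *v b j) $ \<iota> i"
        unfolding Mc[symmetric] using True ij by (intro sum.cong refl) (simp add: S_def)
      moreover have "(\<Sum>k\<in>?I. D $$ (i, k) * S $$ (k, j)) = (A *v b j) $ \<iota> i"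
        unfolding sum_double matrix_vector_mult_index[OF bij] using True ij by (simp add: S_def D_def)
      ultimately show ?thesis unfolding lhs rhs by simp
    next
      case False
      have "(\<Sum>k\<in>?I. S $$ (i, k) * complex_of_int (M $$ (k, j))) = cnj ((A *v b j) $ \<iota> (i - n))"
        unfolding Mc[symmetric] cnj_sum using False ij by (intro sum.cong refl) (simp add: S_def)
      moreover have "(\<Sum>k\<in>?I. D $$ (i, k) * S $$ (k, j)) = cnj ((A *v b j) $ \<iota> (i - n))"
        unfolding sum_double matrix_vector_mult_index[OF bij] cnj_sum using False ij by (simp add: S_def D_def)
      ultimately show ?thesis unfolding lhs rhs by simp
    qed
  qed (use c in simp_all)
  have "S \<in> Units (ring_mat TYPE(complex) (n + n) ())"
    by (rule det_non_zero_imp_unit[OF c(1)]) (unfold S_def, rule period_matrix_nonsingular)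
  then obtain T where T: "T \<in> carrier_mat (n + n) (n + n)" "T * S = 1\<^sub>m (n + n)" "S * T = 1\<^sub>m (n + n)"
    unfolding Units_def ring_mat_def by auto
  have "?M = T * (S * ?M)"
    using c T(1) by (simp only: assoc_mult_mat[OF T(1) c(1) c(3), symmetric] T(2) left_mult_one_mat[OF c(3)])
  also have "\<dots> = T * D * S"
    unfolding \<open>S * ?M = D * S\<close> by (rule assoc_mult_mat[OF T(1) c(2) c(1), symmetric])
  finally have "similar_mat ?M D"
    by (intro similar_matI[of _ _ T S "n + n"]) (use c T in simp_all)
  then have "char_poly ?M = char_poly D" by (rule char_poly_similar)
  interpret cnj: comm_ring_hom cnj by unfold_locales simp_all
  interpret cnjp: map_poly_comm_ring_hom cnj ..
  have lin: "map_poly cnj [:- e, 1:] = [:- cnj e, 1:]" for e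
    by (intro poly_eqI) (simp add: coeff_map_poly coeff_pCons split: nat.split)
  have cpc: "char_poly (map_mat cnj ?J) = (\<Prod>e\<leftarrow>map cnj es. [:- e, 1:])"
    unfolding cnj.char_poly_hom[OF coord_mat_carrier] cp
  proof (induction es)
    case (Cons e es)
    show ?case unfolding list.map prod_list.Cons cnjp.hom_mult Cons lin ..
  qed simp
  have "D = four_block_mat ?J (0\<^sub>m n n) (0\<^sub>m n n) (map_mat cnj ?J)"
    by (intro eq_matI) (auto simp: D_def coord_mat_def)
  then have "char_poly D = char_poly ?J * char_poly (map_mat cnj ?J)"
    by (rule char_poly_0_block[OF _ exI[of _ es] exI[of _ "map cnj es"]])
      (use cp cpc coord_mat_carrier[of \<iota> n A] in simp_all)
  then show ?thesis unfolding \<open>char_poly ?M = char_poly D\<close> cp cpc by simp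
qed

text \<open>In the lattice basis the invariance of \<beta> is a congruence relation for its Gram
  matrix \<open>W\<close>, to which \<open>congruence_eigenvalue\<close> applies.\<close>

lemma invariant_form_eigenvalue:
  fixes \<beta> :: "complex^'n \<Rightarrow> complex^'n \<Rightarrow> complex"
  assumes M: "represents A M" and cp: "char_poly (map_mat complex_of_int M) = (\<Prod>e\<leftarrow>es. [:- e, 1:])"
    and \<beta>: "bilinear \<beta>" "\<exists>u v. \<beta> u v \<noteq> 0" "\<And>u v. \<beta> (A *v u) (A *v v) = \<mu> * \<beta> u v"
  shows "\<exists>c\<in>set es. \<exists>d\<in>set es. \<mu> = c * d"
proof -
  let ?I = "{0..<n + n}" and ?M = "map_mat complex_of_int M"
  define W where "W = Matrix.mat (n + n) (n + n) (\<lambda>(i, j). \<beta> (b i) (b j))"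
  have c: "M \<in> carrier_mat (n + n) (n + n)" "W \<in> carrier_mat (n + n) (n + n)"
    using M by (simp_all add: W_def represents_def)
  have linb: "linear (\<beta> u)" "linear (\<lambda>u. \<beta> u v)" for u v
    by (rule \<beta>(1)[unfolded bilinear_def, THEN conjunct1, THEN spec] \<beta>(1)[unfolded bilinear_def, THEN conjunct2, THEN spec])+
  have "W \<noteq> 0\<^sub>m (n + n) (n + n)"
  proof
    assume W0: "W = 0\<^sub>m (n + n) (n + n)"
    have z: "\<beta> (b i) (b j) = 0" if "i < n + n" "j < n + n" for i j
      using arg_cong[OF W0, of "\<lambda>W. W $$ (i, j)"] that by (simp add: W_def)
    have "\<beta> u v = 0" for u v
    proof (rule linear_eq_0_on_span[OF linb(1), of "b ` ?I"])
      show "v \<in> span (b ` ?I)" by (simp only: span UNIV_I)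
      fix y assume "y \<in> b ` ?I"
      then obtain j where j: "j < n + n" "y = b j" by auto
      show "\<beta> u y = 0"
        by (rule linear_eq_0_on_span[OF linb(2), of "b ` ?I"]) (use z j span in auto)
    qed
    then show False using \<beta>(2) by blast
  qed
  moreover have "transpose_mat ?M * W * ?M = \<mu> \<cdot>\<^sub>m W"
  proof (rule eq_matI)
    fix i j assume "i < dim_row (\<mu> \<cdot>\<^sub>m W)" "j < dim_col (\<mu> \<cdot>\<^sub>m W)"
    then have ij: "i < n + n" "j < n + n" using c by simp_all
    have "(transpose_mat ?M * W * ?M) $$ (i, j)
        = (\<Sum>k\<in>?I. of_int (M $$ (k, i)) * (\<Sum>l\<in>?I. W $$ (k, l) * of_int (M $$ (l, j))))"
      using ij c by (simp add: scalar_prod_def)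
    also have "\<dots> = (\<Sum>k\<in>?I. of_int (M $$ (k, i)) *\<^sub>R (\<Sum>l\<in>?I. of_int (M $$ (l, j)) *\<^sub>R \<beta> (b k) (b l)))"
      by (intro sum.cong refl) (simp add: W_def scaleR_conv_of_real mult.commute)
    also have "\<dots> = (\<Sum>k\<in>?I. of_int (M $$ (k, i)) *\<^sub>R \<beta> (b k) (\<Sum>l\<in>?I. of_int (M $$ (l, j)) *\<^sub>R b l))"
      by (simp only: linear_sum[OF linb(1)] linear_scale[OF linb(1)])
    also have "\<dots> = \<beta> (\<Sum>k\<in>?I. of_int (M $$ (k, i)) *\<^sub>R b k) (\<Sum>l\<in>?I. of_int (M $$ (l, j)) *\<^sub>R b l)"
      by (simp only: linear_sum[OF linb(2)] linear_scale[OF linb(2)])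
    also have "\<dots> = \<beta> (A *v b i) (A *v b j)" using M ij by (simp add: represents_def)
    finally show "(transpose_mat ?M * W * ?M) $$ (i, j) = (\<mu> \<cdot>\<^sub>m W) $$ (i, j)"
      unfolding \<beta>(3) using ij by (simp add: W_def)
  qed (use c in simp_all)
  ultimately show ?thesis
    by (intro congruence_eigenvalue[OF _ cp c(2)]) (use c in simp_all)
qed

end

section \<open>Rational polynomials in an endomorphism\<close>

primrec matpow :: "complex^'n^'n \<Rightarrow> nat \<Rightarrow> complex^'n^'n" where
  "matpow A 0 = mat 1"
| "matpow A (Suc k) = A ** matpow A k"

definition poly_mat :: "rat poly \<Rightarrow> complex^'n^'n \<Rightarrow> complex^'n^'n" where
  "poly_mat q A = (\<Sum>k\<le>degree q. of_rat (coeff q k) *\<^sub>R matpow A k)"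

lemma scaleR_matrix_vector: "(r *\<^sub>R T) *v v = r *\<^sub>R ((T :: complex^'n^'m) *v v)"
  by (simp add: Finite_Cartesian_Product.vec_eq_iff matrix_vector_mult_def scaleR_sum_right)

lemma poly_mat_vector:
  fixes A :: "complex^'n^'n"
  shows "poly_mat q A *v v = (\<Sum>k\<le>degree q. of_rat (coeff q k) *\<^sub>R (matpow A k *v v))"
proof -
  have "linear (\<lambda>T :: complex^'n^'n. T *v v)"
    by (intro linearI matrix_vector_mult_add_rdistrib scaleR_matrix_vector)
  note s = linear_sum[OF this]
  show ?thesis unfolding poly_mat_def s scaleR_matrix_vector ..
qed

lemma matpow_commute: "matpow A k *v (A *v v) = A *v (matpow A k *v v)"
  by (induction k) (simp_all add: matrix_vector_mul_assoc[symmetric])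

lemma poly_mat_commute: "poly_mat q A *v (A *v v) = A *v (poly_mat q A *v v)"
  unfolding poly_mat_vector matpow_commute
    linear_sum[OF bounded_linear.linear[OF matrix_vector_mul_bounded_linear[of A]]]
    matrix_vector_mult_scaleR_complex ..

lemma poly_mat_eigenvector:
  assumes "A *v v = x *s v"
  shows "poly_mat q A *v v = poly (map_poly of_rat q) x *s v"
proof -
  have pow: "matpow A k *v v = x ^ k *s v" for k
    by (induction k) (simp_all add: matrix_vector_mul_assoc[symmetric] vector_scalar_commute assms)
  have r: "complex_of_real (of_rat c) = of_rat c" for c
    by (cases c) (simp add: of_rat_rat)
  show ?thesis
    unfolding poly_mat_vector pow poly_altdef Finite_Cartesian_Product.vec_eq_iff
    by (simp add: degree_map_poly coeff_map_poly scaleR_conv_of_real[where 'a=complex] r sum_distrib_right mult.assoc)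
qed

lemma common_denominator:
  fixes c :: "nat \<Rightarrow> rat"
  shows "\<exists>N :: int. N > 0 \<and> (\<forall>k\<le>d. \<exists>z :: int. of_int N * c k = of_int z)"
proof (induction d)
  have single: "\<exists>N :: int. N > 0 \<and> (\<exists>z :: int. of_int N * r = of_int z)" for r :: rat
  proof (cases r)
    case (Fract p q)
    have "of_int q * r = of_int p"
      unfolding Fract(1) Fract_of_int_quotient using Fract(2) by simp
    then show ?thesis using Fract(2) by blast
  qed
  {
    case 0
    show ?case using single[of "c 0"] by simp
  next
    case (Suc d)
    obtain N where N: "N > 0" "\<And>k. k \<le> d \<Longrightarrow> \<exists>z :: int. of_int N * c k = of_int z" using Suc by blast
    obtain N' z' where N': "(N' :: int) > 0" "of_int N' * c (Suc d) = of_int z'" using single by blast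
    show ?case
    proof (rule exI[of _ "N * N'"], intro conjI allI impI)
      show "N * N' > 0" using N(1) N'(1) by simp
      fix k assume k: "k \<le> Suc d"
      show "\<exists>z :: int. of_int (N * N') * c k = of_int z"
      proof (cases "k = Suc d")
        case True
        have "of_int (N * N') * c k = of_int (N * z')" unfolding True of_int_mult N'(2)[symmetric] by simp
        then show ?thesis by blast
      next
        case False
        then obtain z :: int where z: "of_int N * c k = of_int z" using N(2) k by (metis le_Suc_eq)
        have "of_int (N * N') * c k = of_int (N' * z)" unfolding of_int_mult z[symmetric] by simp
        then show ?thesis by blast
      qed
    qed
  }
qed

text \<open>Clearing denominators yields an endomorphism of the lattice; a positive factor changes
  neither the kernel nor the commutation with \<open>A\<close>.\<close>

lemma poly_mat_integral:
  assumes L: "zmod.subspace L" and AL: "\<And>l. l \<in> L \<Longrightarrow> A *v l \<in> L"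
  obtains N :: int where "N > 0" "\<And>l. l \<in> L \<Longrightarrow> (of_int N *\<^sub>R poly_mat q A) *v l \<in> L"
proof -
  obtain N where N: "N > 0" "\<And>k. k \<le> degree q \<Longrightarrow> \<exists>z :: int. of_int N * coeff q k = of_int z"
    using common_denominator[of "degree q" "coeff q"] by blast
  have pow: "matpow A k *v l \<in> L" if "l \<in> L" for k l
    using that by (induction k) (simp_all add: matrix_vector_mul_assoc[symmetric] AL)
  show thesis
  proof (rule that[OF N(1)])
    fix l assume l: "l \<in> L"
    have "of_int N *\<^sub>R (of_rat (coeff q k) *\<^sub>R (matpow A k *v l)) \<in> L" if k: "k \<in> {..degree q}" for k
    proof -
      obtain z :: int where z: "of_int N * coeff q k = of_int z" using N(2) k by auto
      have "real_of_int N * of_rat (coeff q k) = real_of_int z"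
        using arg_cong[OF z, of "of_rat :: rat \<Rightarrow> real"] by (simp add: of_rat_mult)
      then show ?thesis
        using zmod.subspace_scale[OF L pow[OF l], of z k] by simp
    qed
    then show "(of_int N *\<^sub>R poly_mat q A) *v l \<in> L"
      unfolding scaleR_matrix_vector poly_mat_vector scaleR_sum_right by (rule zmod.subspace_sum[OF L])
  qed
qed

section \<open>The fibration\<close>

text \<open>\<open>E\<close> stands for the set of eigenvalues of \<open>A\<close>. A left
  eigenvector for one of largest modulus attains the square of this modulus; every eigenvalue on
  classes is a product of two factors from \<open>E\<close> and its conjugates, so none exceeds
  it.\<close>

lemma dynamical_degree1_torus:
  fixes L :: "(complex^'n) set"
  assumes lat: "lattice_group L" and f: "\<And>v. f (torus_proj L v) = torus_proj L (A *v v + b)"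
    and AL: "\<And>l. l \<in> L \<Longrightarrow> A *v l \<in> L"
    and E: "finite E" "E \<noteq> {}"
    and co: "\<And>e. e \<in> E \<Longrightarrow> \<exists>w. w \<noteq> 0 \<and> (\<forall>u. (\<Sum>j\<in>UNIV. w $ j * (A *v u) $ j) = e * (\<Sum>j\<in>UNIV. w $ j * u $ j))"
    and inv: "\<And>\<beta> \<mu>. bilinear \<beta> \<Longrightarrow> \<exists>u v. \<beta> u v \<noteq> 0 \<Longrightarrow> (\<And>u v. \<beta> (A *v u) (A *v v) = \<mu> * \<beta> u v) \<Longrightarrow>
      \<exists>c\<in>E \<union> cnj ` E. \<exists>d\<in>E \<union> cnj ` E. \<mu> = c * d"
  shows "dynamical_degree1 L f = (Max (cmod ` E))\<^sup>2"
  unfolding dynamical_degree1_def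
proof (rule cSup_eq_maximum)
  have "Max (cmod ` E) \<in> cmod ` E" using E by (intro Max_in) simp_all
  then obtain e where e: "e \<in> E" "Max (cmod ` E) = cmod e" by (elim imageE) (rule that)
  obtain w where w: "w \<noteq> 0" "\<And>u. (\<Sum>j\<in>UNIV. w $ j * (A *v u) $ j) = e * (\<Sum>j\<in>UNIV. w $ j * u $ j)"
    using co[OF e(1)] by blast
  have "H11_eigenvalue L f (e * cnj e)"
    by (rule H11_eigenvalue_of_covector[OF lat f AL w(2) w(1)])
  moreover have "(Max (cmod ` E))\<^sup>2 = cmod (e * cnj e)"
    unfolding e(2) by (simp add: norm_mult power2_eq_square)
  ultimately show "(Max (cmod ` E))\<^sup>2 \<in> {cmod \<mu> | \<mu>. H11_eigenvalue L f \<mu>}" by blast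
  fix r assume "r \<in> {cmod \<mu> | \<mu>. H11_eigenvalue L f \<mu>}"
  then obtain \<mu> where \<mu>: "r = cmod \<mu>" "H11_eigenvalue L f \<mu>" by blast
  obtain \<beta> where "bilinear \<beta>" "\<exists>u v. \<beta> u v \<noteq> 0" "\<And>u v. \<beta> (A *v u) (A *v v) = \<mu> * \<beta> u v"
    by (rule H11_eigenvalue_invariant_form[OF lat f AL \<mu>(2)]) (assumption, (rule that; assumption))
  from inv[OF this] obtain c d where cd: "c \<in> E \<union> cnj ` E" "d \<in> E \<union> cnj ` E" "\<mu> = c * d" by blast
  have le: "cmod c \<le> Max (cmod ` E)" if "c \<in> E \<union> cnj ` E" for c
    using that E(1) by (intro Max_ge) auto
  show "r \<le> (Max (cmod ` E))\<^sup>2"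
    unfolding \<mu>(1) cd(3) norm_mult power2_eq_square
    by (intro mult_mono le cd norm_ge_zero order_trans[OF norm_ge_zero le[OF cd(1)]])
qed

lemma det_char_poly_roots:
  fixes A :: "complex Matrix.mat"
  assumes A: "A \<in> carrier_mat n n" and cp: "char_poly A = (\<Prod>e\<leftarrow>es. [:- e, 1:])"
  shows "Determinant.det A = prod_list es"
proof -
  obtain B P Q where B: "similar_mat_wit A B P Q" "upper_triangular B" "Matrix.diag_mat B = es"
    using triangularize[OF A cp] .
  have "similar_mat A B" unfolding similar_mat_def using B(1) by blast
  from det_similar[OF this] show ?thesis
    using det_upper_triangular[OF B(2) similar_mat_witD2(5)[OF A B(1)]] B(3) by simp
qed

theorem theorem2:
  fixes L :: "(complex^3) set" and f :: "(complex^3) set \<Rightarrow> (complex^3) set"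
  assumes "lattice_group L"
    and "f \<in> Aut (torus L)"
    and "dynamical_degree1 L f > 1"
    and "salem_number (dynamical_degree1 L f)"
  shows "\<exists>(Y :: (complex^3) set fspace) \<pi>. nontrivial_equivariant_fibration (torus L) f Y \<pi>"
proof -
  note lat = assms(1)
  have L: "zmod.subspace L" "discrete L" using lat by (simp_all add: lattice_group_def)
  obtain A A' v0 where f: "\<And>v. f (torus_proj L v) = torus_proj L (A *v v + v0)"
    and inverse: "\<And>v. A *v (A' *v v) = v" "\<And>v. A' *v (A *v v) = v"
    and AL: "\<And>l. l \<in> L \<Longrightarrow> A *v l \<in> L" "\<And>l. l \<in> L \<Longrightarrow> A' *v l \<in> L"
    by (rule Aut_torus_imp_affine[OF lat assms(2)]) (rule that; assumption)
  show ?thesis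
  proof (cases "\<exists>q u k. poly_mat q A *v u \<noteq> 0 \<and> k \<noteq> 0 \<and> poly_mat q A *v k = 0")
    case True
    then obtain q u k where q: "poly_mat q A *v u \<noteq> 0" "k \<noteq> 0" "poly_mat q A *v k = 0"
      by (elim exE conjE) (rule that)
    obtain N :: int where N: "N > 0" "\<And>l. l \<in> L \<Longrightarrow> (of_int N *\<^sub>R poly_mat q A) *v l \<in> L"
      using poly_mat_integral[OF L(1) AL(1)] by blast
    show ?thesis
    proof (rule fibration_of_endomorphism[OF L N(2) _ q(2) _ _ inverse AL f])
      show "(of_int N *\<^sub>R poly_mat q A) *v u \<noteq> 0" "(of_int N *\<^sub>R poly_mat q A) *v k = 0"
        unfolding scaleR_matrix_vector using N(1) q by simp_all
      show "(of_int N *\<^sub>R poly_mat q A) *v (A *v v) = A *v ((of_int N *\<^sub>R poly_mat q A) *v v)" for v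
        unfolding scaleR_matrix_vector poly_mat_commute matrix_vector_mult_scaleR_complex ..
    qed
  next
    case False
    define n where "n = CARD(3)"
    obtain B where B: "finite B" "card B = 2 * CARD(3)" "independent B" "span B = UNIV" "L = zmod.span B"
      using lattice_group_basis[OF lat] .
    obtain b where b: "bij_betw b {0..<n + n} B"
      using ex_bij_betw_nat_finite[OF B(1)] unfolding B(2) n_def by (auto simp: mult_2)
    obtain \<iota> :: "nat \<Rightarrow> 3" where \<iota>: "bij_betw \<iota> {0..<n} UNIV"
      using ex_bij_betw_nat_finite[of "UNIV :: 3 set"] unfolding n_def by auto
    have im: "b ` {0..<n + n} = B" by (rule bij_betw_imp_surj_on[OF b])
    interpret lattice_basis L b \<iota> n
      by unfold_locales (use im B b \<iota> in \<open>auto intro: bij_betw_imp_inj_on\<close>)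
    obtain as where as: "char_poly (coord_mat \<iota> n A) = (\<Prod>e\<leftarrow>as. [:- e, 1:])" "length as = n"
      using char_poly_factorized[OF coord_mat_carrier[of \<iota> n A]] by blast
    obtain x y z where xyz: "as = [x, y, z]"
      using as(2) unfolding n_def by (auto simp: numeral_3_eq_3 length_Suc_conv)
    obtain M where M: "represents A M" using lattice_matrix[OF AL(1)] by blast
    obtain M' where M': "represents A' M'" using lattice_matrix[OF AL(2)] by blast
    have Mc: "M \<in> carrier_mat (n + n) (n + n)" using M by (simp add: represents_def)
    define es where "es = as @ map cnj as"
    have cpM: "char_poly (map_mat complex_of_int M) = (\<Prod>e\<leftarrow>es. [:- e, 1:])"
      unfolding es_def by (rule char_poly_lattice[OF M as(1)])
    define P where "P = char_poly M"
    have root: "poly (char_poly (coord_mat \<iota> n A)) e = 0" if "e \<in> {x, y, z}" for e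
      using that unfolding as(1) xyz by (auto simp: poly_mult simp del: mult_pCons_left mult_pCons_right)
    have dyn: "dynamical_degree1 L f = (Max (cmod ` {x, y, z}))\<^sup>2"
    proof (rule dynamical_degree1_torus[OF lat f AL(1)])
      fix e assume "e \<in> {x, y, z}"
      then show "\<exists>w. w \<noteq> 0 \<and> (\<forall>u. (\<Sum>j\<in>UNIV. w $ j * (A *v u) $ j) = e * (\<Sum>j\<in>UNIV. w $ j * u $ j))"
        by (intro covector_of_char_poly_root[OF \<iota>] root)
    next
      fix \<beta> :: "complex^3 \<Rightarrow> complex^3 \<Rightarrow> complex" and \<mu>
      assume "bilinear \<beta>" "\<exists>u v. \<beta> u v \<noteq> 0" "\<And>u v. \<beta> (A *v u) (A *v v) = \<mu> * \<beta> u v"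
      from invariant_form_eigenvalue[OF M cpM this]
      show "\<exists>c\<in>{x, y, z} \<union> cnj ` {x, y, z}. \<exists>d\<in>{x, y, z} \<union> cnj ` {x, y, z}. \<mu> = c * d"
        unfolding es_def xyz set_append set_map by (simp only: list.set)
    qed simp_all
    obtain m :: "rat poly" where m: "poly (map_poly of_rat m) (complex_of_real (dynamical_degree1 L f)) = 0"
      "poly (map_poly of_rat m) (1 :: complex) \<noteq> 0"
      "\<And>w :: complex. poly (map_poly of_rat m) w = 0 \<Longrightarrow> w \<noteq> of_real (dynamical_degree1 L f) \<Longrightarrow>
        w \<noteq> of_real (1 / dynamical_degree1 L f) \<Longrightarrow> cmod w = 1"
      by (rule salem_number_min_poly[OF assms(4)]) (rule that; assumption)
    obtain D :: "rat poly" where D: "\<And>t :: complex. poly (map_poly of_rat D) t = (\<Prod>e\<leftarrow>es. poly (map_poly of_rat m) (t * e))"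
      using rational_poly_det[OF Mc cpM] by blast
    have "galois_data P m D x y z"
      unfolding galois_data_def
    proof (intro conjI ballI allI impI)
      have "map_poly complex_of_int P = (\<Prod>e\<leftarrow>es. [:- e, 1:])"
        unfolding P_def of_int_hom.char_poly_hom[OF Mc, symmetric] by (rule cpM)
      then show "map_poly complex_of_int P = conj_quad x * conj_quad y * conj_quad z"
        by (simp only: es_def xyz conj_quad_def list.map append.simps prod_list.Cons prod_list.Nil mult_1_left mult_1_right
            mult.assoc mult.left_commute mult.commute)
      \<comment> \<open>The product of all six roots is the squared modulus of the product of
        \<open>x\<close>, \<open>y\<close>, \<open>z\<close>, and it is the determinant of a
        unimodular matrix.\<close>
      have "of_int (Determinant.det M) = Determinant.det (map_mat complex_of_int M)"
        by (rule of_int_hom.hom_det[symmetric])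
      also have "\<dots> = prod_list es"
        by (rule det_char_poly_roots[OF _ cpM]) (use Mc in simp)
      finally have "cmod (of_int (Determinant.det M)) = (cmod x * cmod y * cmod z)\<^sup>2"
        by (simp add: es_def xyz norm_mult power2_eq_square mult_ac)
      moreover have "cmod (of_int (Determinant.det M)) = 1"
        using matrix_unimodular[OF M M' inverse(1)] by (simp flip: of_int_abs)
      ultimately have "(cmod x * cmod y * cmod z)\<^sup>2 = 1" by simp
      moreover have "0 \<le> cmod x * cmod y * cmod z" by simp
      ultimately show "cmod x * cmod y * cmod z = 1" by (simp only: power2_eq_1_iff) linarith
    next
      fix u v q assume uv: "u \<in> {x, y, z}" "v \<in> {x, y, z}" and q: "poly (map_poly of_rat q) u = 0"
      obtain k where k: "k \<noteq> 0" "A *v k = u *s k"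
        using eigenvector_of_char_poly_root[OF \<iota> root[OF uv(1)]] by blast
      obtain k' where k': "k' \<noteq> 0" "A *v k' = v *s k'"
        using eigenvector_of_char_poly_root[OF \<iota> root[OF uv(2)]] by blast
      \<comment> \<open>Having a non-zero kernel vector \<open>k\<close>, the matrix
        \<open>poly_mat q A\<close> must be zero in this case, so it also kills the eigenvector
        \<open>k'\<close> for \<open>v\<close>.\<close>
      have "poly_mat q A *v k = 0" unfolding poly_mat_eigenvector[OF k(2)] q by simp
      then have "poly_mat q A *v k' = 0" using False k(1) by blast
      then show "poly (map_poly of_rat q) v = 0"
        unfolding poly_mat_eigenvector[OF k'(2)] using k'(1) by simp
    next
      fix t
      show "poly (map_poly of_rat D) t =
          (\<Prod>w\<leftarrow>[x, y, z]. poly (map_poly of_rat m) (t * w) * poly (map_poly of_rat m) (t * cnj w))"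
        unfolding D es_def xyz by (simp add: mult_ac)
    qed
    then have False
      by (rule galois_data_salem_contradiction[OF _ _ assms(3) m]) (simp add: dyn)
    then show ?thesis ..
  qed
qed

end
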